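(* Let $G$ be a group, let $n$ be a positive integer, and let ${\rm Rep}_n(G)$ be the representation variety of degree $n$ for $G$ over $\mathbb{Z}$. For every integer $m$ with $0<m<n$, the absolutely $m$-dense representations in ${\rm Rep}_n(G)$ form an open subscheme of ${\rm Rep}_n(G)$; that is, the set of points $x\in{\rm Rep}_n(G)$ whose associated representation $\rho_x: G\to{\rm GL}_n(k(x))$ is absolutely $m$-dense is open. In particular, the absolutely dense representations in ${\rm Rep}_n(G)$ form an open subscheme of ${\rm Rep}_n(G)$.
   Context: ${\rm Rep}_n(G)$ is the affine scheme over $\mathbb{Z}$ representing the contravariant functor from schemes to sets sending $X$ to the set of group homomorphisms $\rho: G\to {\rm GL}_n(\Gamma(X,\mathcal{O}_X))$. A point $x\in{\rm Rep}_n(G)$ with residue field $k(x)$ determines a representation $\rho_x: G\to{\rm GL}_n(k(x))$ (the specialization of the universal representation). Let $V$ be an $n$-dimensional vector space over a field $k$ and $\rho: G\to{\rm GL}(V)$ a representation. $\rho$ is $m$-dense if $\wedge^m\rho: G\to{\rm GL}(\wedge^m V)$ is irreducible, and dense if it is $m$-dense for each $0<m<n$. $\rho$ is absolutely $m$-dense (resp. absolutely dense) if $\rho\otimes_k\overline{k}: G\to{\rm GL}(V\otimes_k\overline{k})$ is $m$-dense (resp. dense), where $\overline{k}$ is an algebraic closure of $k$. *)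

theory Defs
  imports
    "HOL-Algebra.Algebraic_Closure"
    "HOL-Library.Poly_Mapping"
    "HOL-Analysis.Abstract_Topology"
begin

section \<open>Matrices over a ring\<close>

text \<open>An \<open>n \<times> n\<close> matrix over \<open>R\<close> is an extensional function on \<open>{..<n} \<times> {..<n}\<close>.\<close>

definition mat_ring :: "('a, 'b) ring_scheme \<Rightarrow> nat \<Rightarrow> (nat \<times> nat \<Rightarrow> 'a) ring" where
  "mat_ring R n =
    \<lparr> carrier = {..<n} \<times> {..<n} \<rightarrow>\<^sub>E carrier R,
      monoid.mult = (\<lambda>A B. \<lambda>(i, j) \<in> {..<n} \<times> {..<n}. \<Oplus>\<^bsub>R\<^esub>k\<in>{..<n}. A (i, k) \<otimes>\<^bsub>R\<^esub> B (k, j)),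
      monoid.one = (\<lambda>(i, j) \<in> {..<n} \<times> {..<n}. if i = j then \<one>\<^bsub>R\<^esub> else \<zero>\<^bsub>R\<^esub>),
      ring.zero = (\<lambda>(i, j) \<in> {..<n} \<times> {..<n}. \<zero>\<^bsub>R\<^esub>),
      ring.add = (\<lambda>A B. \<lambda>(i, j) \<in> {..<n} \<times> {..<n}. A (i, j) \<oplus>\<^bsub>R\<^esub> B (i, j)) \<rparr>"

definition GL :: "('a, 'b) ring_scheme \<Rightarrow> nat \<Rightarrow> (nat \<times> nat \<Rightarrow> 'a) monoid" where
  "GL R n = units_of (mat_ring R n)"

definition mat_map :: "nat \<Rightarrow> ('a \<Rightarrow> 'b) \<Rightarrow> (nat \<times> nat \<Rightarrow> 'a) \<Rightarrow> (nat \<times> nat \<Rightarrow> 'b)" where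
  "mat_map n f A = (\<lambda>(i, j) \<in> {..<n} \<times> {..<n}. f (A (i, j)))"

section \<open>Modules and exterior powers\<close>

text \<open>
  The record type \<^typ>\<open>('a, 'b) module\<close> extends \<^typ>\<open>'b ring\<close>; the fields \<open>mult\<close> and
  \<open>one\<close> play no role for modules and are left undefined in the constructions below.
\<close>

definition coord_space :: "('a, 'b) ring_scheme \<Rightarrow> nat \<Rightarrow> ('a, nat \<Rightarrow> 'a) module" where
  "coord_space R n =
    \<lparr> carrier = {..<n} \<rightarrow>\<^sub>E carrier R, monoid.mult = undefined, monoid.one = undefined,
      ring.zero = (\<lambda>i \<in> {..<n}. \<zero>\<^bsub>R\<^esub>),
      ring.add = (\<lambda>v w. \<lambda>i \<in> {..<n}. v i \<oplus>\<^bsub>R\<^esub> w i),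
      module.smult = (\<lambda>a v. \<lambda>i \<in> {..<n}. a \<otimes>\<^bsub>R\<^esub> v i) \<rparr>"

definition mat_act ::
    "('a, 'b) ring_scheme \<Rightarrow> nat \<Rightarrow> (nat \<times> nat \<Rightarrow> 'a) \<Rightarrow> (nat \<Rightarrow> 'a) \<Rightarrow> (nat \<Rightarrow> 'a)" where
  "mat_act R n A v = (\<lambda>i \<in> {..<n}. \<Oplus>\<^bsub>R\<^esub>j\<in>{..<n}. A (i, j) \<otimes>\<^bsub>R\<^esub> v j)"

text \<open>The free module on a set \<open>B\<close>: finitely supported functions vanishing outside \<open>B\<close>.\<close>

definition free_module :: "('a, 'b) ring_scheme \<Rightarrow> 'x set \<Rightarrow> ('a, 'x \<Rightarrow> 'a) module" where
  "free_module R B =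
    \<lparr> carrier = {u. (\<forall>x. u x \<in> carrier R) \<and> (\<forall>x. x \<notin> B \<longrightarrow> u x = \<zero>\<^bsub>R\<^esub>) \<and> finite {x. u x \<noteq> \<zero>\<^bsub>R\<^esub>}},
      monoid.mult = undefined, monoid.one = undefined,
      ring.zero = (\<lambda>x. \<zero>\<^bsub>R\<^esub>),
      ring.add = (\<lambda>u w x. u x \<oplus>\<^bsub>R\<^esub> w x),
      module.smult = (\<lambda>a u x. a \<otimes>\<^bsub>R\<^esub> u x) \<rparr>"

definition free_gen :: "('a, 'b) ring_scheme \<Rightarrow> 'x \<Rightarrow> ('x \<Rightarrow> 'a)" where
  "free_gen R x = (\<lambda>y. if y = x then \<one>\<^bsub>R\<^esub> else \<zero>\<^bsub>R\<^esub>)"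

text \<open>The linear map of free modules which sends the generator at \<open>x\<close> to the generator at \<open>f x\<close>.\<close>

definition free_map :: "('a, 'b) ring_scheme \<Rightarrow> ('x \<Rightarrow> 'y) \<Rightarrow> ('x \<Rightarrow> 'a) \<Rightarrow> ('y \<Rightarrow> 'a)" where
  "free_map R f u = (\<lambda>y. \<Oplus>\<^bsub>R\<^esub>x\<in>{x. u x \<noteq> \<zero>\<^bsub>R\<^esub> \<and> f x = y}. u x)"

definition submodule_gen ::
    "('a, 'b) ring_scheme \<Rightarrow> ('a, 'm, 'c) module_scheme \<Rightarrow> 'm set \<Rightarrow> 'm set" where
  "submodule_gen R M S = \<Inter>{N. submodule N R M \<and> S \<subseteq> N}"

definition quot_module ::
    "('a, 'b) ring_scheme \<Rightarrow> ('a, 'm, 'c) module_scheme \<Rightarrow> 'm set \<Rightarrow> ('a, 'm set) module" where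
  "quot_module R M N =
    \<lparr> carrier = a_rcosets\<^bsub>M\<^esub> N, monoid.mult = undefined, monoid.one = undefined,
      ring.zero = N,
      ring.add = set_add M,
      module.smult = (\<lambda>a C. \<Union>x\<in>C. N +>\<^bsub>M\<^esub> (a \<odot>\<^bsub>M\<^esub> x)) \<rparr>"

text \<open>
  The \<open>m\<close>-th exterior power is the free module on \<open>m\<close>-tuples \<open>(v\<^sub>1, \<dots>, v\<^sub>m)\<close> of elements
  of \<open>M\<close> (as lists of length \<open>m\<close>), divided by the relations saying that the class
  \<open>v\<^sub>1 \<and> \<dots> \<and> v\<^sub>m\<close> of a tuple is linear in each entry and vanishes when two entries coincide.
\<close>

definition tuples :: "('a, 'm, 'c) module_scheme \<Rightarrow> nat \<Rightarrow> 'm list set" where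
  "tuples M m = {vs. length vs = m \<and> set vs \<subseteq> carrier M}"

definition ext_relations ::
    "('a, 'b) ring_scheme \<Rightarrow> ('a, 'm, 'c) module_scheme \<Rightarrow> nat \<Rightarrow> ('m list \<Rightarrow> 'a) set" where
  "ext_relations R M m =
     (let F = free_module R (tuples M m) in
       {free_gen R (vs[k := (a \<odot>\<^bsub>M\<^esub> x) \<oplus>\<^bsub>M\<^esub> y])
          \<ominus>\<^bsub>F\<^esub> ((a \<odot>\<^bsub>F\<^esub> free_gen R (vs[k := x])) \<oplus>\<^bsub>F\<^esub> free_gen R (vs[k := y]))
        | vs k a x y. vs \<in> tuples M m \<and> k < m \<and> a \<in> carrier R \<and> x \<in> carrier M \<and> y \<in> carrier M}
       \<union> {free_gen R vs | vs i j. vs \<in> tuples M m \<and> i < j \<and> j < m \<and> vs ! i = vs ! j})"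

definition ext_kernel ::
    "('a, 'b) ring_scheme \<Rightarrow> ('a, 'm, 'c) module_scheme \<Rightarrow> nat \<Rightarrow> ('m list \<Rightarrow> 'a) set" where
  "ext_kernel R M m = submodule_gen R (free_module R (tuples M m)) (ext_relations R M m)"

definition exterior_power ::
    "('a, 'b) ring_scheme \<Rightarrow> ('a, 'm, 'c) module_scheme \<Rightarrow> nat \<Rightarrow> ('a, ('m list \<Rightarrow> 'a) set) module" where
  "exterior_power R M m = quot_module R (free_module R (tuples M m)) (ext_kernel R M m)"

text \<open>
  The endomorphism of the \<open>m\<close>-th exterior power of \<open>M\<close> induced by a linear endomorphism \<open>f\<close> of
  \<open>M\<close>, i.e. \<open>v\<^sub>1 \<and> \<dots> \<and> v\<^sub>m \<mapsto> f v\<^sub>1 \<and> \<dots> \<and> f v\<^sub>m\<close>.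
\<close>

definition exterior_map ::
    "('a, 'b) ring_scheme \<Rightarrow> ('a, 'm, 'c) module_scheme \<Rightarrow> nat \<Rightarrow> ('m \<Rightarrow> 'm)
      \<Rightarrow> ('m list \<Rightarrow> 'a) set \<Rightarrow> ('m list \<Rightarrow> 'a) set" where
  "exterior_map R M m f C =
     (\<Union>u\<in>C. ext_kernel R M m +>\<^bsub>free_module R (tuples M m)\<^esub> free_map R (map f) u)"

section \<open>Irreducible and dense representations\<close>

definition irreducible_rep ::
    "('k, 'b) ring_scheme \<Rightarrow> ('k, 'v, 'c) module_scheme \<Rightarrow> ('g, 'd) monoid_scheme
      \<Rightarrow> ('g \<Rightarrow> 'v \<Rightarrow> 'v) \<Rightarrow> bool" where
  "irreducible_rep K V G \<rho> \<longleftrightarrow>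
     carrier V \<noteq> {\<zero>\<^bsub>V\<^esub>} \<and>
     (\<forall>W. submodule W K V \<and> (\<forall>g\<in>carrier G. \<rho> g ` W \<subseteq> W) \<longrightarrow> W = {\<zero>\<^bsub>V\<^esub>} \<or> W = carrier V)"

definition m_dense ::
    "('k, 'b) ring_scheme \<Rightarrow> ('k, 'v, 'c) module_scheme \<Rightarrow> ('g, 'd) monoid_scheme
      \<Rightarrow> ('g \<Rightarrow> 'v \<Rightarrow> 'v) \<Rightarrow> nat \<Rightarrow> bool" where
  "m_dense K V G \<rho> m \<longleftrightarrow>
     irreducible_rep K (exterior_power K V m) G (\<lambda>g. exterior_map K V m (\<rho> g))"

text \<open>Here \<open>n\<close> is the dimension of \<open>V\<close>.\<close>

definition dense_rep ::
    "('k, 'b) ring_scheme \<Rightarrow> ('k, 'v, 'c) module_scheme \<Rightarrow> nat \<Rightarrow> ('g, 'd) monoid_scheme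
      \<Rightarrow> ('g \<Rightarrow> 'v \<Rightarrow> 'v) \<Rightarrow> bool" where
  "dense_rep K V n G \<rho> \<longleftrightarrow> (\<forall>m. 0 < m \<and> m < n \<longrightarrow> m_dense K V G \<rho> m)"

text \<open>
  A matrix representation \<open>\<rho> : G \<rightarrow> GL\<^sub>n(k)\<close> acts on \<open>k\<^sup>n\<close>; its scalar extension to the algebraic
  closure is the composite with \<open>GL\<^sub>n(k) \<rightarrow> GL\<^sub>n(L)\<close>, where \<open>L\<close> is the algebraic closure provided
  by the library and \<^const>\<open>ring.indexed_const\<close> is the embedding \<open>k \<rightarrow> L\<close>
  (cf. \<open>field.alg_closureE\<close>).
\<close>

definition alg_closure_rep ::
    "('k, 'b) ring_scheme \<Rightarrow> nat \<Rightarrow> ('g \<Rightarrow> nat \<times> nat \<Rightarrow> 'k)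
      \<Rightarrow> 'g \<Rightarrow> (nat \<Rightarrow> ('k list \<times> nat) multiset \<Rightarrow> 'k) \<Rightarrow> (nat \<Rightarrow> ('k list \<times> nat) multiset \<Rightarrow> 'k)" where
  "alg_closure_rep K n \<rho> g =
     mat_act (field.alg_closure K) n (mat_map n (ring.indexed_const K) (\<rho> g))"

definition abs_m_dense ::
    "('k, 'b) ring_scheme \<Rightarrow> nat \<Rightarrow> ('g, 'd) monoid_scheme \<Rightarrow> ('g \<Rightarrow> nat \<times> nat \<Rightarrow> 'k) \<Rightarrow> nat \<Rightarrow> bool" where
  "abs_m_dense K n G \<rho> m \<longleftrightarrow>
     m_dense (field.alg_closure K) (coord_space (field.alg_closure K) n) G (alg_closure_rep K n \<rho>) m"

definition abs_dense ::
    "('k, 'b) ring_scheme \<Rightarrow> nat \<Rightarrow> ('g, 'd) monoid_scheme \<Rightarrow> ('g \<Rightarrow> nat \<times> nat \<Rightarrow> 'k) \<Rightarrow> bool" where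
  "abs_dense K n G \<rho> \<longleftrightarrow>
     dense_rep (field.alg_closure K) (coord_space (field.alg_closure K) n) n G (alg_closure_rep K n \<rho>)"

section \<open>Spectrum and residue fields\<close>

definition Spec :: "('a, 'b) ring_scheme \<Rightarrow> 'a set set" where
  "Spec A = {P. primeideal P A}"

definition zariski :: "('a, 'b) ring_scheme \<Rightarrow> 'a set topology" where
  "zariski A = topology (\<lambda>U. \<exists>S \<subseteq> carrier A. U = {P \<in> Spec A. \<not> S \<subseteq> P})"

definition frac_rel :: "('a, 'b) ring_scheme \<Rightarrow> (('a \<times> 'a) \<times> ('a \<times> 'a)) set" where
  "frac_rel D =
     {((a, b), (c, d)). a \<in> carrier D \<and> b \<in> carrier D - {\<zero>\<^bsub>D\<^esub>} \<and>
                        c \<in> carrier D \<and> d \<in> carrier D - {\<zero>\<^bsub>D\<^esub>} \<and> a \<otimes>\<^bsub>D\<^esub> d = c \<otimes>\<^bsub>D\<^esub> b}"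

definition frac_class :: "('a, 'b) ring_scheme \<Rightarrow> 'a \<Rightarrow> 'a \<Rightarrow> ('a \<times> 'a) set" where
  "frac_class D a b = frac_rel D `` {(a, b)}"

text \<open>The field of fractions of an integral domain \<open>D\<close>.\<close>

definition frac_field :: "('a, 'b) ring_scheme \<Rightarrow> ('a \<times> 'a) set ring" where
  "frac_field D =
    \<lparr> carrier = (carrier D \<times> (carrier D - {\<zero>\<^bsub>D\<^esub>})) // frac_rel D,
      monoid.mult = (\<lambda>p q. \<Union>(a, b)\<in>p. \<Union>(c, d)\<in>q. frac_class D (a \<otimes>\<^bsub>D\<^esub> c) (b \<otimes>\<^bsub>D\<^esub> d)),
      monoid.one = frac_class D \<one>\<^bsub>D\<^esub> \<one>\<^bsub>D\<^esub>,
      ring.zero = frac_class D \<zero>\<^bsub>D\<^esub> \<one>\<^bsub>D\<^esub>,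
      ring.add = (\<lambda>p q. \<Union>(a, b)\<in>p. \<Union>(c, d)\<in>q.
               frac_class D ((a \<otimes>\<^bsub>D\<^esub> d) \<oplus>\<^bsub>D\<^esub> (c \<otimes>\<^bsub>D\<^esub> b)) (b \<otimes>\<^bsub>D\<^esub> d)) \<rparr>"

definition residue_field :: "('a, 'b) ring_scheme \<Rightarrow> 'a set \<Rightarrow> ('a set \<times> 'a set) set ring" where
  "residue_field A P = frac_field (A Quot P)"

definition residue_map :: "('a, 'b) ring_scheme \<Rightarrow> 'a set \<Rightarrow> 'a \<Rightarrow> ('a set \<times> 'a set) set" where
  "residue_map A P a = frac_class (A Quot P) (P +>\<^bsub>A\<^esub> a) \<one>\<^bsub>A Quot P\<^esub>"

section \<open>The representation variety\<close>

type_synonym 'v int_mpoly = "('v \<Rightarrow>\<^sub>0 nat) \<Rightarrow>\<^sub>0 int"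

text \<open>The polynomial ring over the integers in the variables from the set \<open>V\<close>.\<close>

definition int_mpoly_ring :: "'v set \<Rightarrow> 'v int_mpoly ring" where
  "int_mpoly_ring V =
    \<lparr> carrier = {p. \<forall>t\<in>Poly_Mapping.keys p. Poly_Mapping.keys t \<subseteq> V},
      monoid.mult = (*), monoid.one = 1, ring.zero = 0, ring.add = (+) \<rparr>"

definition mvar :: "'v \<Rightarrow> 'v int_mpoly" where
  "mvar v = Poly_Mapping.single (Poly_Mapping.single v 1) 1"

text \<open>
  \<open>Rep\<^sub>n(G)\<close> is the spectrum of the ring generated by indeterminates \<open>x\<^bsub>g,i,j\<^esub>\<close>, for \<open>g \<in> G\<close> and
  \<open>i, j < n\<close>, subject to the entries of the matrix identities \<open>X\<^bsub>1\<^esub> = 1\<close> and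
  \<open>X\<^bsub>gh\<^esub> = X\<^bsub>g\<^esub> X\<^bsub>h\<^esub>\<close>. Invertibility of the matrices \<open>X\<^bsub>g\<^esub>\<close> follows from these relations.
\<close>

definition rep_poly_ring :: "('g, 'd) monoid_scheme \<Rightarrow> nat \<Rightarrow> ('g \<times> nat \<times> nat) int_mpoly ring" where
  "rep_poly_ring G n = int_mpoly_ring (carrier G \<times> {..<n} \<times> {..<n})"

definition rep_relations :: "('g, 'd) monoid_scheme \<Rightarrow> nat \<Rightarrow> ('g \<times> nat \<times> nat) int_mpoly set" where
  "rep_relations G n =
     {mvar (\<one>\<^bsub>G\<^esub>, i, j) - (if i = j then 1 else 0) | i j. i < n \<and> j < n} \<union>
     {mvar (g \<otimes>\<^bsub>G\<^esub> h, i, j) - (\<Sum>k<n. mvar (g, i, k) * mvar (h, k, j))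
       | g h i j. g \<in> carrier G \<and> h \<in> carrier G \<and> i < n \<and> j < n}"

definition rep_ideal :: "('g, 'd) monoid_scheme \<Rightarrow> nat \<Rightarrow> ('g \<times> nat \<times> nat) int_mpoly set" where
  "rep_ideal G n = Idl\<^bsub>rep_poly_ring G n\<^esub> (rep_relations G n)"

definition rep_ring :: "('g, 'd) monoid_scheme \<Rightarrow> nat \<Rightarrow> ('g \<times> nat \<times> nat) int_mpoly set ring" where
  "rep_ring G n = rep_poly_ring G n Quot rep_ideal G n"

definition univ_rep ::
    "('g, 'd) monoid_scheme \<Rightarrow> nat \<Rightarrow> 'g \<Rightarrow> nat \<times> nat \<Rightarrow> ('g \<times> nat \<times> nat) int_mpoly set" where
  "univ_rep G n g =
     (\<lambda>(i, j) \<in> {..<n} \<times> {..<n}. rep_ideal G n +>\<^bsub>rep_poly_ring G n\<^esub> mvar (g, i, j))"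

abbreviation Rep :: "('g, 'd) monoid_scheme \<Rightarrow> nat \<Rightarrow> ('g \<times> nat \<times> nat) int_mpoly set set topology" where
  "Rep G n \<equiv> zariski (rep_ring G n)"

definition rep_at ::
    "('g, 'd) monoid_scheme \<Rightarrow> nat \<Rightarrow> ('g \<times> nat \<times> nat) int_mpoly set set
      \<Rightarrow> 'g \<Rightarrow> nat \<times> nat \<Rightarrow>
         (('g \<times> nat \<times> nat) int_mpoly set set \<times> ('g \<times> nat \<times> nat) int_mpoly set set) set" where
  "rep_at G n x g = mat_map n (residue_map (rep_ring G n) x) (univ_rep G n g)"

section \<open>The Zariski topology and residue fields are well defined\<close>

lemma istopology_zariski:
  assumes "cring A"
  shows "istopology (\<lambda>U. \<exists>S \<subseteq> carrier A. U = {P \<in> Spec A. \<not> S \<subseteq> P})"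
  unfolding istopology_def
proof (intro conjI allI impI)
  fix U V
  assume "\<exists>S\<subseteq>carrier A. U = {P \<in> Spec A. \<not> S \<subseteq> P}" "\<exists>S\<subseteq>carrier A. V = {P \<in> Spec A. \<not> S \<subseteq> P}"
  then obtain S T where S: "S \<subseteq> carrier A" "U = {P \<in> Spec A. \<not> S \<subseteq> P}"
    and T: "T \<subseteq> carrier A" "V = {P \<in> Spec A. \<not> T \<subseteq> P}"
    by blast
  interpret cring A by fact
  define W where "W = {s \<otimes>\<^bsub>A\<^esub> t | s t. s \<in> S \<and> t \<in> T}"
  have eq: "W \<subseteq> P \<longleftrightarrow> S \<subseteq> P \<or> T \<subseteq> P" if "P \<in> Spec A" for P
  proof
    interpret primeideal P A using that by (simp add: Spec_def)
    show "S \<subseteq> P \<or> T \<subseteq> P" if W: "W \<subseteq> P"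
    proof (rule ccontr)
      assume "\<not> (S \<subseteq> P \<or> T \<subseteq> P)"
      then obtain s t where "s \<in> S" "s \<notin> P" "t \<in> T" "t \<notin> P" by blast
      moreover from this have "s \<otimes>\<^bsub>A\<^esub> t \<in> P" using W by (auto simp: W_def)
      ultimately show False using I_prime[of s t] S(1) T(1) by auto
    qed
    show "W \<subseteq> P" if "S \<subseteq> P \<or> T \<subseteq> P"
      using that S(1) T(1) I_l_closed I_r_closed by (auto simp: W_def subset_iff)
  qed
  have "P \<in> U \<inter> V \<longleftrightarrow> P \<in> Spec A \<and> \<not> W \<subseteq> P" for P
    using eq[of P] unfolding S(2) T(2) mem_Collect_eq Int_iff by metis
  then have "U \<inter> V = {P \<in> Spec A. \<not> W \<subseteq> P}"
    by blast
  moreover have "W \<subseteq> carrier A" using S(1) T(1) by (auto simp: W_def)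
  ultimately show "\<exists>S\<subseteq>carrier A. U \<inter> V = {P \<in> Spec A. \<not> S \<subseteq> P}"
    by auto
next
  fix \<K> assume "\<forall>K\<in>\<K>. \<exists>S\<subseteq>carrier A. K = {P \<in> Spec A. \<not> S \<subseteq> P}"
  from bchoice[OF this] obtain S where S: "\<And>K. K \<in> \<K> \<Longrightarrow> S K \<subseteq> carrier A"
      "\<And>K. K \<in> \<K> \<Longrightarrow> K = {P \<in> Spec A. \<not> S K \<subseteq> P}"
    by blast
  have "\<Union>\<K> = {P \<in> Spec A. \<not> (\<Union>(S ` \<K>)) \<subseteq> P}"
    using S(2) by blast
  with S(1) show "\<exists>S\<subseteq>carrier A. \<Union>\<K> = {P \<in> Spec A. \<not> S \<subseteq> P}"
    by (intro exI[of _ "\<Union>(S ` \<K>)"]) blast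
qed

lemma openin_zariski:
  "cring A \<Longrightarrow> openin (zariski A) U \<longleftrightarrow> (\<exists>S \<subseteq> carrier A. U = {P \<in> Spec A. \<not> S \<subseteq> P})"
  unfolding zariski_def by (simp add: topology_inverse'[OF istopology_zariski])

lemma UN_pairs_const_eq:
  assumes "(a, b) \<in> p" "(c, d) \<in> q"
    and f: "\<And>a b c d. (a, b) \<in> p \<Longrightarrow> (c, d) \<in> q \<Longrightarrow> f a b c d = C"
  shows "(\<Union>(a, b)\<in>p. \<Union>(c, d)\<in>q. f a b c d) = C"
proof -
  have "(\<Union>(c, d)\<in>q. f a b c d) = C" if "(a, b) \<in> p" for a b
    by (rule UN_constant_eq[OF assms(2)]) (use f that in auto)
  then show ?thesis
    by (intro UN_constant_eq[OF assms(1)]) (simp add: split_paired_all)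
qed

context domain
begin

lemma equiv_frac_rel: "equiv (carrier R \<times> (carrier R - {\<zero>})) (frac_rel R)"
proof (rule equivI)
  show "frac_rel R \<subseteq> (carrier R \<times> (carrier R - {\<zero>})) \<times> (carrier R \<times> (carrier R - {\<zero>}))"
    by (auto simp: frac_rel_def)
  show "refl_on (carrier R \<times> (carrier R - {\<zero>})) (frac_rel R)"
    by (auto simp: frac_rel_def refl_on_def)
  show "sym (frac_rel R)"
    by (auto simp: frac_rel_def sym_def)
  show "trans (frac_rel R)"
  proof (rule transI)
    fix x y z assume "(x, y) \<in> frac_rel R" "(y, z) \<in> frac_rel R"
    then obtain a b c d e f where *: "x = (a, b)" "y = (c, d)" "z = (e, f)"
      "a \<in> carrier R" "b \<in> carrier R" "b \<noteq> \<zero>" "c \<in> carrier R" "d \<in> carrier R" "d \<noteq> \<zero>"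
      "e \<in> carrier R" "f \<in> carrier R" "f \<noteq> \<zero>" "a \<otimes> d = c \<otimes> b" "c \<otimes> f = e \<otimes> d"
      by (auto simp: frac_rel_def)
    note c = *(4,5,7,8,10,11)
    have "d \<otimes> (a \<otimes> f) = (a \<otimes> d) \<otimes> f" using c by algebra
    also have "\<dots> = b \<otimes> (c \<otimes> f)" unfolding \<open>a \<otimes> d = c \<otimes> b\<close> using c by algebra
    also have "\<dots> = d \<otimes> (e \<otimes> b)" unfolding \<open>c \<otimes> f = e \<otimes> d\<close> using c by algebra
    finally have "a \<otimes> f = e \<otimes> b" using * by (simp add: m_lcancel)
    with * show "(x, z) \<in> frac_rel R" by (auto simp: frac_rel_def)
  qed
qed

lemma frac_class_eq_iff:
  assumes "a \<in> carrier R" "b \<in> carrier R - {\<zero>}" "c \<in> carrier R" "d \<in> carrier R - {\<zero>}"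
  shows "frac_class R a b = frac_class R c d \<longleftrightarrow> a \<otimes> d = c \<otimes> b"
  using assms eq_equiv_class_iff[OF equiv_frac_rel, of "(a, b)" "(c, d)"]
  by (auto simp: frac_class_def frac_rel_def)

lemma carrier_frac_field:
  "carrier (frac_field R) = {frac_class R a b | a b. a \<in> carrier R \<and> b \<in> carrier R - {\<zero>}}"
  by (auto simp: frac_field_def quotient_def frac_class_def)

lemma frac_class_memD:
  "(c, d) \<in> frac_class R a b \<Longrightarrow> c \<in> carrier R \<and> d \<in> carrier R - {\<zero>} \<and> a \<otimes> d = c \<otimes> b"
  by (auto simp: frac_class_def frac_rel_def)

lemma frac_class_self:
  "a \<in> carrier R \<Longrightarrow> b \<in> carrier R - {\<zero>} \<Longrightarrow> (a, b) \<in> frac_class R a b"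
  by (auto simp: frac_class_def frac_rel_def)

lemma frac_mult:
  assumes a: "a \<in> carrier R" "b \<in> carrier R - {\<zero>}" "c \<in> carrier R" "d \<in> carrier R - {\<zero>}"
  shows "frac_class R a b \<otimes>\<^bsub>frac_field R\<^esub> frac_class R c d = frac_class R (a \<otimes> c) (b \<otimes> d)"
proof -
  have "frac_class R (a' \<otimes> c') (b' \<otimes> d') = frac_class R (a \<otimes> c) (b \<otimes> d)"
    if "(a', b') \<in> frac_class R a b" "(c', d') \<in> frac_class R c d" for a' b' c' d'
  proof -
    note * = frac_class_memD[OF that(1)] frac_class_memD[OF that(2)]
    have c: "a \<in> carrier R" "b \<in> carrier R" "c \<in> carrier R" "d \<in> carrier R"
      "a' \<in> carrier R" "b' \<in> carrier R" "c' \<in> carrier R" "d' \<in> carrier R"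
      using * a by auto
    have "a' \<otimes> c' \<otimes> (b \<otimes> d) = (a' \<otimes> b) \<otimes> (c' \<otimes> d)" using c by algebra
    also have "\<dots> = (a \<otimes> b') \<otimes> (c \<otimes> d')" using * by simp
    also have "\<dots> = a \<otimes> c \<otimes> (b' \<otimes> d')" using c by algebra
    finally show ?thesis using * a integral by (subst frac_class_eq_iff) auto
  qed
  then show ?thesis
    unfolding frac_field_def ring.simps monoid.simps
    by (rule UN_pairs_const_eq[OF frac_class_self[OF a(1,2)] frac_class_self[OF a(3,4)]])
qed

lemma frac_add:
  assumes a: "a \<in> carrier R" "b \<in> carrier R - {\<zero>}" "c \<in> carrier R" "d \<in> carrier R - {\<zero>}"
  shows "frac_class R a b \<oplus>\<^bsub>frac_field R\<^esub> frac_class R c d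
           = frac_class R (a \<otimes> d \<oplus> c \<otimes> b) (b \<otimes> d)"
proof -
  have "frac_class R (a' \<otimes> d' \<oplus> c' \<otimes> b') (b' \<otimes> d') = frac_class R (a \<otimes> d \<oplus> c \<otimes> b) (b \<otimes> d)"
    if "(a', b') \<in> frac_class R a b" "(c', d') \<in> frac_class R c d" for a' b' c' d'
  proof -
    note * = frac_class_memD[OF that(1)] frac_class_memD[OF that(2)]
    have c: "a \<in> carrier R" "b \<in> carrier R" "c \<in> carrier R" "d \<in> carrier R"
      "a' \<in> carrier R" "b' \<in> carrier R" "c' \<in> carrier R" "d' \<in> carrier R"
      using * a by auto
    have "(a' \<otimes> d' \<oplus> c' \<otimes> b') \<otimes> (b \<otimes> d) = (a' \<otimes> b) \<otimes> (d' \<otimes> d) \<oplus> (c' \<otimes> d) \<otimes> (b' \<otimes> b)"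
      using c by algebra
    also have "\<dots> = (a \<otimes> b') \<otimes> (d' \<otimes> d) \<oplus> (c \<otimes> d') \<otimes> (b' \<otimes> b)" using * by simp
    also have "\<dots> = (a \<otimes> d \<oplus> c \<otimes> b) \<otimes> (b' \<otimes> d')" using c by algebra
    finally show ?thesis using * a integral by (subst frac_class_eq_iff) auto
  qed
  then show ?thesis
    unfolding frac_field_def ring.simps monoid.simps
    by (rule UN_pairs_const_eq[OF frac_class_self[OF a(1,2)] frac_class_self[OF a(3,4)]])
qed

lemma frac_one: "\<one>\<^bsub>frac_field R\<^esub> = frac_class R \<one> \<one>"
  and frac_zero: "\<zero>\<^bsub>frac_field R\<^esub> = frac_class R \<zero> \<one>"
  by (simp_all add: frac_field_def)

lemma frac_field_cases:
  assumes "p \<in> carrier (frac_field R)"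
  obtains a b where "p = frac_class R a b" "a \<in> carrier R" "b \<in> carrier R" "b \<noteq> \<zero>"
  using assms unfolding carrier_frac_field by blast

lemma field_frac_field: "field (frac_field R)"
proof (rule cring.cring_fieldI2)
  let ?F = "frac_field R"
  have mem: "frac_class R a b \<in> carrier ?F" if "a \<in> carrier R" "b \<in> carrier R" "b \<noteq> \<zero>" for a b
    using that by (auto simp: carrier_frac_field)
  have nz: "b \<otimes> d \<noteq> \<zero>" if "b \<in> carrier R" "b \<noteq> \<zero>" "d \<in> carrier R" "d \<noteq> \<zero>" for b d
    using that integral by blast
  show "cring ?F"
  proof (rule cringI)
    show "abelian_group ?F"
    proof (rule abelian_groupI)
      fix x y assume "x \<in> carrier ?F" "y \<in> carrier ?F"
      obtain a b where x: "x = frac_class R a b" "a \<in> carrier R" "b \<in> carrier R" "b \<noteq> \<zero>"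
        using frac_field_cases[OF \<open>x \<in> carrier ?F\<close>] .
      obtain c d where y: "y = frac_class R c d" "c \<in> carrier R" "d \<in> carrier R" "d \<noteq> \<zero>"
        using frac_field_cases[OF \<open>y \<in> carrier ?F\<close>] .
      show "x \<oplus>\<^bsub>?F\<^esub> y \<in> carrier ?F" using x y nz by (simp add: frac_add mem)
      show "x \<oplus>\<^bsub>?F\<^esub> y = y \<oplus>\<^bsub>?F\<^esub> x" using x y nz by (simp add: frac_add a_comm m_comm)
    next
      fix x y z assume "x \<in> carrier ?F" "y \<in> carrier ?F" "z \<in> carrier ?F"
      obtain a b where x: "x = frac_class R a b" "a \<in> carrier R" "b \<in> carrier R" "b \<noteq> \<zero>"
        using frac_field_cases[OF \<open>x \<in> carrier ?F\<close>] .
      obtain c d where y: "y = frac_class R c d" "c \<in> carrier R" "d \<in> carrier R" "d \<noteq> \<zero>"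
        using frac_field_cases[OF \<open>y \<in> carrier ?F\<close>] .
      obtain e f where z: "z = frac_class R e f" "e \<in> carrier R" "f \<in> carrier R" "f \<noteq> \<zero>"
        using frac_field_cases[OF \<open>z \<in> carrier ?F\<close>] .
      have "(a \<otimes> d \<oplus> c \<otimes> b) \<otimes> f \<oplus> e \<otimes> (b \<otimes> d) = a \<otimes> (d \<otimes> f) \<oplus> (c \<otimes> f \<oplus> e \<otimes> d) \<otimes> b"
        using x y z by algebra
      then show "x \<oplus>\<^bsub>?F\<^esub> y \<oplus>\<^bsub>?F\<^esub> z = x \<oplus>\<^bsub>?F\<^esub> (y \<oplus>\<^bsub>?F\<^esub> z)" using x y z nz by (simp add: frac_add m_assoc)
    next
      fix x assume "x \<in> carrier ?F"
      obtain a b where x: "x = frac_class R a b" "a \<in> carrier R" "b \<in> carrier R" "b \<noteq> \<zero>"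
        using frac_field_cases[OF \<open>x \<in> carrier ?F\<close>] .
      show "\<zero>\<^bsub>?F\<^esub> \<oplus>\<^bsub>?F\<^esub> x = x" using x by (simp add: frac_zero frac_add)
      have "frac_class R (\<ominus> a \<otimes> b \<oplus> a \<otimes> b) (b \<otimes> b) = frac_class R \<zero> \<one>"
        using x nz by (subst frac_class_eq_iff) (auto simp: l_minus l_neg)
      then show "\<exists>y\<in>carrier ?F. y \<oplus>\<^bsub>?F\<^esub> x = \<zero>\<^bsub>?F\<^esub>"
        using x mem[of "\<ominus> a" b] by (intro bexI[of _ "frac_class R (\<ominus> a) b"]) (auto simp: frac_zero frac_add)
    qed (auto simp: frac_zero mem)
    show "comm_monoid ?F"
    proof (rule comm_monoidI)
      fix x y assume "x \<in> carrier ?F" "y \<in> carrier ?F"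
      obtain a b where x: "x = frac_class R a b" "a \<in> carrier R" "b \<in> carrier R" "b \<noteq> \<zero>"
        using frac_field_cases[OF \<open>x \<in> carrier ?F\<close>] .
      obtain c d where y: "y = frac_class R c d" "c \<in> carrier R" "d \<in> carrier R" "d \<noteq> \<zero>"
        using frac_field_cases[OF \<open>y \<in> carrier ?F\<close>] .
      show "x \<otimes>\<^bsub>?F\<^esub> y \<in> carrier ?F" using x y nz by (simp add: frac_mult mem)
      show "x \<otimes>\<^bsub>?F\<^esub> y = y \<otimes>\<^bsub>?F\<^esub> x" using x y nz by (simp add: frac_mult m_comm)
    next
      fix x y z assume "x \<in> carrier ?F" "y \<in> carrier ?F" "z \<in> carrier ?F"
      obtain a b where x: "x = frac_class R a b" "a \<in> carrier R" "b \<in> carrier R" "b \<noteq> \<zero>"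
        using frac_field_cases[OF \<open>x \<in> carrier ?F\<close>] .
      obtain c d where y: "y = frac_class R c d" "c \<in> carrier R" "d \<in> carrier R" "d \<noteq> \<zero>"
        using frac_field_cases[OF \<open>y \<in> carrier ?F\<close>] .
      obtain e f where z: "z = frac_class R e f" "e \<in> carrier R" "f \<in> carrier R" "f \<noteq> \<zero>"
        using frac_field_cases[OF \<open>z \<in> carrier ?F\<close>] .
      show "x \<otimes>\<^bsub>?F\<^esub> y \<otimes>\<^bsub>?F\<^esub> z = x \<otimes>\<^bsub>?F\<^esub> (y \<otimes>\<^bsub>?F\<^esub> z)"
        using x y z nz[of b d] nz[of d f] by (simp add: frac_mult m_assoc)
    next
      fix x assume "x \<in> carrier ?F"
      obtain a b where x: "x = frac_class R a b" "a \<in> carrier R" "b \<in> carrier R" "b \<noteq> \<zero>"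
        using frac_field_cases[OF \<open>x \<in> carrier ?F\<close>] .
      show "\<one>\<^bsub>?F\<^esub> \<otimes>\<^bsub>?F\<^esub> x = x" using x by (simp add: frac_one frac_mult)
    qed (auto simp: frac_one mem)
    fix x y z assume "x \<in> carrier ?F" "y \<in> carrier ?F" "z \<in> carrier ?F"
    obtain a b where x: "x = frac_class R a b" "a \<in> carrier R" "b \<in> carrier R" "b \<noteq> \<zero>"
      using frac_field_cases[OF \<open>x \<in> carrier ?F\<close>] .
    obtain c d where y: "y = frac_class R c d" "c \<in> carrier R" "d \<in> carrier R" "d \<noteq> \<zero>"
      using frac_field_cases[OF \<open>y \<in> carrier ?F\<close>] .
    obtain e f where z: "z = frac_class R e f" "e \<in> carrier R" "f \<in> carrier R" "f \<noteq> \<zero>"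
      using frac_field_cases[OF \<open>z \<in> carrier ?F\<close>] .
    have "(a \<otimes> d \<oplus> c \<otimes> b) \<otimes> e \<otimes> (b \<otimes> f \<otimes> (d \<otimes> f)) =
          (a \<otimes> e \<otimes> (d \<otimes> f) \<oplus> c \<otimes> e \<otimes> (b \<otimes> f)) \<otimes> (b \<otimes> d \<otimes> f)"
      using x(2,3) y(2,3) z(2,3) by (simp add: l_distr r_distr m_ac)
    then show "(x \<oplus>\<^bsub>?F\<^esub> y) \<otimes>\<^bsub>?F\<^esub> z = x \<otimes>\<^bsub>?F\<^esub> z \<oplus>\<^bsub>?F\<^esub> y \<otimes>\<^bsub>?F\<^esub> z"
      using x y z nz by (simp add: frac_add frac_mult frac_class_eq_iff)
  qed
  show "\<zero>\<^bsub>?F\<^esub> \<noteq> \<one>\<^bsub>?F\<^esub>" by (simp add: frac_one frac_zero frac_class_eq_iff)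
  fix x assume "x \<in> carrier ?F" "x \<noteq> \<zero>\<^bsub>?F\<^esub>"
  obtain a b where x: "x = frac_class R a b" "a \<in> carrier R" "b \<in> carrier R" "b \<noteq> \<zero>"
    using frac_field_cases[OF \<open>x \<in> carrier ?F\<close>] .
  have "a \<noteq> \<zero>"
    using x \<open>x \<noteq> \<zero>\<^bsub>?F\<^esub>\<close> by (auto simp: frac_zero frac_class_eq_iff)
  then have "x \<otimes>\<^bsub>?F\<^esub> frac_class R b a = \<one>\<^bsub>?F\<^esub>"
    using x nz by (simp add: frac_mult frac_one frac_class_eq_iff m_comm)
  then show "\<exists>y\<in>carrier ?F. x \<otimes>\<^bsub>?F\<^esub> y = \<one>\<^bsub>?F\<^esub>"
    using mem x \<open>a \<noteq> \<zero>\<close> by blast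
qed

lemma frac_class_closed:
  "a \<in> carrier R \<Longrightarrow> b \<in> carrier R \<Longrightarrow> b \<noteq> \<zero> \<Longrightarrow> frac_class R a b \<in> carrier (frac_field R)"
  by (auto simp: carrier_frac_field)

lemma frac_class_one_hom: "(\<lambda>a. frac_class R a \<one>) \<in> ring_hom R (frac_field R)"
  by (rule ring_hom_memI) (auto simp: frac_class_closed frac_mult frac_add frac_one)

end

lemma field_residue_field: "P \<in> Spec A \<Longrightarrow> field (residue_field A P)"
  unfolding Spec_def residue_field_def
  using domain.field_frac_field primeideal.quotient_is_domain by blast

lemma residue_map_hom:
  assumes "P \<in> Spec A"
  shows "residue_map A P \<in> ring_hom A (residue_field A P)"
proof -
  interpret primeideal P A using assms by (simp add: Spec_def)
  interpret Q: domain "A Quot P" by (rule quotient_is_domain)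
  have "residue_map A P = (\<lambda>a. frac_class (A Quot P) a \<one>\<^bsub>A Quot P\<^esub>) \<circ> (+>\<^bsub>A\<^esub>) P"
    by (auto simp: residue_map_def)
  then show ?thesis
    unfolding residue_field_def using ring_hom_trans[OF rcos_ring_hom Q.frac_class_one_hom] by simp
qed

lemma residue_map_eq_zero_iff:
  assumes "P \<in> Spec A" "a \<in> carrier A"
  shows "residue_map A P a = \<zero>\<^bsub>residue_field A P\<^esub> \<longleftrightarrow> a \<in> P"
proof -
  interpret primeideal P A using assms by (simp add: Spec_def)
  interpret Q: domain "A Quot P" by (rule quotient_is_domain)
  have "P +>\<^bsub>A\<^esub> a \<in> carrier (A Quot P)"
    using assms rcos_ring_hom by (auto simp: ring_hom_def)
  then have "residue_map A P a = \<zero>\<^bsub>residue_field A P\<^esub> \<longleftrightarrow> P +>\<^bsub>A\<^esub> a = \<zero>\<^bsub>A Quot P\<^esub>"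
    by (auto simp: residue_map_def residue_field_def Q.frac_zero Q.frac_class_eq_iff)
  also have "\<dots> \<longleftrightarrow> P +>\<^bsub>A\<^esub> a = P" by (simp add: FactRing_def)
  also have "\<dots> \<longleftrightarrow> a \<in> P" using assms a_rcos_const a_rcos_self by blast
  finally show ?thesis .
qed

section \<open>\<open>\<rho>\<^sub>x\<close> is a representation\<close>

lemma mat_map_hom:
  assumes "cring A" "cring B" and f: "f \<in> ring_hom A B"
  shows "mat_map n f \<in> hom (GL A n) (GL B n)"
proof -
  interpret A: cring A by fact
  interpret B: cring B by fact
  interpret ring_hom_cring A B f by unfold_locales (rule f)
  have closed: "mat_map n f M \<in> carrier (mat_ring B n)" if "M \<in> carrier (mat_ring A n)" for M
    using that by (auto simp: mat_map_def mat_ring_def)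
  have mult: "mat_map n f (M \<otimes>\<^bsub>mat_ring A n\<^esub> N) = mat_map n f M \<otimes>\<^bsub>mat_ring B n\<^esub> mat_map n f N"
    if "M \<in> carrier (mat_ring A n)" "N \<in> carrier (mat_ring A n)" for M N
  proof -
    have in_carrier: "M (i, j) \<in> carrier A" "N (i, j) \<in> carrier A" if "i < n" "j < n" for i j
      using that \<open>M \<in> _\<close> \<open>N \<in> _\<close> by (auto simp: mat_ring_def PiE_iff)
    have "f (\<Oplus>\<^bsub>A\<^esub>k\<in>{..<n}. M (i, k) \<otimes>\<^bsub>A\<^esub> N (k, j)) = (\<Oplus>\<^bsub>B\<^esub>k\<in>{..<n}. mat_map n f M (i, k) \<otimes>\<^bsub>B\<^esub> mat_map n f N (k, j))"
      if ij: "i < n" "j < n" for i j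
      using ij in_carrier
      by (subst hom_finsum) (auto simp: mat_map_def intro!: B.finsum_cong')
    then show ?thesis
      unfolding mat_ring_def by (auto simp: mat_map_def fun_eq_iff)
  qed
  have one: "mat_map n f \<one>\<^bsub>mat_ring A n\<^esub> = \<one>\<^bsub>mat_ring B n\<^esub>"
    by (auto simp: mat_map_def mat_ring_def fun_eq_iff)
  show ?thesis
    unfolding GL_def
  proof (rule homI)
    fix M assume M: "M \<in> carrier (units_of (mat_ring A n))"
    then obtain N where N: "N \<in> carrier (mat_ring A n)" "M \<in> carrier (mat_ring A n)"
      "M \<otimes>\<^bsub>mat_ring A n\<^esub> N = \<one>\<^bsub>mat_ring A n\<^esub>" "N \<otimes>\<^bsub>mat_ring A n\<^esub> M = \<one>\<^bsub>mat_ring A n\<^esub>"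
      by (auto simp: units_of_def Units_def)
    then show "mat_map n f M \<in> carrier (units_of (mat_ring B n))"
      using closed mult one unfolding units_of_def Units_def by (simp, metis)
  qed (auto simp: units_of_def Units_def mult)
qed

lemma int_mpoly_ring_simps:
  "p \<otimes>\<^bsub>int_mpoly_ring V\<^esub> q = p * q" "\<one>\<^bsub>int_mpoly_ring V\<^esub> = 1"
  "p \<oplus>\<^bsub>int_mpoly_ring V\<^esub> q = p + q" "\<zero>\<^bsub>int_mpoly_ring V\<^esub> = 0"
  by (simp_all add: int_mpoly_ring_def)

lemma cring_int_mpoly_ring: "cring (int_mpoly_ring V)"
proof (rule cringI)
  have keys_plus: "Poly_Mapping.keys (s + t) \<subseteq> Poly_Mapping.keys s \<union> Poly_Mapping.keys t"
    for s t :: "'a \<Rightarrow>\<^sub>0 nat" by (rule Poly_Mapping.keys_add)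
  have add: "p + q \<in> carrier (int_mpoly_ring V)"
    if "p \<in> carrier (int_mpoly_ring V)" "q \<in> carrier (int_mpoly_ring V)" for p q
    using that Poly_Mapping.keys_add[of p q] by (auto simp: int_mpoly_ring_def)
  have mult: "p * q \<in> carrier (int_mpoly_ring V)"
    if "p \<in> carrier (int_mpoly_ring V)" "q \<in> carrier (int_mpoly_ring V)" for p q
  proof -
    have "Poly_Mapping.keys t \<subseteq> V" if t: "t \<in> Poly_Mapping.keys (p * q)" for t
    proof -
      obtain r u where "t = r + u" "r \<in> Poly_Mapping.keys p" "u \<in> Poly_Mapping.keys q"
        using t Poly_Mapping.keys_mult[of p q] by blast
      then show ?thesis
        using keys_plus[of r u] \<open>p \<in> _\<close> \<open>q \<in> _\<close> by (auto simp: int_mpoly_ring_def)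
    qed
    then show ?thesis by (simp add: int_mpoly_ring_def)
  qed
  have one: "1 \<in> carrier (int_mpoly_ring V)"
    by (simp add: int_mpoly_ring_def flip: single_one)
  have uminus: "- p \<in> carrier (int_mpoly_ring V)" if "p \<in> carrier (int_mpoly_ring V)" for p
    using that by (simp add: int_mpoly_ring_def)
  have zero: "0 \<in> carrier (int_mpoly_ring V)"
    by (simp add: int_mpoly_ring_def)
  show "abelian_group (int_mpoly_ring V)"
  proof (rule abelian_groupI, unfold int_mpoly_ring_simps)
    fix p assume p: "p \<in> carrier (int_mpoly_ring V)"
    show "\<exists>q\<in>carrier (int_mpoly_ring V). q + p = 0"
      by (rule bexI[OF _ uminus[OF p]]) simp
  qed (simp_all add: add zero ac_simps)
  show "comm_monoid (int_mpoly_ring V)"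
    by (rule comm_monoidI, unfold int_mpoly_ring_simps) (simp_all add: mult one ac_simps)
qed (simp add: int_mpoly_ring_simps distrib_right)

lemma finsum_int_mpoly_ring:
  assumes "f \<in> S \<rightarrow> carrier (int_mpoly_ring V)"
  shows "(\<Oplus>\<^bsub>int_mpoly_ring V\<^esub>i\<in>S. f i) = sum f S"
proof -
  interpret cring "int_mpoly_ring V" by (rule cring_int_mpoly_ring)
  have "\<zero>\<^bsub>int_mpoly_ring V\<^esub> = 0" "x \<oplus>\<^bsub>int_mpoly_ring V\<^esub> y = x + y" for x y
    by (simp_all add: int_mpoly_ring_def)
  with assms show ?thesis
    by (induction S rule: infinite_finite_induct) auto
qed

lemma int_mpoly_ring_sum_closed:
  assumes "f \<in> S \<rightarrow> carrier (int_mpoly_ring V)"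
  shows "sum f S \<in> carrier (int_mpoly_ring V)"
proof -
  interpret cring "int_mpoly_ring V" by (rule cring_int_mpoly_ring)
  show ?thesis
    using finsum_closed[OF assms] finsum_int_mpoly_ring[OF assms] by simp
qed

lemma mvar_closed: "v \<in> V \<Longrightarrow> mvar v \<in> carrier (int_mpoly_ring V)"
  by (simp add: mvar_def int_mpoly_ring_def)

lemma int_mpoly_ring_diff_closed:
  assumes "p \<in> carrier (int_mpoly_ring V)" "q \<in> carrier (int_mpoly_ring V)"
  shows "p - q \<in> carrier (int_mpoly_ring V)"
  using assms keys_diff[of p q] by (auto simp: int_mpoly_ring_def)

lemma rep_relations_closed: 
  assumes "group G"
  shows "rep_relations G n \<subseteq> carrier (rep_poly_ring G n)"
proof -
  interpret G: group G by fact
  let ?V = "carrier G \<times> {..<n} \<times> {..<n}"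
  interpret R: cring "int_mpoly_ring ?V" by (rule cring_int_mpoly_ring)
  have 0: "0 \<in> carrier (int_mpoly_ring ?V)" "1 \<in> carrier (int_mpoly_ring ?V)"
    using R.zero_closed R.one_closed by (simp_all add: int_mpoly_ring_def)
  have mult: "p * q \<in> carrier (int_mpoly_ring ?V)"
    if "p \<in> carrier (int_mpoly_ring ?V)" "q \<in> carrier (int_mpoly_ring ?V)" for p q
    using R.m_closed[OF that] by (simp add: int_mpoly_ring_def)
  show ?thesis
    unfolding rep_relations_def rep_poly_ring_def
    by (auto intro!: int_mpoly_ring_diff_closed mvar_closed 0 mult int_mpoly_ring_sum_closed)
qed

lemma ideal_rep_ideal: "group G \<Longrightarrow> ideal (rep_ideal G n) (rep_poly_ring G n)"
  unfolding rep_ideal_def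
  using rep_relations_closed cring_int_mpoly_ring
  by (metis cring.axioms(1) rep_poly_ring_def ring.genideal_ideal)

lemma cring_rep_ring: "group G \<Longrightarrow> cring (rep_ring G n)"
  unfolding rep_ring_def
  by (metis ideal.quotient_is_cring ideal_rep_ideal cring_int_mpoly_ring rep_poly_ring_def)

lemma univ_rep_hom:
  assumes "group G"
  shows "univ_rep G n \<in> hom G (GL (rep_ring G n) n)"
proof -
  interpret G: group G by fact
  let ?V = "carrier G \<times> {..<n} \<times> {..<n}"
  define R where "R = rep_poly_ring G n"
  define I where "I = rep_ideal G n"
  define Q where "Q = rep_ring G n"
  interpret R: cring R unfolding R_def rep_poly_ring_def by (rule cring_int_mpoly_ring)
  interpret I: ideal I R unfolding R_def I_def by (rule ideal_rep_ideal) fact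
  have Q: "Q = R Quot I" by (simp add: Q_def R_def I_def rep_ring_def)
  define \<pi> where "\<pi> = (+>\<^bsub>R\<^esub>) I"
  interpret Q: cring Q unfolding Q_def by (rule cring_rep_ring) fact
  interpret \<pi>: ring_hom_cring R Q \<pi>
    unfolding Q \<pi>_def by (rule I.rcos_ring_hom_cring) unfold_locales
  have R_simps: "p \<oplus>\<^bsub>R\<^esub> q = p + q" "p \<otimes>\<^bsub>R\<^esub> q = p * q" "\<one>\<^bsub>R\<^esub> = 1" "\<zero>\<^bsub>R\<^esub> = 0" for p q
    by (simp_all add: R_def rep_poly_ring_def int_mpoly_ring_def)
  have mvar: "mvar (g, i, j) \<in> carrier R" if "g \<in> carrier G" "i < n" "j < n" for g i j
    unfolding R_def rep_poly_ring_def using that by (intro mvar_closed) auto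
  have rel: "\<pi> p = \<pi> q" if "p - q \<in> rep_relations G n" "q \<in> carrier R" for p q
  proof -
    have "p - q \<in> I" unfolding I_def rep_ideal_def
      using that(1) R.genideal_self[OF rep_relations_closed[OF assms, of n, folded R_def]] R_def by blast
    then have "\<pi> (p - q) = \<zero>\<^bsub>Q\<^esub>" "p - q \<in> carrier R"
      using I.a_rcos_const I.Icarr by (auto simp: Q FactRing_def \<pi>_def)
    then have "\<pi> (p - q \<oplus>\<^bsub>R\<^esub> q) = \<pi> q" using that(2) by simp
    then show ?thesis by (simp add: R_simps)
  qed
  have \<rho>: "univ_rep G n g = (\<lambda>(i, j) \<in> {..<n} \<times> {..<n}. \<pi> (mvar (g, i, j)))" for g
    by (simp add: univ_rep_def \<pi>_def I_def R_def)
  have closed: "univ_rep G n g \<in> carrier (mat_ring Q n)" if "g \<in> carrier G" for g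
    using that mvar by (auto simp: \<rho> mat_ring_def)
  have one: "univ_rep G n \<one>\<^bsub>G\<^esub> = \<one>\<^bsub>mat_ring Q n\<^esub>"
  proof -
    have "\<pi> (mvar (\<one>\<^bsub>G\<^esub>, i, j)) = \<pi> (if i = j then \<one>\<^bsub>R\<^esub> else \<zero>\<^bsub>R\<^esub>)" if "i < n" "j < n" for i j
    proof (rule rel)
      show "mvar (\<one>\<^bsub>G\<^esub>, i, j) - (if i = j then \<one>\<^bsub>R\<^esub> else \<zero>\<^bsub>R\<^esub>) \<in> rep_relations G n"
        unfolding rep_relations_def R_simps using that by blast
    qed simp
    then show ?thesis by (auto simp: \<rho> mat_ring_def fun_eq_iff)
  qed
  have mult: "univ_rep G n (g \<otimes>\<^bsub>G\<^esub> h) = univ_rep G n g \<otimes>\<^bsub>mat_ring Q n\<^esub> univ_rep G n h"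
    if "g \<in> carrier G" "h \<in> carrier G" for g h
  proof -
    have "\<pi> (mvar (g \<otimes>\<^bsub>G\<^esub> h, i, j)) = (\<Oplus>\<^bsub>Q\<^esub>k\<in>{..<n}. \<pi> (mvar (g, i, k)) \<otimes>\<^bsub>Q\<^esub> \<pi> (mvar (h, k, j)))"
      if ij: "i < n" "j < n" for i j
    proof -
      have car: "(\<lambda>k. mvar (g, i, k) * mvar (h, k, j)) \<in> {..<n} \<rightarrow> carrier R"
        using mvar ij \<open>g \<in> _\<close> \<open>h \<in> _\<close> by (auto simp flip: R_simps)
      then have sum: "(\<Oplus>\<^bsub>R\<^esub>k\<in>{..<n}. mvar (g, i, k) * mvar (h, k, j)) = (\<Sum>k<n. mvar (g, i, k) * mvar (h, k, j))"
        unfolding R_def rep_poly_ring_def by (rule finsum_int_mpoly_ring)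
      have "\<pi> (mvar (g \<otimes>\<^bsub>G\<^esub> h, i, j)) = \<pi> (\<Sum>k<n. mvar (g, i, k) * mvar (h, k, j))"
        by (rule rel) (use ij \<open>g \<in> _\<close> \<open>h \<in> _\<close> R.finsum_closed[OF car] sum in \<open>auto simp: rep_relations_def\<close>)
      also have "\<dots> = (\<Oplus>\<^bsub>Q\<^esub>k\<in>{..<n}. \<pi> (mvar (g, i, k) \<otimes>\<^bsub>R\<^esub> mvar (h, k, j)))"
        unfolding sum[symmetric] using \<pi>.hom_finsum[OF car] by (simp add: o_def R_simps)
      also have "\<dots> = (\<Oplus>\<^bsub>Q\<^esub>k\<in>{..<n}. \<pi> (mvar (g, i, k)) \<otimes>\<^bsub>Q\<^esub> \<pi> (mvar (h, k, j)))"
        by (rule Q.finsum_cong') (use mvar ij \<open>g \<in> _\<close> \<open>h \<in> _\<close> in auto)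
      finally show ?thesis .
    qed
    moreover have "(\<Oplus>\<^bsub>Q\<^esub>k\<in>{..<n}. univ_rep G n g (i, k) \<otimes>\<^bsub>Q\<^esub> univ_rep G n h (k, j))
        = (\<Oplus>\<^bsub>Q\<^esub>k\<in>{..<n}. \<pi> (mvar (g, i, k)) \<otimes>\<^bsub>Q\<^esub> \<pi> (mvar (h, k, j)))" if "i < n" "j < n" for i j
      by (rule Q.finsum_cong') (use that mvar \<open>g \<in> _\<close> \<open>h \<in> _\<close> in \<open>auto simp: \<rho>\<close>)
    ultimately show ?thesis unfolding mat_ring_def by (auto simp: \<rho> fun_eq_iff)
  qed
  have "univ_rep G n g \<in> Units (mat_ring Q n)" if "g \<in> carrier G" for g
  proof -
    have "univ_rep G n g \<otimes>\<^bsub>mat_ring Q n\<^esub> univ_rep G n (inv\<^bsub>G\<^esub> g) = \<one>\<^bsub>mat_ring Q n\<^esub>"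
      "univ_rep G n (inv\<^bsub>G\<^esub> g) \<otimes>\<^bsub>mat_ring Q n\<^esub> univ_rep G n g = \<one>\<^bsub>mat_ring Q n\<^esub>"
      using that mult[of g "inv\<^bsub>G\<^esub> g"] mult[of "inv\<^bsub>G\<^esub> g" g] one by auto
    then show ?thesis
      using closed that G.inv_closed unfolding Units_def by blast
  qed
  then show ?thesis
    using mult unfolding GL_def units_of_def Q_def[symmetric] by (auto intro!: homI)
qed

lemma rep_at_hom:
  assumes "group G" "x \<in> Spec (rep_ring G n)"
  shows "rep_at G n x \<in> hom G (GL (residue_field (rep_ring G n) x) n)"
proof -
  have "mat_map n (residue_map (rep_ring G n) x)
          \<in> hom (GL (rep_ring G n) n) (GL (residue_field (rep_ring G n) x) n)"
    using assms field_residue_field residue_map_hom cring_rep_ring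
    by (intro mat_map_hom) (auto simp: field_def domain_def)
  then show ?thesis
    using univ_rep_hom[OF assms(1), of n] unfolding rep_at_def[abs_def] hom_def by auto
qed

section \<open>The universal property of \<open>rep_ring G n\<close>\<close>

lemma sum_single_keys:
  fixes p :: "'x \<Rightarrow>\<^sub>0 'y::comm_monoid_add"
  shows "p = (\<Sum>t\<in>Poly_Mapping.keys p. Poly_Mapping.single t (Poly_Mapping.lookup p t))"
proof (rule poly_mapping_eqI)
  fix u
  have "Poly_Mapping.lookup (\<Sum>t\<in>Poly_Mapping.keys p. Poly_Mapping.single t (Poly_Mapping.lookup p t)) u
      = (\<Sum>t\<in>Poly_Mapping.keys p. if t = u then Poly_Mapping.lookup p t else 0)"
    unfolding lookup_sum by (rule sum.cong) (auto simp: lookup_single when_def)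
  also have "\<dots> = Poly_Mapping.lookup p u"
    by (simp add: sum.delta in_keys_iff)
  finally show "Poly_Mapping.lookup p u
      = Poly_Mapping.lookup (\<Sum>t\<in>Poly_Mapping.keys p. Poly_Mapping.single t (Poly_Mapping.lookup p t)) u" ..
qed

definition mpoly_eval ::
    "('b, 'c) ring_scheme \<Rightarrow> ('v \<Rightarrow> 'b) \<Rightarrow> 'v int_mpoly \<Rightarrow> 'b" where
  "mpoly_eval B s p =
     (\<Oplus>\<^bsub>B\<^esub>t\<in>Poly_Mapping.keys p. [Poly_Mapping.lookup p t] \<cdot>\<^bsub>B\<^esub>
        (\<Otimes>\<^bsub>B\<^esub>v\<in>Poly_Mapping.keys t. s v [^]\<^bsub>B\<^esub> Poly_Mapping.lookup t v))"

context cring begin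

context
  fixes V :: "'v set" and s :: "'v \<Rightarrow> 'a"
  assumes s: "s \<in> V \<rightarrow> carrier R"
begin

lemma mpoly_val_closed: "v \<in> V \<Longrightarrow> s v \<in> carrier R" using s by auto

definition mpoly_mon :: "('v \<Rightarrow>\<^sub>0 nat) \<Rightarrow> 'a" where
  "mpoly_mon t = (\<Otimes>v\<in>Poly_Mapping.keys t. s v [^] Poly_Mapping.lookup t v)"

lemma mpoly_mon_closed: "Poly_Mapping.keys t \<subseteq> V \<Longrightarrow> mpoly_mon t \<in> carrier R"
  unfolding mpoly_mon_def by (intro finprod_closed) (auto intro!: nat_pow_closed mpoly_val_closed)

lemma mpoly_mon_superset:
  assumes "Poly_Mapping.keys t \<subseteq> W" "W \<subseteq> V" "finite W"
  shows "mpoly_mon t = (\<Otimes>v\<in>W. s v [^] Poly_Mapping.lookup t v)"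
  unfolding mpoly_mon_def
  by (rule finprod_mono_neutral_cong_left) (use assms mpoly_val_closed in \<open>auto simp: in_keys_iff\<close>)

lemma mpoly_mon_add:
  assumes "Poly_Mapping.keys t \<subseteq> V" "Poly_Mapping.keys u \<subseteq> V"
  shows "mpoly_mon (t + u) = mpoly_mon t \<otimes> mpoly_mon u"
proof -
  define W where "W = Poly_Mapping.keys t \<union> Poly_Mapping.keys u"
  have W: "W \<subseteq> V" "finite W" using assms by (auto simp: W_def)
  have "mpoly_mon (t + u) = (\<Otimes>v\<in>W. s v [^] Poly_Mapping.lookup (t + u) v)"
    by (rule mpoly_mon_superset) (use W keys_add[of t u] in \<open>auto simp: W_def\<close>)
  also have "\<dots> = (\<Otimes>v\<in>W. s v [^] Poly_Mapping.lookup t v \<otimes> s v [^] Poly_Mapping.lookup u v)"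
    by (rule finprod_cong') (use W mpoly_val_closed in \<open>auto simp: lookup_add nat_pow_mult\<close>)
  also have "\<dots> = (\<Otimes>v\<in>W. s v [^] Poly_Mapping.lookup t v) \<otimes> (\<Otimes>v\<in>W. s v [^] Poly_Mapping.lookup u v)"
    by (rule finprod_multf) (use W mpoly_val_closed in auto)
  also have "\<dots> = mpoly_mon t \<otimes> mpoly_mon u"
    using mpoly_mon_superset[of t W] mpoly_mon_superset[of u W] W by (simp add: W_def)
  finally show ?thesis .
qed

lemma add_pow_int_zero: "[(0 :: int)] \<cdot> x = \<zero>"
  by (simp add: add_pow_int_ge)

lemma mpoly_eval_alt: "mpoly_eval R s p = (\<Oplus>t\<in>Poly_Mapping.keys p. [Poly_Mapping.lookup p t] \<cdot> mpoly_mon t)"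
  by (simp add: mpoly_eval_def mpoly_mon_def)

lemma mpoly_eval_superset:
  assumes "p \<in> carrier (int_mpoly_ring V)" "Poly_Mapping.keys p \<subseteq> T" "finite T" "\<And>t. t \<in> T \<Longrightarrow> Poly_Mapping.keys t \<subseteq> V"
  shows "mpoly_eval R s p = (\<Oplus>t\<in>T. [Poly_Mapping.lookup p t] \<cdot> mpoly_mon t)"
  unfolding mpoly_eval_alt
  by (rule add.finprod_mono_neutral_cong_left)
     (use assms mpoly_mon_closed in \<open>auto simp: in_keys_iff add.int_pow_closed add_pow_int_zero\<close>)

lemma mpoly_eval_closed: "p \<in> carrier (int_mpoly_ring V) \<Longrightarrow> mpoly_eval R s p \<in> carrier R"
  unfolding mpoly_eval_alt
  by (rule finsum_closed) (auto simp: int_mpoly_ring_def intro!: add.int_pow_closed mpoly_mon_closed)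

lemma mpoly_eval_add:
  assumes p: "p \<in> carrier (int_mpoly_ring V)" and q: "q \<in> carrier (int_mpoly_ring V)"
  shows "mpoly_eval R s (p + q) = mpoly_eval R s p \<oplus> mpoly_eval R s q"
proof -
  define T where "T = Poly_Mapping.keys p \<union> Poly_Mapping.keys q"
  have T: "finite T" "\<And>t. t \<in> T \<Longrightarrow> Poly_Mapping.keys t \<subseteq> V"
    using p q by (auto simp: T_def int_mpoly_ring_def)
  have pq: "p + q \<in> carrier (int_mpoly_ring V)"
    using cring.cring_simprules(1)[OF cring_int_mpoly_ring p q] by (simp add: int_mpoly_ring_simps)
  have "mpoly_eval R s (p + q) = (\<Oplus>t\<in>T. [Poly_Mapping.lookup (p + q) t] \<cdot> mpoly_mon t)"
    by (rule mpoly_eval_superset[OF pq]) (use T keys_add[of p q] in \<open>auto simp: T_def\<close>)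
  also have "\<dots> = (\<Oplus>t\<in>T. [Poly_Mapping.lookup p t] \<cdot> mpoly_mon t \<oplus> [Poly_Mapping.lookup q t] \<cdot> mpoly_mon t)"
    by (rule finsum_cong') (use T mpoly_mon_closed in \<open>auto simp: lookup_add add.int_pow_mult\<close>)
  also have "\<dots> = (\<Oplus>t\<in>T. [Poly_Mapping.lookup p t] \<cdot> mpoly_mon t) \<oplus> (\<Oplus>t\<in>T. [Poly_Mapping.lookup q t] \<cdot> mpoly_mon t)"
    by (rule finsum_addf) (use T mpoly_mon_closed in auto)
  also have "\<dots> = mpoly_eval R s p \<oplus> mpoly_eval R s q"
    using mpoly_eval_superset[OF p, of T] mpoly_eval_superset[OF q, of T] T by (simp add: T_def)
  finally show ?thesis .
qed

lemma mpoly_eval_zero: "mpoly_eval R s 0 = \<zero>"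
  by (simp add: mpoly_eval_def)

lemma mpoly_eval_sum:
  assumes "f \<in> A \<rightarrow> carrier (int_mpoly_ring V)"
  shows "mpoly_eval R s (sum f A) = (\<Oplus>a\<in>A. mpoly_eval R s (f a))"
  using assms
proof (induction A rule: infinite_finite_induct)
  case (insert a A)
  then have "sum f A \<in> carrier (int_mpoly_ring V)"
    by (intro int_mpoly_ring_sum_closed) auto
  with insert show ?case
    by (subst finsum_insert) (auto simp: mpoly_eval_add Pi_iff intro!: mpoly_eval_closed)
qed (auto simp: mpoly_eval_zero)

lemma mpoly_single_closed: "Poly_Mapping.keys t \<subseteq> V \<Longrightarrow> Poly_Mapping.single t c \<in> carrier (int_mpoly_ring V)"
  by (simp add: int_mpoly_ring_def)

lemma mpoly_eval_single: "Poly_Mapping.keys t \<subseteq> V \<Longrightarrow> mpoly_eval R s (Poly_Mapping.single t c) = [c] \<cdot> mpoly_mon t"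
  using mpoly_mon_closed[of t] by (simp add: mpoly_eval_alt add_pow_int_zero)

lemma mpoly_eval_mult_single:
  assumes t: "Poly_Mapping.keys t \<subseteq> V" and u: "Poly_Mapping.keys u \<subseteq> V"
  shows "mpoly_eval R s (Poly_Mapping.single t c * Poly_Mapping.single u d)
       = mpoly_eval R s (Poly_Mapping.single t c) \<otimes> mpoly_eval R s (Poly_Mapping.single u d)"
proof -
  have "Poly_Mapping.keys (t + u) \<subseteq> V" using keys_add[of t u] t u by auto
  then have "mpoly_eval R s (Poly_Mapping.single t c * Poly_Mapping.single u d) = [(c * d)] \<cdot> (mpoly_mon t \<otimes> mpoly_mon u)"
    using t u by (simp add: mult_single mpoly_eval_single mpoly_mon_add)
  also have "\<dots> = [d] \<cdot> ([c] \<cdot> (mpoly_mon t \<otimes> mpoly_mon u))"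
    using mpoly_mon_closed t u by (simp add: add.int_pow_pow)
  also have "\<dots> = [c] \<cdot> mpoly_mon t \<otimes> [d] \<cdot> mpoly_mon u"
    using mpoly_mon_closed t u by (simp add: add_pow_ldistr_int add_pow_rdistr_int)
  finally show ?thesis using t u by (simp add: mpoly_eval_single)
qed

lemma mpoly_eval_mult:
  assumes p: "p \<in> carrier (int_mpoly_ring V)" and q: "q \<in> carrier (int_mpoly_ring V)"
  shows "mpoly_eval R s (p * q) = mpoly_eval R s p \<otimes> mpoly_eval R s q"
proof -
  let ?s = "\<lambda>p t. Poly_Mapping.single t (Poly_Mapping.lookup p t)"
  let ?K = "Poly_Mapping.keys"
  have K: "?K t \<subseteq> V" if "t \<in> ?K p \<or> t \<in> ?K q" for t
    using p q that by (auto simp: int_mpoly_ring_def)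
  have c: "mpoly_eval R s (?s r t) \<in> carrier R" if "t \<in> ?K p \<or> t \<in> ?K q" for r t
    by (intro mpoly_eval_closed mpoly_single_closed K that)
  have sc: "?s p t * ?s q u \<in> carrier (int_mpoly_ring V)" if "t \<in> ?K p" "u \<in> ?K q" for t u
    using cring.cring_simprules(5)[OF cring_int_mpoly_ring, of "?s p t" V "?s q u"] K that
    by (simp add: int_mpoly_ring_simps mpoly_single_closed)
  have P: "mpoly_eval R s p = (\<Oplus>t\<in>?K p. mpoly_eval R s (?s p t))"
    by (subst sum_single_keys[of p], subst mpoly_eval_sum) (use K mpoly_single_closed in auto)
  have Q: "mpoly_eval R s q = (\<Oplus>u\<in>?K q. mpoly_eval R s (?s q u))"
    by (subst sum_single_keys[of q], subst mpoly_eval_sum) (use K mpoly_single_closed in auto)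
  have "p * q = (\<Sum>(t, u)\<in>?K p \<times> ?K q. ?s p t * ?s q u)"
    by (subst sum_single_keys[of p], subst sum_single_keys[of q])
       (simp add: sum_product sum.cartesian_product)
  then have "p * q = (\<Sum>t\<in>?K p. \<Sum>u\<in>?K q. ?s p t * ?s q u)"
    by (simp add: sum.cartesian_product)
  then have "mpoly_eval R s (p * q) = mpoly_eval R s (\<Sum>t\<in>?K p. \<Sum>u\<in>?K q. ?s p t * ?s q u)"
    by simp
  also have "\<dots> = (\<Oplus>t\<in>?K p. mpoly_eval R s (\<Sum>u\<in>?K q. ?s p t * ?s q u))"
  proof (rule mpoly_eval_sum, rule Pi_I)
    fix t assume t: "t \<in> ?K p"
    have "(\<lambda>u. ?s p t * ?s q u) \<in> ?K q \<rightarrow> carrier (int_mpoly_ring V)" using sc t by auto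
    then show "(\<Sum>u\<in>?K q. ?s p t * ?s q u) \<in> carrier (int_mpoly_ring V)"
      by (rule int_mpoly_ring_sum_closed)
  qed
  also have "\<dots> = (\<Oplus>t\<in>?K p. mpoly_eval R s (?s p t) \<otimes> mpoly_eval R s q)"
  proof (rule finsum_cong')
    fix t assume t: "t \<in> ?K p"
    have "mpoly_eval R s (\<Sum>u\<in>?K q. ?s p t * ?s q u) = (\<Oplus>u\<in>?K q. mpoly_eval R s (?s p t * ?s q u))"
      by (rule mpoly_eval_sum) (use sc t in auto)
    also have "\<dots> = (\<Oplus>u\<in>?K q. mpoly_eval R s (?s p t) \<otimes> mpoly_eval R s (?s q u))"
      by (rule finsum_cong') (use t K c mpoly_eval_mult_single in auto)
    also have "\<dots> = mpoly_eval R s (?s p t) \<otimes> mpoly_eval R s q"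
      unfolding Q by (rule finsum_rdistr[symmetric]) (use t c in auto)
    finally show "mpoly_eval R s (\<Sum>u\<in>?K q. ?s p t * ?s q u) = mpoly_eval R s (?s p t) \<otimes> mpoly_eval R s q" .
  qed (use c mpoly_eval_closed[OF q] in auto)
  also have "\<dots> = mpoly_eval R s p \<otimes> mpoly_eval R s q"
    unfolding P by (rule finsum_ldistr[symmetric]) (use c mpoly_eval_closed[OF q] in auto)
  finally show ?thesis .
qed

lemma mpoly_eval_one: "mpoly_eval R s 1 = \<one>"
  using mpoly_eval_single[of 0 1] by (simp add: mpoly_mon_def)

lemma mpoly_eval_mvar: "v \<in> V \<Longrightarrow> mpoly_eval R s (mvar v) = s v"
  using mpoly_val_closed by (simp add: mvar_def mpoly_eval_single mpoly_mon_def)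

lemma mpoly_eval_hom: "mpoly_eval R s \<in> ring_hom (int_mpoly_ring V) R"
  by (rule ring_hom_memI) (simp_all add: int_mpoly_ring_simps mpoly_eval_closed mpoly_eval_add mpoly_eval_mult mpoly_eval_one)

end
end

lemma (in abelian_monoid) finsum_swap:
  assumes "finite I" "finite J" "\<And>i j. i \<in> I \<Longrightarrow> j \<in> J \<Longrightarrow> f i j \<in> carrier G"
  shows "(\<Oplus>i\<in>I. \<Oplus>j\<in>J. f i j) = (\<Oplus>j\<in>J. \<Oplus>i\<in>I. f i j)"
  using assms(1,3)
proof (induction I)
  case (insert i I)
  then have "(\<Oplus>i\<in>insert i I. \<Oplus>j\<in>J. f i j) = (\<Oplus>j\<in>J. f i j) \<oplus> (\<Oplus>j\<in>J. \<Oplus>i\<in>I. f i j)"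
    by (subst finsum_insert) (auto intro!: finsum_closed)
  also have "\<dots> = (\<Oplus>j\<in>J. f i j \<oplus> (\<Oplus>i\<in>I. f i j))"
    using insert.prems by (intro finsum_addf[symmetric]) (auto intro!: finsum_closed)
  also have "\<dots> = (\<Oplus>j\<in>J. \<Oplus>i\<in>insert i I. f i j)"
    using insert by (intro finsum_cong') (auto intro!: finsum_closed)
  finally show ?case .
qed auto

lemma monoid_mat_ring:
  assumes "cring B"
  shows "monoid (mat_ring B n)"
proof -
  interpret cring B by fact
  have ent: "M (i, j) \<in> carrier B" if "M \<in> carrier (mat_ring B n)" "i < n" "j < n" for M i j
    using that by (auto simp: mat_ring_def PiE_iff)
  have entry: "(M \<otimes>\<^bsub>mat_ring B n\<^esub> N) (i, j) = (\<Oplus>\<^bsub>B\<^esub>k\<in>{..<n}. M (i, k) \<otimes>\<^bsub>B\<^esub> N (k, j))"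
    if "i < n" "j < n" for M N i j
    using that by (simp add: mat_ring_def)
  have closed: "M \<otimes>\<^bsub>mat_ring B n\<^esub> N \<in> carrier (mat_ring B n)"
    if "M \<in> carrier (mat_ring B n)" "N \<in> carrier (mat_ring B n)" for M N
    using ent[OF that(1)] ent[OF that(2)] by (auto simp: mat_ring_def intro!: finsum_closed)
  have eqI: "M = N" if "M \<in> carrier (mat_ring B n)" "N \<in> carrier (mat_ring B n)"
    "\<And>i j. i < n \<Longrightarrow> j < n \<Longrightarrow> M (i, j) = N (i, j)" for M N
    by (rule PiE_ext[of M "{..<n} \<times> {..<n}" "\<lambda>_. carrier B"]) (use that in \<open>auto simp: mat_ring_def\<close>)
  have one: "\<one>\<^bsub>mat_ring B n\<^esub> \<in> carrier (mat_ring B n)"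
    by (auto simp: mat_ring_def)
  have one_entry: "\<one>\<^bsub>mat_ring B n\<^esub> (i, j) = (if i = j then \<one>\<^bsub>B\<^esub> else \<zero>\<^bsub>B\<^esub>)" if "i < n" "j < n" for i j
    using that by (simp add: mat_ring_def)
  show ?thesis
  proof (rule monoidI)
    fix L M N assume L: "L \<in> carrier (mat_ring B n)" and M: "M \<in> carrier (mat_ring B n)"
      and N: "N \<in> carrier (mat_ring B n)"
    show "L \<otimes>\<^bsub>mat_ring B n\<^esub> M \<otimes>\<^bsub>mat_ring B n\<^esub> N = L \<otimes>\<^bsub>mat_ring B n\<^esub> (M \<otimes>\<^bsub>mat_ring B n\<^esub> N)"
    proof (rule eqI)
      fix i j assume ij: "i < n" "j < n"
      have rd: "(\<Oplus>\<^bsub>B\<^esub>k\<in>{..<n}. L (i, l) \<otimes>\<^bsub>B\<^esub> M (l, k) \<otimes>\<^bsub>B\<^esub> N (k, j))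
          = L (i, l) \<otimes>\<^bsub>B\<^esub> (M \<otimes>\<^bsub>mat_ring B n\<^esub> N) (l, j)" if l: "l < n" for l
      proof -
        have "L (i, l) \<otimes>\<^bsub>B\<^esub> (M \<otimes>\<^bsub>mat_ring B n\<^esub> N) (l, j)
            = (\<Oplus>\<^bsub>B\<^esub>k\<in>{..<n}. L (i, l) \<otimes>\<^bsub>B\<^esub> (M (l, k) \<otimes>\<^bsub>B\<^esub> N (k, j)))"
          unfolding entry[OF l ij(2)] using l ij ent[OF L] ent[OF M] ent[OF N]
          by (intro finsum_rdistr) auto
        also have "\<dots> = (\<Oplus>\<^bsub>B\<^esub>k\<in>{..<n}. L (i, l) \<otimes>\<^bsub>B\<^esub> M (l, k) \<otimes>\<^bsub>B\<^esub> N (k, j))"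
          using l ij ent[OF L] ent[OF M] ent[OF N]
          by (intro finsum_cong') (auto simp: m_assoc)
        finally show ?thesis ..
      qed
      have "(L \<otimes>\<^bsub>mat_ring B n\<^esub> M \<otimes>\<^bsub>mat_ring B n\<^esub> N) (i, j)
          = (\<Oplus>\<^bsub>B\<^esub>k\<in>{..<n}. \<Oplus>\<^bsub>B\<^esub>l\<in>{..<n}. L (i, l) \<otimes>\<^bsub>B\<^esub> M (l, k) \<otimes>\<^bsub>B\<^esub> N (k, j))"
        unfolding entry[OF ij] using ij ent[OF L] ent[OF M] ent[OF N]
        by (intro finsum_cong') (auto simp: entry finsum_ldistr Pi_iff)
      also have "\<dots> = (\<Oplus>\<^bsub>B\<^esub>l\<in>{..<n}. \<Oplus>\<^bsub>B\<^esub>k\<in>{..<n}. L (i, l) \<otimes>\<^bsub>B\<^esub> M (l, k) \<otimes>\<^bsub>B\<^esub> N (k, j))"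
        using ij ent[OF L] ent[OF M] ent[OF N] by (intro finsum_swap) auto
      also have "\<dots> = (\<Oplus>\<^bsub>B\<^esub>l\<in>{..<n}. L (i, l) \<otimes>\<^bsub>B\<^esub> (M \<otimes>\<^bsub>mat_ring B n\<^esub> N) (l, j))"
        using ij ent[OF L] ent[OF M] ent[OF N]
        by (intro finsum_cong') (auto simp: rd entry intro!: finsum_closed)
      finally show "(L \<otimes>\<^bsub>mat_ring B n\<^esub> M \<otimes>\<^bsub>mat_ring B n\<^esub> N) (i, j) = (L \<otimes>\<^bsub>mat_ring B n\<^esub> (M \<otimes>\<^bsub>mat_ring B n\<^esub> N)) (i, j)"
        unfolding entry[OF ij, of L] .
    qed (use L M N closed in auto)
  next
    fix M assume M: "M \<in> carrier (mat_ring B n)"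
    show "\<one>\<^bsub>mat_ring B n\<^esub> \<otimes>\<^bsub>mat_ring B n\<^esub> M = M"
    proof (rule eqI)
      fix i j assume ij: "i < n" "j < n"
      have "(\<one>\<^bsub>mat_ring B n\<^esub> \<otimes>\<^bsub>mat_ring B n\<^esub> M) (i, j)
          = (\<Oplus>\<^bsub>B\<^esub>k\<in>{..<n}. if i = k then M (k, j) else \<zero>\<^bsub>B\<^esub>)"
        unfolding entry[OF ij] using ij ent[OF M] by (intro finsum_cong') (auto simp: one_entry)
      also have "\<dots> = M (i, j)"
        using ij ent[OF M] by (intro finsum_singleton[where f = "\<lambda>k. M (k, j)"]) auto
      finally show "(\<one>\<^bsub>mat_ring B n\<^esub> \<otimes>\<^bsub>mat_ring B n\<^esub> M) (i, j) = M (i, j)" .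
    qed (use M closed one in auto)
    show "M \<otimes>\<^bsub>mat_ring B n\<^esub> \<one>\<^bsub>mat_ring B n\<^esub> = M"
    proof (rule eqI)
      fix i j assume ij: "i < n" "j < n"
      have "(M \<otimes>\<^bsub>mat_ring B n\<^esub> \<one>\<^bsub>mat_ring B n\<^esub>) (i, j)
          = (\<Oplus>\<^bsub>B\<^esub>k\<in>{..<n}. if j = k then M (i, k) else \<zero>\<^bsub>B\<^esub>)"
        unfolding entry[OF ij] using ij ent[OF M] by (intro finsum_cong') (auto simp: one_entry)
      also have "\<dots> = M (i, j)"
        using ij ent[OF M] by (intro finsum_singleton[where f = "\<lambda>k. M (i, k)"]) auto
      finally show "(M \<otimes>\<^bsub>mat_ring B n\<^esub> \<one>\<^bsub>mat_ring B n\<^esub>) (i, j) = M (i, j)" .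
    qed (use M closed one in auto)
  qed (use closed one in auto)
qed

lemma group_GL: "cring B \<Longrightarrow> group (GL B n)"
  unfolding GL_def by (rule monoid.units_group) (rule monoid_mat_ring)

text \<open>\<open>rep_ring G n\<close> represents the functor \<open>B \<mapsto> Hom(G, GL\<^sub>n(B))\<close>.\<close>

theorem rep_ring_universal_ex:
  assumes "group G" "cring B" "\<rho> \<in> hom G (GL B n)"
  shows "\<exists>\<phi>\<in>ring_hom (rep_ring G n) B. \<forall>g\<in>carrier G. mat_map n \<phi> (univ_rep G n g) = \<rho> g"
proof -
  interpret G: group G by fact
  interpret B: cring B by fact
  let ?V = "carrier G \<times> {..<n} \<times> {..<n}"
  define R where "R = rep_poly_ring G n"
  define I where "I = rep_ideal G n"
  define s where "s = (\<lambda>(g, i, j). \<rho> g (i, j))"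
  have \<rho>: "\<rho> g \<in> carrier (mat_ring B n)" if "g \<in> carrier G" for g
    using assms(3) that by (auto simp: hom_def GL_def units_of_def Units_def)
  have mult: "\<rho> (g \<otimes>\<^bsub>G\<^esub> h) = \<rho> g \<otimes>\<^bsub>mat_ring B n\<^esub> \<rho> h" if "g \<in> carrier G" "h \<in> carrier G" for g h
    using assms(3) that by (auto simp: hom_def GL_def units_of_def)
  have s: "s \<in> ?V \<rightarrow> carrier B"
    using \<rho> by (auto simp: s_def mat_ring_def PiE_iff)
  interpret R: cring R unfolding R_def rep_poly_ring_def by (rule cring_int_mpoly_ring)
  interpret I: ideal I R unfolding R_def I_def by (rule ideal_rep_ideal) fact
  define ev where "ev = mpoly_eval B s"
  have ev: "ev \<in> ring_hom R B"
    unfolding ev_def R_def rep_poly_ring_def by (rule B.mpoly_eval_hom[OF s])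
  interpret ev: ring_hom_cring R B ev by unfold_locales (rule ev)
  have R_simps: "p \<oplus>\<^bsub>R\<^esub> q = p + q" "p \<otimes>\<^bsub>R\<^esub> q = p * q" "\<one>\<^bsub>R\<^esub> = 1" "\<zero>\<^bsub>R\<^esub> = 0" for p q
    by (simp_all add: R_def rep_poly_ring_def int_mpoly_ring_def)
  have mvar: "mvar (g, i, j) \<in> carrier R" if "g \<in> carrier G" "i < n" "j < n" for g i j
    unfolding R_def rep_poly_ring_def using that by (intro mvar_closed) auto
  have ev_mvar: "ev (mvar (g, i, j)) = \<rho> g (i, j)" if "g \<in> carrier G" "i < n" "j < n" for g i j
    using B.mpoly_eval_mvar[OF s, of "(g, i, j)"] that by (simp add: ev_def s_def)
  have one: "\<rho> \<one>\<^bsub>G\<^esub> = \<one>\<^bsub>mat_ring B n\<^esub>"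
    using group_hom.hom_one[of G "GL B n" \<rho>] group_GL[OF assms(2)] assms(1,3)
    by (simp add: group_hom_def group_hom_axioms_def GL_def units_of_def)
  have ker: "p - q \<in> a_kernel R B ev"
    if "p \<in> carrier R" "q \<in> carrier R" "ev p = ev q" for p q
  proof -
    have pq: "p - q \<in> carrier R"
      using that int_mpoly_ring_diff_closed unfolding R_def rep_poly_ring_def by blast
    have *: "p - q \<oplus>\<^bsub>R\<^esub> q = p" by (simp add: R_simps)
    have "ev (p - q) \<oplus>\<^bsub>B\<^esub> ev q = ev q"
      unfolding ev.hom_add[OF pq that(2), symmetric] * by (rule that(3))
    then have "ev (p - q) = \<zero>\<^bsub>B\<^esub>"
      using B.add.r_cancel_one[OF ev.hom_closed[OF that(2)] ev.hom_closed[OF pq]] by simp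
    then show ?thesis
      unfolding a_kernel_def' using pq by blast
  qed
  have "rep_relations G n \<subseteq> a_kernel R B ev"
  proof -
    have "mvar (\<one>\<^bsub>G\<^esub>, i, j) - (if i = j then 1 else 0) \<in> a_kernel R B ev" if ij: "i < n" "j < n" for i j
      using R.one_closed R.zero_closed ev.hom_one ev.hom_zero
      by (intro ker mvar) (use ij in \<open>auto simp: ev_mvar one mat_ring_def R_simps\<close>)
    moreover have "mvar (g \<otimes>\<^bsub>G\<^esub> h, i, j) - (\<Sum>k<n. mvar (g, i, k) * mvar (h, k, j)) \<in> a_kernel R B ev"
      if gh: "g \<in> carrier G" "h \<in> carrier G" and ij: "i < n" "j < n" for g h i j
    proof -
      have car: "(\<lambda>k. mvar (g, i, k) \<otimes>\<^bsub>R\<^esub> mvar (h, k, j)) \<in> {..<n} \<rightarrow> carrier R"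
        using mvar gh ij by auto
      then have sum: "(\<Oplus>\<^bsub>R\<^esub>k\<in>{..<n}. mvar (g, i, k) \<otimes>\<^bsub>R\<^esub> mvar (h, k, j))
          = (\<Sum>k<n. mvar (g, i, k) * mvar (h, k, j))"
        unfolding R_simps unfolding R_def rep_poly_ring_def by (rule finsum_int_mpoly_ring)
      have "ev (\<Sum>k<n. mvar (g, i, k) * mvar (h, k, j))
          = (\<Oplus>\<^bsub>B\<^esub>k\<in>{..<n}. ev (mvar (g, i, k) \<otimes>\<^bsub>R\<^esub> mvar (h, k, j)))"
        unfolding sum[symmetric] using ev.hom_finsum[OF car] by (simp add: o_def)
      also have "\<dots> = (\<Oplus>\<^bsub>B\<^esub>k\<in>{..<n}. \<rho> g (i, k) \<otimes>\<^bsub>B\<^esub> \<rho> h (k, j))"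
        by (rule B.finsum_cong') (use gh ij mvar \<rho> in \<open>auto simp: ev_mvar mat_ring_def PiE_iff\<close>)
      also have "\<dots> = ev (mvar (g \<otimes>\<^bsub>G\<^esub> h, i, j))"
        using gh ij by (simp add: ev_mvar mult mat_ring_def)
      finally show ?thesis
        using R.finsum_closed[OF car] sum gh ij by (intro ker mvar) auto
    qed
    ultimately show ?thesis unfolding rep_relations_def by blast
  qed
  then have I_ker: "I \<subseteq> a_kernel R B ev"
    unfolding I_def rep_ideal_def R_def[symmetric]
    by (rule R.genideal_minimal[OF ring_hom_ring.kernel_is_ideal, rotated])
       (rule ring_hom_ringI2[OF R.ring_axioms B.ring_axioms ev])
  define \<phi> where "\<phi> = (\<lambda>C. the_elem (ev ` C))"
  have \<phi>: "\<phi> (I +>\<^bsub>R\<^esub> p) = ev p" if "p \<in> carrier R" for p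
  proof -
    have "ev x = ev p" if x: "x \<in> I +>\<^bsub>R\<^esub> p" for x
    proof -
      obtain i where i: "i \<in> I" "x = i \<oplus>\<^bsub>R\<^esub> p" using x by (auto simp: a_r_coset_def')
      then have "ev i = \<zero>\<^bsub>B\<^esub>" "i \<in> carrier R" using I_ker I.Icarr unfolding a_kernel_def' by auto
      then show ?thesis using i \<open>p \<in> _\<close> by simp
    qed
    then have "ev ` (I +>\<^bsub>R\<^esub> p) = {ev p}" using I.a_rcos_self[OF that] by blast
    then show ?thesis by (simp add: \<phi>_def)
  qed
  have Q: "rep_ring G n = R Quot I" by (simp add: R_def I_def rep_ring_def)
  have carr: "\<exists>p\<in>carrier R. C = I +>\<^bsub>R\<^esub> p" if "C \<in> carrier (R Quot I)" for C
    using that by (auto simp: FactRing_def A_RCOSETS_def' a_r_coset_def')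
  have \<pi>: "(+>\<^bsub>R\<^esub>) I \<in> ring_hom R (R Quot I)" by (rule I.rcos_ring_hom)
  have "\<phi> \<in> ring_hom (R Quot I) B"
  proof (rule ring_hom_memI)
    fix C assume "C \<in> carrier (R Quot I)"
    then obtain p where p: "p \<in> carrier R" "C = I +>\<^bsub>R\<^esub> p" using carr by blast
    then show "\<phi> C \<in> carrier B" by (simp add: \<phi>)
    fix D assume "D \<in> carrier (R Quot I)"
    then obtain q where q: "q \<in> carrier R" "D = I +>\<^bsub>R\<^esub> q" using carr by blast
    show "\<phi> (C \<otimes>\<^bsub>R Quot I\<^esub> D) = \<phi> C \<otimes>\<^bsub>B\<^esub> \<phi> D"
      using p q ring_hom_mult[OF \<pi>, of p q, symmetric] by (simp add: \<phi>)
    show "\<phi> (C \<oplus>\<^bsub>R Quot I\<^esub> D) = \<phi> C \<oplus>\<^bsub>B\<^esub> \<phi> D"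
      using p q ring_hom_add[OF \<pi>, of p q, symmetric] by (simp add: \<phi>)
  next
    show "\<phi> \<one>\<^bsub>R Quot I\<^esub> = \<one>\<^bsub>B\<^esub>" using ring_hom_one[OF \<pi>] \<phi>[of "\<one>\<^bsub>R\<^esub>"] by simp
  qed
  moreover have "mat_map n \<phi> (univ_rep G n g) = \<rho> g" if g: "g \<in> carrier G" for g
  proof (rule PiE_ext[of _ "{..<n} \<times> {..<n}" "\<lambda>_. carrier B"])
    show "\<rho> g \<in> {..<n} \<times> {..<n} \<rightarrow>\<^sub>E carrier B" using \<rho>[OF g] by (simp add: mat_ring_def)
    have entry: "mat_map n \<phi> (univ_rep G n g) (i, j) = \<rho> g (i, j)" if "i < n" "j < n" for i j
      using that g \<phi>[OF mvar[OF g that]] ev_mvar[OF g that]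
      by (simp add: mat_map_def univ_rep_def R_def I_def)
    then show "\<And>x. x \<in> {..<n} \<times> {..<n} \<Longrightarrow> mat_map n \<phi> (univ_rep G n g) x = \<rho> g x" by auto
    show "mat_map n \<phi> (univ_rep G n g) \<in> {..<n} \<times> {..<n} \<rightarrow>\<^sub>E carrier B"
      using entry \<rho>[OF g] by (auto simp: mat_ring_def PiE_iff mat_map_def extensional_def)
  qed
  ultimately show ?thesis unfolding Q by blast
qed

theorem rep_ring_universal_unique:
  assumes "group G" "cring B" "\<phi> \<in> ring_hom (rep_ring G n) B" "\<psi> \<in> ring_hom (rep_ring G n) B"
    and "\<And>g. g \<in> carrier G \<Longrightarrow> mat_map n \<phi> (univ_rep G n g) = mat_map n \<psi> (univ_rep G n g)"
    and "a \<in> carrier (rep_ring G n)"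
  shows "\<phi> a = \<psi> a"
proof -
  interpret G: group G by fact
  interpret B: cring B by fact
  let ?V = "carrier G \<times> {..<n} \<times> {..<n}"
  define R where "R = int_mpoly_ring ?V"
  define I where "I = rep_ideal G n"
  have R: "rep_poly_ring G n = R" by (simp add: R_def rep_poly_ring_def)
  interpret R: cring R unfolding R_def by (rule cring_int_mpoly_ring)
  interpret I: ideal I R unfolding R[symmetric] I_def by (rule ideal_rep_ideal) fact
  define f where "f = \<phi> \<circ> (+>\<^bsub>R\<^esub>) I"
  define h where "h = \<psi> \<circ> (+>\<^bsub>R\<^esub>) I"
  have Q: "rep_ring G n = R Quot I" by (simp add: R I_def rep_ring_def)
  interpret f: ring_hom_cring R B f
    by unfold_locales (use ring_hom_trans[OF I.rcos_ring_hom] assms(3) in \<open>simp add: f_def Q\<close>)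
  interpret h: ring_hom_cring R B h
    by unfold_locales (use ring_hom_trans[OF I.rcos_ring_hom] assms(4) in \<open>simp add: h_def Q\<close>)
  define E where "E = {p \<in> carrier R. f p = h p}"
  have E0: "0 \<in> E" using f.hom_zero h.hom_zero R.zero_closed unfolding E_def R_def int_mpoly_ring_simps by simp
  have E1: "1 \<in> E" using f.hom_one h.hom_one R.one_closed unfolding E_def R_def int_mpoly_ring_simps by simp
  have Ea: "p + q \<in> E" if "p \<in> E" "q \<in> E" for p q
    using that f.hom_add[of p q] h.hom_add[of p q] R.a_closed[of p q]
    unfolding E_def R_def int_mpoly_ring_simps by simp
  have Em: "p * q \<in> E" if "p \<in> E" "q \<in> E" for p q
    using that f.hom_mult[of p q] h.hom_mult[of p q] R.m_closed[of p q]
    unfolding E_def R_def int_mpoly_ring_simps by simp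
  have En: "- p \<in> E" if "p \<in> E" for p
  proof -
    have p: "p \<in> carrier R" "f p = h p" using that by (auto simp: E_def)
    then have np: "- p \<in> carrier R" by (auto simp: R_def int_mpoly_ring_def)
    have "- p = \<ominus>\<^bsub>R\<^esub> p"
      by (rule R.minus_equality[symmetric]) (use p np in \<open>auto simp: R_def int_mpoly_ring_simps\<close>)
    then show ?thesis using p np by (simp add: E_def)
  qed
  have Ev: "mvar v \<in> E" if vV: "v \<in> ?V" for v
  proof -
    obtain g i j where v: "v = (g, i, j)" "g \<in> carrier G" "i < n" "j < n" using vV by auto
    have "mat_map n \<phi> (univ_rep G n g) (i, j) = mat_map n \<psi> (univ_rep G n g) (i, j)"
      using assms(5)[OF v(2)] by simp
    then have "f (mvar v) = h (mvar v)"
      using v by (simp add: mat_map_def univ_rep_def f_def h_def R I_def)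
    then show ?thesis using vV mvar_closed[of v ?V] by (simp add: E_def R_def)
  qed
  have Ep: "p ^ k \<in> E" if "p \<in> E" for p k
    by (induction k) (use that E1 Em in auto)
  have single_var: "Poly_Mapping.single (Poly_Mapping.single v k) 1 = mvar v ^ k" for v :: "'g \<times> nat \<times> nat" and k
  proof (induction k)
    case (Suc k)
    have "Poly_Mapping.single (Poly_Mapping.single v (Suc k)) (1::int)
        = Poly_Mapping.single (Poly_Mapping.single v 1) 1 * Poly_Mapping.single (Poly_Mapping.single v k) 1"
      by (simp add: mult_single flip: single_add)
    then show ?case by (simp add: Suc mvar_def)
  qed simp
  have Emon: "Poly_Mapping.single t 1 \<in> E" if t: "Poly_Mapping.keys t \<subseteq> ?V" for t
  proof -
    have "Poly_Mapping.single (\<Sum>v\<in>W. Poly_Mapping.single v (Poly_Mapping.lookup t v)) 1 \<in> E"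
      if "finite W" "W \<subseteq> ?V" for W
      using that
    proof (induction W)
      case (insert v W)
      have "Poly_Mapping.single (\<Sum>v\<in>insert v W. Poly_Mapping.single v (Poly_Mapping.lookup t v)) (1::int)
          = mvar v ^ Poly_Mapping.lookup t v
            * Poly_Mapping.single (\<Sum>v\<in>W. Poly_Mapping.single v (Poly_Mapping.lookup t v)) 1"
        using insert.hyps by (simp add: mult_single flip: single_var)
      then show ?case using insert Em Ep Ev by simp
    qed (use E1 in simp)
    from this[of "Poly_Mapping.keys t"] t sum_single_keys[of t] show ?thesis by simp
  qed
  have Eint: "of_int c \<in> E" for c
  proof (induction c rule: int_induct[where k = 0])
    case (step1 i) then show ?case using Ea[OF _ E1] by simp
  next
    case (step2 i) then show ?case using Ea[OF _ En[OF E1]] by simp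
  qed (use E0 in simp)
  have Esingle: "Poly_Mapping.single t c \<in> E" if "Poly_Mapping.keys t \<subseteq> ?V" for t c
  proof -
    have "Poly_Mapping.single t c = of_int c * Poly_Mapping.single t 1"
      by (simp add: mult_single flip: single_of_int)
    then show ?thesis using Em Eint Emon that by simp
  qed
  have Esum: "sum k A \<in> E" if "k \<in> A \<rightarrow> E" for k and A :: "(('g \<times> nat \<times> nat) \<Rightarrow>\<^sub>0 nat) set"
    using that by (induction A rule: infinite_finite_induct) (use E0 Ea in auto)
  have "\<exists>p\<in>carrier R. a = I +>\<^bsub>R\<^esub> p"
    using assms(6) unfolding Q by (auto simp: FactRing_def A_RCOSETS_def' a_r_coset_def')
  then obtain p where p: "p \<in> carrier R" "a = I +>\<^bsub>R\<^esub> p" by blast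
  have "(\<Sum>t\<in>Poly_Mapping.keys p. Poly_Mapping.single t (Poly_Mapping.lookup p t)) \<in> E"
    using p(1) by (intro Esum) (auto intro!: Esingle simp: R_def int_mpoly_ring_def)
  then have "p \<in> E" using sum_single_keys[of p] by simp
  then show ?thesis by (simp add: E_def f_def h_def p(2))
qed

section \<open>Exterior powers are modules and induced maps are well defined\<close>

lemma coord_space_simps:
  "carrier (coord_space R n) = {..<n} \<rightarrow>\<^sub>E carrier R"
  "\<zero>\<^bsub>coord_space R n\<^esub> = (\<lambda>i \<in> {..<n}. \<zero>\<^bsub>R\<^esub>)"
  "v \<oplus>\<^bsub>coord_space R n\<^esub> w = (\<lambda>i \<in> {..<n}. v i \<oplus>\<^bsub>R\<^esub> w i)"
  "a \<odot>\<^bsub>coord_space R n\<^esub> v = (\<lambda>i \<in> {..<n}. a \<otimes>\<^bsub>R\<^esub> v i)"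
  by (simp_all add: coord_space_def)

lemma module_coord_space:
  fixes R (structure)
  assumes "cring R"
  shows "module R (coord_space R n)"
proof -
  interpret cring R by fact
  have eqI: "v = w" if "v \<in> {..<n} \<rightarrow>\<^sub>E carrier R" "w \<in> {..<n} \<rightarrow>\<^sub>E carrier R" "\<And>i. i < n \<Longrightarrow> v i = w i" for v w
    by (rule PiE_ext[OF that(1,2)]) (use that(3) in auto)
  have ent: "v i \<in> carrier R" if "v \<in> {..<n} \<rightarrow>\<^sub>E carrier R" "i < n" for v i
    using that by auto
  show ?thesis
  proof (rule moduleI)
    show "abelian_group (coord_space R n)"
    proof (rule abelian_groupI, unfold coord_space_simps)
      fix v assume v: "v \<in> {..<n} \<rightarrow>\<^sub>E carrier R"
      show "\<exists>w\<in>{..<n} \<rightarrow>\<^sub>E carrier R. (\<lambda>i\<in>{..<n}. w i \<oplus> v i) = (\<lambda>i\<in>{..<n}. \<zero>)"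
        by (rule bexI[of _ "\<lambda>i\<in>{..<n}. \<ominus> v i"]) (use ent[OF v] in \<open>auto simp: l_neg intro!: restrict_ext\<close>)
    next
      fix v assume v: "v \<in> {..<n} \<rightarrow>\<^sub>E carrier R"
      show "(\<lambda>i\<in>{..<n}. (\<lambda>i\<in>{..<n}. \<zero>) i \<oplus> v i) = v"
        by (rule eqI) (use v ent[OF v] in auto)
    next
      fix u v w assume *: "u \<in> {..<n} \<rightarrow>\<^sub>E carrier R" "v \<in> {..<n} \<rightarrow>\<^sub>E carrier R" "w \<in> {..<n} \<rightarrow>\<^sub>E carrier R"
      show "(\<lambda>i\<in>{..<n}. (\<lambda>i\<in>{..<n}. u i \<oplus> v i) i \<oplus> w i) = (\<lambda>i\<in>{..<n}. u i \<oplus> (\<lambda>i\<in>{..<n}. v i \<oplus> w i) i)"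
        by (rule restrict_ext) (use ent[OF *(1)] ent[OF *(2)] ent[OF *(3)] in \<open>simp add: a_assoc\<close>)
    next
      fix u v assume *: "u \<in> {..<n} \<rightarrow>\<^sub>E carrier R" "v \<in> {..<n} \<rightarrow>\<^sub>E carrier R"
      show "(\<lambda>i\<in>{..<n}. u i \<oplus> v i) = (\<lambda>i\<in>{..<n}. v i \<oplus> u i)"
        by (rule restrict_ext) (use ent[OF *(1)] ent[OF *(2)] in \<open>simp add: a_comm\<close>)
      show "(\<lambda>i\<in>{..<n}. u i \<oplus> v i) \<in> {..<n} \<rightarrow>\<^sub>E carrier R"
        using ent[OF *(1)] ent[OF *(2)] by auto
    qed auto
  next
    fix a v assume *: "a \<in> carrier R" "v \<in> carrier (coord_space R n)"
    then show "a \<odot>\<^bsub>coord_space R n\<^esub> v \<in> carrier (coord_space R n)"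
      unfolding coord_space_simps by auto
    fix b assume b: "b \<in> carrier R"
    show "(a \<oplus> b) \<odot>\<^bsub>coord_space R n\<^esub> v = a \<odot>\<^bsub>coord_space R n\<^esub> v \<oplus>\<^bsub>coord_space R n\<^esub> b \<odot>\<^bsub>coord_space R n\<^esub> v"
      unfolding coord_space_simps by (rule restrict_ext) (use * b ent in \<open>auto simp: coord_space_simps l_distr\<close>)
    show "(a \<otimes> b) \<odot>\<^bsub>coord_space R n\<^esub> v = a \<odot>\<^bsub>coord_space R n\<^esub> (b \<odot>\<^bsub>coord_space R n\<^esub> v)"
      unfolding coord_space_simps by (rule restrict_ext) (use * b ent in \<open>auto simp: coord_space_simps m_assoc\<close>)
  next
    fix a v w assume *: "a \<in> carrier R" "v \<in> carrier (coord_space R n)" "w \<in> carrier (coord_space R n)"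
    show "a \<odot>\<^bsub>coord_space R n\<^esub> (v \<oplus>\<^bsub>coord_space R n\<^esub> w) = a \<odot>\<^bsub>coord_space R n\<^esub> v \<oplus>\<^bsub>coord_space R n\<^esub> a \<odot>\<^bsub>coord_space R n\<^esub> w"
      unfolding coord_space_simps by (rule restrict_ext) (use * ent in \<open>auto simp: coord_space_simps r_distr\<close>)
  next
    fix v assume "v \<in> carrier (coord_space R n)"
    then have v: "v \<in> {..<n} \<rightarrow>\<^sub>E carrier R" by (simp add: coord_space_simps)
    show "\<one> \<odot>\<^bsub>coord_space R n\<^esub> v = v"
      unfolding coord_space_simps by (rule eqI) (use v ent[OF v] in auto)
  qed unfold_locales
qed

lemma free_module_simps:
  "u \<in> carrier (free_module R B) \<longleftrightarrow>
     (\<forall>x. u x \<in> carrier R) \<and> (\<forall>x. x \<notin> B \<longrightarrow> u x = \<zero>\<^bsub>R\<^esub>) \<and> finite {x. u x \<noteq> \<zero>\<^bsub>R\<^esub>}"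
  "\<zero>\<^bsub>free_module R B\<^esub> = (\<lambda>x. \<zero>\<^bsub>R\<^esub>)"
  "u \<oplus>\<^bsub>free_module R B\<^esub> w = (\<lambda>x. u x \<oplus>\<^bsub>R\<^esub> w x)"
  "a \<odot>\<^bsub>free_module R B\<^esub> u = (\<lambda>x. a \<otimes>\<^bsub>R\<^esub> u x)"
  by (simp_all add: free_module_def)

lemma module_free_module:
  fixes R (structure)
  assumes "cring R"
  shows "module R (free_module R B)"
proof -
  interpret cring R by fact
  note simps = free_module_simps
  have add: "(\<lambda>x. u x \<oplus> w x) \<in> carrier (free_module R B)"
    if "u \<in> carrier (free_module R B)" "w \<in> carrier (free_module R B)" for u w
  proof -
    have "finite ({x. u x \<noteq> \<zero>} \<union> {x. w x \<noteq> \<zero>})" using that by (simp add: simps(1))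
    then have "finite {x. u x \<oplus> w x \<noteq> \<zero>}" by (rule rev_finite_subset) auto
    then show ?thesis using that by (simp add: simps(1))
  qed
  have smult: "(\<lambda>x. a \<otimes> u x) \<in> carrier (free_module R B)"
    if "a \<in> carrier R" "u \<in> carrier (free_module R B)" for a u
  proof -
    have "finite {x. u x \<noteq> \<zero>}" using that by (simp add: simps(1))
    then have "finite {x. a \<otimes> u x \<noteq> \<zero>}" by (rule rev_finite_subset) (use that in auto)
    then show ?thesis using that by (simp add: simps(1))
  qed
  have uminus: "(\<lambda>x. \<ominus> u x) \<in> carrier (free_module R B)"
    if "u \<in> carrier (free_module R B)" for u
  proof -
    have "finite {x. u x \<noteq> \<zero>}" using that by (simp add: simps(1))
    then have "finite {x. \<ominus> u x \<noteq> \<zero>}" by (rule rev_finite_subset) (use that in auto)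
    then show ?thesis using that by (simp add: simps(1))
  qed
  have c: "u x \<in> carrier R" if "u \<in> carrier (free_module R B)" for u x
    using that by (simp add: simps(1))
  show ?thesis
  proof (rule moduleI)
    show "abelian_group (free_module R B)"
    proof (rule abelian_groupI, unfold simps(2,3))
      fix u assume u: "u \<in> carrier (free_module R B)"
      show "\<exists>w\<in>carrier (free_module R B). (\<lambda>x. w x \<oplus> u x) = (\<lambda>x. \<zero>)"
        by (rule bexI[OF _ uminus[OF u]]) (simp add: c[OF u] l_neg)
    next
      show "(\<lambda>x. \<zero>) \<in> carrier (free_module R B)" by (simp add: simps(1))
    qed (simp_all add: add c a_ac)
  next
    fix a u assume *: "a \<in> carrier R" "u \<in> carrier (free_module R B)"
    show "a \<odot>\<^bsub>free_module R B\<^esub> u \<in> carrier (free_module R B)"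
      unfolding simps(4) by (rule smult[OF *])
    fix b assume b: "b \<in> carrier R"
    show "(a \<oplus> b) \<odot>\<^bsub>free_module R B\<^esub> u = a \<odot>\<^bsub>free_module R B\<^esub> u \<oplus>\<^bsub>free_module R B\<^esub> b \<odot>\<^bsub>free_module R B\<^esub> u"
      unfolding simps(3,4) using *(1) b c[OF *(2)] by (simp add: l_distr)
    show "(a \<otimes> b) \<odot>\<^bsub>free_module R B\<^esub> u = a \<odot>\<^bsub>free_module R B\<^esub> (b \<odot>\<^bsub>free_module R B\<^esub> u)"
      unfolding simps(4) using *(1) b c[OF *(2)] by (simp add: m_assoc)
  next
    fix a u w assume *: "a \<in> carrier R" "u \<in> carrier (free_module R B)" "w \<in> carrier (free_module R B)"
    show "a \<odot>\<^bsub>free_module R B\<^esub> (u \<oplus>\<^bsub>free_module R B\<^esub> w) = a \<odot>\<^bsub>free_module R B\<^esub> u \<oplus>\<^bsub>free_module R B\<^esub> a \<odot>\<^bsub>free_module R B\<^esub> w"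
      unfolding simps(3,4) using *(1) c[OF *(2)] c[OF *(3)] by (simp add: r_distr)
  next
    fix u assume u: "u \<in> carrier (free_module R B)"
    show "\<one> \<odot>\<^bsub>free_module R B\<^esub> u = u"
      unfolding simps(4) using c[OF u] by simp
  qed unfold_locales
qed

lemma module_quot_module:
  assumes "module R M" "submodule N R M"
  shows "module R (quot_module R M N)"
    and "\<And>x y. x \<in> carrier M \<Longrightarrow> y \<in> carrier M \<Longrightarrow>
           (N +>\<^bsub>M\<^esub> x) \<oplus>\<^bsub>quot_module R M N\<^esub> (N +>\<^bsub>M\<^esub> y) = N +>\<^bsub>M\<^esub> (x \<oplus>\<^bsub>M\<^esub> y)"
    and "\<And>a x. a \<in> carrier R \<Longrightarrow> x \<in> carrier M \<Longrightarrow>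
           a \<odot>\<^bsub>quot_module R M N\<^esub> (N +>\<^bsub>M\<^esub> x) = N +>\<^bsub>M\<^esub> (a \<odot>\<^bsub>M\<^esub> x)"
proof -
  interpret module R M by fact
  interpret N: submodule N R M by fact
  interpret N: abelian_subgroup N M
    by (rule abelian_subgroupI3) (unfold_locales)
  have Q: "carrier (quot_module R M N) = a_rcosets\<^bsub>M\<^esub> N" "\<zero>\<^bsub>quot_module R M N\<^esub> = N"
    "C \<oplus>\<^bsub>quot_module R M N\<^esub> D = C <+>\<^bsub>M\<^esub> D"
    "a \<odot>\<^bsub>quot_module R M N\<^esub> C = (\<Union>x\<in>C. N +>\<^bsub>M\<^esub> (a \<odot>\<^bsub>M\<^esub> x))" for C D a
    by (simp_all add: quot_module_def)
  show add: "(N +>\<^bsub>M\<^esub> x) \<oplus>\<^bsub>quot_module R M N\<^esub> (N +>\<^bsub>M\<^esub> y) = N +>\<^bsub>M\<^esub> (x \<oplus>\<^bsub>M\<^esub> y)"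
    if "x \<in> carrier M" "y \<in> carrier M" for x y
    unfolding Q using that by (rule N.a_rcos_sum)
  have cong: "N +>\<^bsub>M\<^esub> (a \<odot>\<^bsub>M\<^esub> x') = N +>\<^bsub>M\<^esub> (a \<odot>\<^bsub>M\<^esub> x)"
    if a: "a \<in> carrier R" and x: "x \<in> carrier M" and x': "x' \<in> N +>\<^bsub>M\<^esub> x" for a x x'
  proof -
    obtain u where u: "u \<in> N" "x' = u \<oplus>\<^bsub>M\<^esub> x" using x' by (auto simp: a_r_coset_def')
    then have "a \<odot>\<^bsub>M\<^esub> x' = a \<odot>\<^bsub>M\<^esub> u \<oplus>\<^bsub>M\<^esub> a \<odot>\<^bsub>M\<^esub> x"
      using a x N.a_subset by (auto simp: smult_r_distr)
    then have "a \<odot>\<^bsub>M\<^esub> x' \<in> N +>\<^bsub>M\<^esub> (a \<odot>\<^bsub>M\<^esub> x)"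
      using N.smult_closed[OF a u(1)] by (auto simp: a_r_coset_def')
    then show ?thesis using a x by (intro a_repr_independence[symmetric]) (auto intro: N.a_subgroup)
  qed
  show smult: "a \<odot>\<^bsub>quot_module R M N\<^esub> (N +>\<^bsub>M\<^esub> x) = N +>\<^bsub>M\<^esub> (a \<odot>\<^bsub>M\<^esub> x)"
    if "a \<in> carrier R" "x \<in> carrier M" for a x
    unfolding Q by (rule UN_constant_eq[OF N.a_rcos_self[OF that(2)]]) (intro ballI cong[OF that])
  have carr: "\<exists>x\<in>carrier M. C = N +>\<^bsub>M\<^esub> x" if "C \<in> carrier (quot_module R M N)" for C
    using that by (auto simp: Q A_RCOSETS_def' a_r_coset_def')
  have mem: "N +>\<^bsub>M\<^esub> x \<in> carrier (quot_module R M N)" if "x \<in> carrier M" for x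
    using that by (auto simp: Q A_RCOSETS_def')
  have ab: "abelian_group (quot_module R M N)"
  proof (rule abelian_groupI)
    have zero: "\<zero>\<^bsub>quot_module R M N\<^esub> = N +>\<^bsub>M\<^esub> \<zero>\<^bsub>M\<^esub>"
      using N.a_rcos_const[OF N.zero_closed] by (simp add: Q)
    show "\<zero>\<^bsub>quot_module R M N\<^esub> \<in> carrier (quot_module R M N)"
      unfolding zero by (rule mem) simp
    fix C assume "C \<in> carrier (quot_module R M N)"
    then obtain x where x: "x \<in> carrier M" "C = N +>\<^bsub>M\<^esub> x" using carr by blast
    show "\<zero>\<^bsub>quot_module R M N\<^esub> \<oplus>\<^bsub>quot_module R M N\<^esub> C = C"
      unfolding zero using x by (simp add: add)
    show "\<exists>D\<in>carrier (quot_module R M N). D \<oplus>\<^bsub>quot_module R M N\<^esub> C = \<zero>\<^bsub>quot_module R M N\<^esub>"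
      unfolding zero using x by (intro bexI[of _ "N +>\<^bsub>M\<^esub> (\<ominus>\<^bsub>M\<^esub> x)"]) (simp_all add: add mem M.l_neg)
    fix D assume "D \<in> carrier (quot_module R M N)"
    then obtain y where y: "y \<in> carrier M" "D = N +>\<^bsub>M\<^esub> y" using carr by blast
    show "C \<oplus>\<^bsub>quot_module R M N\<^esub> D \<in> carrier (quot_module R M N)"
      using x y by (simp add: add mem)
    show "C \<oplus>\<^bsub>quot_module R M N\<^esub> D = D \<oplus>\<^bsub>quot_module R M N\<^esub> C"
      using x y by (simp add: add M.a_comm)
    fix E assume "E \<in> carrier (quot_module R M N)"
    then obtain z where z: "z \<in> carrier M" "E = N +>\<^bsub>M\<^esub> z" using carr by blast
    show "C \<oplus>\<^bsub>quot_module R M N\<^esub> D \<oplus>\<^bsub>quot_module R M N\<^esub> E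
        = C \<oplus>\<^bsub>quot_module R M N\<^esub> (D \<oplus>\<^bsub>quot_module R M N\<^esub> E)"
      using x y z by (simp add: add M.a_assoc)
  qed
  show "module R (quot_module R M N)"
  proof (rule moduleI[OF _ ab])
    fix a C assume a: "a \<in> carrier R" and "C \<in> carrier (quot_module R M N)"
    then obtain x where x: "x \<in> carrier M" "C = N +>\<^bsub>M\<^esub> x" using carr by blast
    show "a \<odot>\<^bsub>quot_module R M N\<^esub> C \<in> carrier (quot_module R M N)"
      using a x by (simp add: smult mem)
    fix b assume b: "b \<in> carrier R"
    show "(a \<oplus>\<^bsub>R\<^esub> b) \<odot>\<^bsub>quot_module R M N\<^esub> C
        = a \<odot>\<^bsub>quot_module R M N\<^esub> C \<oplus>\<^bsub>quot_module R M N\<^esub> b \<odot>\<^bsub>quot_module R M N\<^esub> C"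
      using a b x by (simp add: smult add smult_l_distr)
    show "(a \<otimes>\<^bsub>R\<^esub> b) \<odot>\<^bsub>quot_module R M N\<^esub> C = a \<odot>\<^bsub>quot_module R M N\<^esub> (b \<odot>\<^bsub>quot_module R M N\<^esub> C)"
      using a b x by (simp add: smult smult_assoc1)
  next
    fix a C D assume a: "a \<in> carrier R" and "C \<in> carrier (quot_module R M N)" "D \<in> carrier (quot_module R M N)"
    then obtain x y where "x \<in> carrier M" "C = N +>\<^bsub>M\<^esub> x" "y \<in> carrier M" "D = N +>\<^bsub>M\<^esub> y" using carr by blast
    then show "a \<odot>\<^bsub>quot_module R M N\<^esub> (C \<oplus>\<^bsub>quot_module R M N\<^esub> D)
        = a \<odot>\<^bsub>quot_module R M N\<^esub> C \<oplus>\<^bsub>quot_module R M N\<^esub> a \<odot>\<^bsub>quot_module R M N\<^esub> D"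
      using a by (simp add: smult add smult_r_distr)
  next
    fix C assume "C \<in> carrier (quot_module R M N)"
    then obtain x where x: "x \<in> carrier M" "C = N +>\<^bsub>M\<^esub> x" using carr by blast
    then show "\<one>\<^bsub>R\<^esub> \<odot>\<^bsub>quot_module R M N\<^esub> C = C" by (simp add: smult)
  qed unfold_locales
qed

lemma submodule_submodule_gen:
  assumes "module R M" "S \<subseteq> carrier M"
  shows "submodule (submodule_gen R M S) R M" "S \<subseteq> submodule_gen R M S"
    and "\<And>N. submodule N R M \<Longrightarrow> S \<subseteq> N \<Longrightarrow> submodule_gen R M S \<subseteq> N"
proof -
  interpret module R M by fact
  note E = submoduleE
  have whole: "submodule (carrier M) R M" by (rule carrier_is_submodule)
  show "submodule (submodule_gen R M S) R M"
  proof (rule submoduleI)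
    show "submodule_gen R M S \<subseteq> carrier M"
      using whole assms(2) unfolding submodule_gen_def by blast
    show "\<zero>\<^bsub>M\<^esub> \<in> submodule_gen R M S"
      unfolding submodule_gen_def
      using subgroup.one_closed[OF submodule.axioms(1)] by fastforce
  qed (use E in \<open>auto simp: submodule_gen_def\<close>)
  show "S \<subseteq> submodule_gen R M S" unfolding submodule_gen_def by blast
  show "submodule_gen R M S \<subseteq> N" if "submodule N R M" "S \<subseteq> N" for N
    using that unfolding submodule_gen_def by blast
qed

lemma (in cring) free_gen_closed: "x \<in> B \<Longrightarrow> free_gen R x \<in> carrier (free_module R B)"
proof -
  have "finite {y. free_gen R x y \<noteq> \<zero>}"
    by (rule finite_subset[of _ "{x}"]) (auto simp: free_gen_def)
  then show "x \<in> B \<Longrightarrow> free_gen R x \<in> carrier (free_module R B)"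
    by (auto simp: free_module_simps free_gen_def)
qed

lemma (in cring) free_map_superset:
  assumes "u \<in> carrier (free_module R B)" "finite T" "{x. u x \<noteq> \<zero>} \<subseteq> T"
  shows "free_map R f u y = (\<Oplus>x\<in>{x \<in> T. f x = y}. u x)"
  unfolding free_map_def
  by (rule add.finprod_mono_neutral_cong_left) (use assms in \<open>auto simp: free_module_simps\<close>)

lemma (in cring) free_map_closed:
  assumes u: "u \<in> carrier (free_module R B)" and f: "f \<in> B \<rightarrow> B'"
  shows "free_map R f u \<in> carrier (free_module R B')"
proof -
  let ?S = "{x. u x \<noteq> \<zero>}"
  have S: "finite ?S" "?S \<subseteq> B" "\<And>x. u x \<in> carrier R" using u by (auto simp: free_module_simps)
  have 0: "free_map R f u y = \<zero>" if "y \<notin> f ` ?S" for y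
  proof -
    have *: "{x. u x \<noteq> \<zero> \<and> f x = y} = {}" using that by auto
    show ?thesis unfolding free_map_def * by simp
  qed
  have "{y. free_map R f u y \<noteq> \<zero>} \<subseteq> f ` ?S" using 0 by blast
  then have "finite {y. free_map R f u y \<noteq> \<zero>}" using S(1) finite_subset by blast
  moreover have "free_map R f u y = \<zero>" if "y \<notin> B'" for y
    by (rule 0) (use that S(2) f in auto)
  moreover have "free_map R f u y \<in> carrier R" for y
    unfolding free_map_def using S(3) by (intro finsum_closed) auto
  ultimately show ?thesis by (simp add: free_module_simps)
qed

lemma (in cring) free_map_add:
  assumes u: "u \<in> carrier (free_module R B)" and w: "w \<in> carrier (free_module R B)"
  shows "free_map R f (u \<oplus>\<^bsub>free_module R B\<^esub> w) = free_map R f u \<oplus>\<^bsub>free_module R B'\<^esub> free_map R f w"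
proof
  fix y
  let ?T = "{x. u x \<noteq> \<zero>} \<union> {x. w x \<noteq> \<zero>}"
  interpret F: module R "free_module R B" by (rule module_free_module) (rule cring_axioms)
  have T: "finite ?T" "\<And>x. u x \<in> carrier R" "\<And>x. w x \<in> carrier R" using u w by (auto simp: free_module_simps)
  have "free_map R f (u \<oplus>\<^bsub>free_module R B\<^esub> w) y = (\<Oplus>x\<in>{x \<in> ?T. f x = y}. (u \<oplus>\<^bsub>free_module R B\<^esub> w) x)"
    by (rule free_map_superset[OF F.a_closed[OF u w] T(1)]) (auto simp: free_module_simps)
  also have "\<dots> = (\<Oplus>x\<in>{x \<in> ?T. f x = y}. u x) \<oplus> (\<Oplus>x\<in>{x \<in> ?T. f x = y}. w x)"
    unfolding free_module_simps by (rule finsum_addf) (use T in auto)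
  also have "\<dots> = free_map R f u y \<oplus> free_map R f w y"
    using free_map_superset[OF u T(1), of f y] free_map_superset[OF w T(1), of f y] by simp
  finally show "free_map R f (u \<oplus>\<^bsub>free_module R B\<^esub> w) y = (free_map R f u \<oplus>\<^bsub>free_module R B'\<^esub> free_map R f w) y"
    by (simp add: free_module_simps)
qed

lemma (in cring) free_map_smult:
  assumes a: "a \<in> carrier R" and u: "u \<in> carrier (free_module R B)"
  shows "free_map R f (a \<odot>\<^bsub>free_module R B\<^esub> u) = a \<odot>\<^bsub>free_module R B'\<^esub> free_map R f u"
proof
  fix y
  let ?T = "{x. u x \<noteq> \<zero>}"
  interpret F: module R "free_module R B" by (rule module_free_module) (rule cring_axioms)
  have T: "finite ?T" "\<And>x. u x \<in> carrier R" using u by (auto simp: free_module_simps)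
  have "free_map R f (a \<odot>\<^bsub>free_module R B\<^esub> u) y = (\<Oplus>x\<in>{x \<in> ?T. f x = y}. (a \<odot>\<^bsub>free_module R B\<^esub> u) x)"
    by (rule free_map_superset[OF F.smult_closed[OF a u] T(1)]) (use a in \<open>auto simp: free_module_simps\<close>)
  also have "\<dots> = a \<otimes> (\<Oplus>x\<in>{x \<in> ?T. f x = y}. u x)"
    unfolding free_module_simps by (rule finsum_rdistr[symmetric]) (use T a in auto)
  also have "\<dots> = a \<otimes> free_map R f u y"
    using free_map_superset[OF u T(1), of f y] by simp
  finally show "free_map R f (a \<odot>\<^bsub>free_module R B\<^esub> u) y = (a \<odot>\<^bsub>free_module R B'\<^esub> free_map R f u) y"
    by (simp add: free_module_simps)
qed

lemma (in cring) free_map_free_gen: "free_map R f (free_gen R x) = free_gen R (f x)"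
proof
  fix y
  have "{x'. free_gen R x x' \<noteq> \<zero> \<and> f x' = y} = (if \<one> \<noteq> \<zero> \<and> f x = y then {x} else {})"
    by (auto simp: free_gen_def)
  then have "free_map R f (free_gen R x) y = (if \<one> \<noteq> \<zero> \<and> f x = y then \<Oplus>x'\<in>{x}. free_gen R x x' else \<zero>)"
    unfolding free_map_def by (simp only: if_distrib[of "finsum R (free_gen R x)"] finsum_empty)
  also have "\<dots> = free_gen R (f x) y"
    by (auto simp: free_gen_def)
  finally show "free_map R f (free_gen R x) y = free_gen R (f x) y" .
qed

context module
begin

abbreviation ext_free :: "nat \<Rightarrow> ('a, 'c list \<Rightarrow> 'a) module" where
  "ext_free m \<equiv> free_module R (tuples M m)"

lemma tuples_update: "vs \<in> tuples M m \<Longrightarrow> x \<in> carrier M \<Longrightarrow> vs[k := x] \<in> tuples M m"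
  by (auto simp: tuples_def dest: set_update_subset_insert[THEN subsetD])

lemma ext_relations_closed: "ext_relations R M m \<subseteq> carrier (ext_free m)"
proof -
  interpret F: module R "ext_free m" by (rule module_free_module) (rule R.cring_axioms)
  show ?thesis
    unfolding ext_relations_def Let_def
    by (auto intro!: F.M.minus_closed F.a_closed F.smult_closed R.free_gen_closed tuples_update)
qed

lemma submodule_ext_kernel: "submodule (ext_kernel R M m) R (ext_free m)"
  unfolding ext_kernel_def
  by (rule submodule_submodule_gen[OF module_free_module[OF R.cring_axioms] ext_relations_closed])

lemma module_exterior_power: "module R (exterior_power R M m)"
  unfolding exterior_power_def
  by (rule module_quot_module[OF module_free_module[OF R.cring_axioms] submodule_ext_kernel])

lemma free_map_ext_kernel:
  assumes f: "f \<in> carrier M \<rightarrow> carrier M"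
    and f_add: "\<And>x y. x \<in> carrier M \<Longrightarrow> y \<in> carrier M \<Longrightarrow> f (x \<oplus>\<^bsub>M\<^esub> y) = f x \<oplus>\<^bsub>M\<^esub> f y"
    and f_smult: "\<And>a x. a \<in> carrier R \<Longrightarrow> x \<in> carrier M \<Longrightarrow> f (a \<odot>\<^bsub>M\<^esub> x) = a \<odot>\<^bsub>M\<^esub> f x"
    and u: "u \<in> ext_kernel R M m"
  shows "free_map R (map f) u \<in> ext_kernel R M m"
proof -
  let ?F = "ext_free m" and ?N = "ext_kernel R M m"
  interpret F: module R ?F by (rule module_free_module) (rule R.cring_axioms)
  note gen = submodule_submodule_gen[OF F.module_axioms ext_relations_closed, folded ext_kernel_def]
  note NE = F.submoduleE[OF submodule_ext_kernel[of m]]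
  have mapf: "map f \<in> tuples M m \<rightarrow> tuples M m"
    using f by (auto simp: tuples_def subset_iff Pi_iff)
  note add = R.free_map_add[of _ "tuples M m" _ _ "tuples M m"]
  note smult = R.free_map_smult[of _ _ "tuples M m" _ "tuples M m"]
  have N0: "\<zero>\<^bsub>?F\<^esub> \<in> ?N"
    using subgroup.one_closed[OF submodule.axioms(1)[OF submodule_ext_kernel[of m]]] by simp
  have F0: "free_map R (map f) \<zero>\<^bsub>?F\<^esub> = \<zero>\<^bsub>?F\<^esub>"
    by (simp add: free_map_def free_module_simps)
  define W where "W = {u \<in> carrier ?F. free_map R (map f) u \<in> ?N}"
  have W: "submodule W R ?F"
  proof (rule F.submoduleI)
    fix u assume u: "u \<in> W"
    then have u': "u \<in> carrier ?F" "free_map R (map f) u \<in> ?N" by (auto simp: W_def)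
    have "free_map R (map f) (\<ominus>\<^bsub>?F\<^esub> u) = \<ominus>\<^bsub>?F\<^esub> free_map R (map f) u"
      using u' smult[of "\<ominus> \<one>" u] R.free_map_closed[OF u'(1) mapf] by (simp add: F.smult_l_minus)
    then show "\<ominus>\<^bsub>?F\<^esub> u \<in> W" using u' NE(3) by (simp add: W_def)
  qed (use NE N0 F0 add smult in \<open>auto simp: W_def\<close>)
  have tup: "vs[k := x] \<in> tuples M m" if "vs \<in> tuples M m" "x \<in> carrier M" for vs k x
    using that by (rule tuples_update)
  have "ext_relations R M m \<subseteq> W"
  proof
    fix r assume r: "r \<in> ext_relations R M m"
    then have rF: "r \<in> carrier ?F" using ext_relations_closed by blast
    have "free_map R (map f) r \<in> ext_relations R M m"
      using r unfolding ext_relations_def Let_def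
    proof (elim UnE)
      assume "r \<in> {free_gen R (vs[k := (a \<odot>\<^bsub>M\<^esub> x) \<oplus>\<^bsub>M\<^esub> y])
          \<ominus>\<^bsub>?F\<^esub> ((a \<odot>\<^bsub>?F\<^esub> free_gen R (vs[k := x])) \<oplus>\<^bsub>?F\<^esub> free_gen R (vs[k := y]))
        | vs k a x y. vs \<in> tuples M m \<and> k < m \<and> a \<in> carrier R \<and> x \<in> carrier M \<and> y \<in> carrier M}"
      then obtain vs k a x y where *: "vs \<in> tuples M m" "k < m" "a \<in> carrier R" "x \<in> carrier M" "y \<in> carrier M"
        and r: "r = free_gen R (vs[k := (a \<odot>\<^bsub>M\<^esub> x) \<oplus>\<^bsub>M\<^esub> y])
          \<ominus>\<^bsub>?F\<^esub> ((a \<odot>\<^bsub>?F\<^esub> free_gen R (vs[k := x])) \<oplus>\<^bsub>?F\<^esub> free_gen R (vs[k := y]))"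
        by blast
      let ?p = "free_gen R (vs[k := (a \<odot>\<^bsub>M\<^esub> x) \<oplus>\<^bsub>M\<^esub> y])"
      let ?q = "(a \<odot>\<^bsub>?F\<^esub> free_gen R (vs[k := x])) \<oplus>\<^bsub>?F\<^esub> free_gen R (vs[k := y])"
      have gens: "?p \<in> carrier ?F" "free_gen R (vs[k := x]) \<in> carrier ?F" "free_gen R (vs[k := y]) \<in> carrier ?F"
        using * by (auto intro!: R.free_gen_closed tup)
      then have q: "?q \<in> carrier ?F" using * by simp
      have "\<ominus>\<^bsub>?F\<^esub> ?q = (\<ominus> \<one>) \<odot>\<^bsub>?F\<^esub> ?q" using q by (simp add: F.smult_l_minus)
      then have r': "r = ?p \<oplus>\<^bsub>?F\<^esub> ((\<ominus> \<one>) \<odot>\<^bsub>?F\<^esub> ?q)" by (simp add: r a_minus_def)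
      have fq: "free_map R (map f) ?q
          = (a \<odot>\<^bsub>?F\<^esub> free_gen R ((map f vs)[k := f x])) \<oplus>\<^bsub>?F\<^esub> free_gen R ((map f vs)[k := f y])" (is "_ = ?q'")
        using gens * by (simp add: add smult R.free_map_free_gen map_update)
      have fp: "free_map R (map f) ?p = free_gen R ((map f vs)[k := (a \<odot>\<^bsub>M\<^esub> f x) \<oplus>\<^bsub>M\<^esub> f y])" (is "_ = ?p'")
        using * by (simp add: R.free_map_free_gen map_update f_add f_smult)
      have q': "?q' \<in> carrier ?F" using R.free_map_closed[OF q mapf] fq by simp
      have "free_map R (map f) r = ?p' \<oplus>\<^bsub>?F\<^esub> ((\<ominus> \<one>) \<odot>\<^bsub>?F\<^esub> ?q')"
        unfolding r' using gens(1) q by (simp add: add smult fp fq)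
      also have "\<dots> = ?p' \<ominus>\<^bsub>?F\<^esub> ?q'" using q' by (simp add: F.smult_l_minus a_minus_def)
      finally show "free_map R (map f) r \<in> {free_gen R (vs[k := (a \<odot>\<^bsub>M\<^esub> x) \<oplus>\<^bsub>M\<^esub> y])
          \<ominus>\<^bsub>?F\<^esub> ((a \<odot>\<^bsub>?F\<^esub> free_gen R (vs[k := x])) \<oplus>\<^bsub>?F\<^esub> free_gen R (vs[k := y]))
        | vs k a x y. vs \<in> tuples M m \<and> k < m \<and> a \<in> carrier R \<and> x \<in> carrier M \<and> y \<in> carrier M}
        \<union> {free_gen R vs | vs i j. vs \<in> tuples M m \<and> i < j \<and> j < m \<and> vs ! i = vs ! j}"
        using * f mapf by blast
    next
      assume "r \<in> {free_gen R vs | vs i j. vs \<in> tuples M m \<and> i < j \<and> j < m \<and> vs ! i = vs ! j}"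
      then obtain vs i j where *: "vs \<in> tuples M m" "i < j" "j < m" "vs ! i = vs ! j" "r = free_gen R vs" by blast
      have "map f vs \<in> tuples M m" using mapf *(1) by auto
      moreover have "map f vs ! i = map f vs ! j" using *(1-4) by (simp add: tuples_def)
      ultimately have "map f vs \<in> tuples M m \<and> i < j \<and> j < m \<and> map f vs ! i = map f vs ! j"
        using *(2,3) by blast
      moreover have "free_map R (map f) r = free_gen R (map f vs)"
        using * by (simp add: R.free_map_free_gen)
      ultimately show "free_map R (map f) r \<in> {free_gen R (vs[k := (a \<odot>\<^bsub>M\<^esub> x) \<oplus>\<^bsub>M\<^esub> y])
          \<ominus>\<^bsub>?F\<^esub> ((a \<odot>\<^bsub>?F\<^esub> free_gen R (vs[k := x])) \<oplus>\<^bsub>?F\<^esub> free_gen R (vs[k := y]))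
        | vs k a x y. vs \<in> tuples M m \<and> k < m \<and> a \<in> carrier R \<and> x \<in> carrier M \<and> y \<in> carrier M}
        \<union> {free_gen R vs | vs i j. vs \<in> tuples M m \<and> i < j \<and> j < m \<and> vs ! i = vs ! j}"
        by blast
    qed
    then show "r \<in> W" using rF gen(2) by (auto simp: W_def)
  qed
  then have "?N \<subseteq> W" by (rule gen(3)[OF W])
  then show ?thesis using u by (auto simp: W_def)
qed

lemma exterior_map_coset:
  assumes f: "f \<in> carrier M \<rightarrow> carrier M"
    and f_add: "\<And>x y. x \<in> carrier M \<Longrightarrow> y \<in> carrier M \<Longrightarrow> f (x \<oplus>\<^bsub>M\<^esub> y) = f x \<oplus>\<^bsub>M\<^esub> f y"
    and f_smult: "\<And>a x. a \<in> carrier R \<Longrightarrow> x \<in> carrier M \<Longrightarrow> f (a \<odot>\<^bsub>M\<^esub> x) = a \<odot>\<^bsub>M\<^esub> f x"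
    and u: "u \<in> carrier (ext_free m)"
  shows "exterior_map R M m f (ext_kernel R M m +>\<^bsub>ext_free m\<^esub> u)
           = ext_kernel R M m +>\<^bsub>ext_free m\<^esub> free_map R (map f) u"
proof -
  let ?F = "ext_free m" and ?N = "ext_kernel R M m"
  interpret F: module R ?F by (rule module_free_module) (rule R.cring_axioms)
  interpret N: submodule ?N R ?F by (rule submodule_ext_kernel)
  interpret N: abelian_subgroup ?N ?F by (rule abelian_subgroupI3) (unfold_locales)
  have mapf: "map f \<in> tuples M m \<rightarrow> tuples M m"
    using f by (auto simp: tuples_def subset_iff Pi_iff)
  have "?N +>\<^bsub>?F\<^esub> free_map R (map f) u' = ?N +>\<^bsub>?F\<^esub> free_map R (map f) u"
    if u': "u' \<in> ?N +>\<^bsub>?F\<^esub> u" for u'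
  proof -
    obtain w where w: "w \<in> ?N" "u' = w \<oplus>\<^bsub>?F\<^esub> u" using u' by (auto simp: a_r_coset_def')
    then have "free_map R (map f) u' = free_map R (map f) w \<oplus>\<^bsub>?F\<^esub> free_map R (map f) u"
      using N.a_subset u by (auto intro: R.free_map_add)
    then have "free_map R (map f) u' \<in> ?N +>\<^bsub>?F\<^esub> free_map R (map f) u"
      using free_map_ext_kernel[OF f f_add f_smult w(1)] by (auto simp: a_r_coset_def')
    then show ?thesis
      using R.free_map_closed[OF u mapf] by (intro F.a_repr_independence[symmetric]) (auto intro: N.a_subgroup)
  qed
  then show ?thesis
    unfolding exterior_map_def by (intro UN_constant_eq[OF N.a_rcos_self[OF u]]) auto
qed

lemma exterior_map_wedge:
  assumes f: "f \<in> carrier M \<rightarrow> carrier M"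
    and f_add: "\<And>x y. x \<in> carrier M \<Longrightarrow> y \<in> carrier M \<Longrightarrow> f (x \<oplus>\<^bsub>M\<^esub> y) = f x \<oplus>\<^bsub>M\<^esub> f y"
    and f_smult: "\<And>a x. a \<in> carrier R \<Longrightarrow> x \<in> carrier M \<Longrightarrow> f (a \<odot>\<^bsub>M\<^esub> x) = a \<odot>\<^bsub>M\<^esub> f x"
    and vs: "vs \<in> tuples M m"
  shows "exterior_map R M m f (ext_kernel R M m +>\<^bsub>ext_free m\<^esub> free_gen R vs)
           = ext_kernel R M m +>\<^bsub>ext_free m\<^esub> free_gen R (map f vs)"
  using exterior_map_coset[OF f f_add f_smult R.free_gen_closed[OF vs]]
  by (simp add: R.free_map_free_gen)

end

end

theory Submission
  imports Defs "HOL-Combinatorics.Permutations"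
begin

text \<open>
  Let \<open>L\<close> be an algebraic closure of \<open>k(x)\<close>. By Burnside's theorem, the \<open>m\<close>-th exterior power of
  \<open>\<rho>\<^sub>x\<close> over \<open>L\<close> is irreducible iff no nonzero linear functional on the endomorphisms of the exterior
  power vanishes on all images of elements of \<open>G\<close>. In the basis of the exterior power indexed by strictly
  increasing lists, the entries of these images are minors of the \<open>\<rho>\<^sub>x g\<close>, that is, images under
  \<open>rep_ring G n \<rightarrow> L\<close> of elements which do not depend on \<open>x\<close>. Gaussian elimination carried out without
  division shows that a family of vectors over a ring \<open>A\<close> spans after base change along \<open>h : A \<rightarrow> L\<close>
  iff \<open>h t \<noteq> 0\<close> for some \<open>t\<close> in a fixed set of products of pivots. As \<open>h t = 0\<close> means \<open>t \<in> x\<close>, this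
  condition on \<open>x\<close> is open.
\<close>

section \<open>Linear maps and free modules\<close>

text \<open>The exterior power is a quotient of a free module on the usually infinite set of all
  \<open>m\<close>-tuples, so its freeness is not given. Minors supply coordinates that vanish on
  the relations, and these show that the wedges of unit vectors are independent. The tests for
  spanning must be fixed before the point and its residue field are known, so no pivot can be chosen
  according to what is nonzero at a point. All choices of pivots are followed at once over
  \<open>rep_ring G n\<close>, and a product of ring elements records that a branch is admissible
  and successful. The group may be infinite, and then so may the set of tests; openness does not
  suffer from this. Spanning is phrased through functionals because both elimination and the
  induction behind Burnside's theorem work with them directly. Algebraic closedness enters through a
  single fact: an endomorphism of a nonzero finite-dimensional space has an eigenvector, which gives
  Schur's lemma.\<close>

definition linear_map ::
    "('a, 'b) ring_scheme \<Rightarrow> ('a, 'm, 'c) module_scheme \<Rightarrow> ('a, 'n, 'e) module_scheme \<Rightarrow> ('m \<Rightarrow> 'n) \<Rightarrow> bool" where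
  "linear_map R M N f \<longleftrightarrow>
     f \<in> carrier M \<rightarrow> carrier N \<and>
     (\<forall>x\<in>carrier M. \<forall>y\<in>carrier M. f (x \<oplus>\<^bsub>M\<^esub> y) = f x \<oplus>\<^bsub>N\<^esub> f y) \<and>
     (\<forall>a\<in>carrier R. \<forall>x\<in>carrier M. f (a \<odot>\<^bsub>M\<^esub> x) = a \<odot>\<^bsub>N\<^esub> f x)"

lemma linear_mapI:
  assumes "\<And>x. x \<in> carrier M \<Longrightarrow> f x \<in> carrier N"
    and "\<And>x y. x \<in> carrier M \<Longrightarrow> y \<in> carrier M \<Longrightarrow> f (x \<oplus>\<^bsub>M\<^esub> y) = f x \<oplus>\<^bsub>N\<^esub> f y"
    and "\<And>a x. a \<in> carrier R \<Longrightarrow> x \<in> carrier M \<Longrightarrow> f (a \<odot>\<^bsub>M\<^esub> x) = a \<odot>\<^bsub>N\<^esub> f x"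
  shows "linear_map R M N f"
  using assms by (auto simp: linear_map_def)

lemma linear_mapD:
  assumes "linear_map R M N f"
  shows "x \<in> carrier M \<Longrightarrow> f x \<in> carrier N"
    and "x \<in> carrier M \<Longrightarrow> y \<in> carrier M \<Longrightarrow> f (x \<oplus>\<^bsub>M\<^esub> y) = f x \<oplus>\<^bsub>N\<^esub> f y"
    and "a \<in> carrier R \<Longrightarrow> x \<in> carrier M \<Longrightarrow> f (a \<odot>\<^bsub>M\<^esub> x) = a \<odot>\<^bsub>N\<^esub> f x"
  using assms by (auto simp: linear_map_def)

context module
begin

text \<open>Turns negation into a scalar multiple, so that closure under sums and multiples is all
  that has to be checked for submodules and linear maps.\<close>

lemma smult_minus_one: "x \<in> carrier M \<Longrightarrow> \<ominus>\<^bsub>M\<^esub> x = (\<ominus> \<one>) \<odot>\<^bsub>M\<^esub> x"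
  by (simp add: smult_l_minus)

lemma submoduleI':
  assumes "H \<subseteq> carrier M" "\<zero>\<^bsub>M\<^esub> \<in> H"
    and "\<And>x y. x \<in> H \<Longrightarrow> y \<in> H \<Longrightarrow> x \<oplus>\<^bsub>M\<^esub> y \<in> H"
    and "\<And>a x. a \<in> carrier R \<Longrightarrow> x \<in> H \<Longrightarrow> a \<odot>\<^bsub>M\<^esub> x \<in> H"
  shows "submodule H R M"
  using assms by (intro submoduleI) (auto simp: smult_minus_one subset_iff)

lemma submodule_zero_mem: "submodule H R M \<Longrightarrow> \<zero>\<^bsub>M\<^esub> \<in> H"
  using subgroup.one_closed[OF submodule.axioms(1)] by fastforce

lemma linear_map_zero:
  assumes "module R N" "linear_map R M N f"
  shows "f \<zero>\<^bsub>M\<^esub> = \<zero>\<^bsub>N\<^esub>"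
proof -
  interpret N: module R N by fact
  have "f (\<zero> \<odot>\<^bsub>M\<^esub> \<zero>\<^bsub>M\<^esub>) = \<zero> \<odot>\<^bsub>N\<^esub> f \<zero>\<^bsub>M\<^esub>"
    using linear_mapD[OF assms(2)] by blast
  then show ?thesis using linear_mapD(1)[OF assms(2)] by simp
qed

lemma submodule_equalizer:
  assumes "module R N" "linear_map R M N f" "linear_map R M N g"
  shows "submodule {x \<in> carrier M. f x = g x} R M"
  by (rule submoduleI')
    (auto simp: linear_mapD[OF assms(2)] linear_mapD[OF assms(3)] linear_map_zero[OF assms(1,2)] linear_map_zero[OF assms(1,3)])

lemma submodule_vimage:
  assumes N: "module R N" and f: "linear_map R M N f" and H: "submodule H R N"
  shows "submodule {x \<in> carrier M. f x \<in> H} R M"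
proof -
  interpret N: module R N by fact
  show ?thesis
    by (rule submoduleI')
      (auto simp: linear_mapD[OF f] linear_map_zero[OF N f] N.submodule_zero_mem[OF H] N.submoduleE(4,5)[OF H])
qed

lemma submodule_image:
  assumes N: "module R N" and f: "linear_map R M N f" and H: "submodule H R M"
  shows "submodule (f ` H) R N"
proof -
  interpret N: module R N by fact
  note HE = submoduleE[OF H]
  have sub: "x \<in> H \<Longrightarrow> x \<in> carrier M" for x using HE(1) by blast
  show ?thesis
  proof (rule N.submoduleI')
    show "\<zero>\<^bsub>N\<^esub> \<in> f ` H"
      using linear_map_zero[OF N f] submodule_zero_mem[OF H] by (metis imageI)
    fix x y assume "x \<in> f ` H" "y \<in> f ` H"
    then obtain x' y' where *: "x' \<in> H" "y' \<in> H" "x = f x'" "y = f y'" by blast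
    show "x \<oplus>\<^bsub>N\<^esub> y \<in> f ` H"
      using * HE(5)[of x' y'] linear_mapD(2)[OF f sub sub] by (metis imageI)
  next
    fix a x assume a: "a \<in> carrier R" and "x \<in> f ` H"
    then obtain x' where *: "x' \<in> H" "x = f x'" by blast
    show "a \<odot>\<^bsub>N\<^esub> x \<in> f ` H"
      using * HE(4)[of a x'] a linear_mapD(3)[OF f a sub] by (metis imageI)
  qed (use linear_mapD(1)[OF f] sub in auto)
qed

end

context cring
begin

lemma free_moduleD: "u \<in> carrier (free_module R B) \<Longrightarrow> u x \<in> carrier R"
  "u \<in> carrier (free_module R B) \<Longrightarrow> x \<notin> B \<Longrightarrow> u x = \<zero>"
  by (simp_all add: free_module_simps)

lemma free_moduleI:
  assumes "finite B" "\<And>x. u x \<in> carrier R" "\<And>x. x \<notin> B \<Longrightarrow> u x = \<zero>"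
  shows "u \<in> carrier (free_module R B)"
  using assms finite_subset[of "{x. u x \<noteq> \<zero>}" B] by (auto simp: free_module_simps)

text \<open>This serves as the induction principle for free modules: a property that cuts out a
  submodule has to be checked on generators only. The induction runs over a finite set containing
  the support, since \<open>B\<close> itself, for instance a set of tuples, may be infinite.\<close>

lemma free_module_spanned:
  assumes W: "submodule W R (free_module R B)" and gen: "\<And>b. b \<in> B \<Longrightarrow> free_gen R b \<in> W"
  shows "W = carrier (free_module R B)"
proof -
  let ?F = "free_module R B"
  interpret F: module R ?F by (rule module_free_module) (rule cring_axioms)
  note WE = F.submoduleE[OF W]
  have "u \<in> W" if "finite A" "u \<in> carrier ?F" "{x. u x \<noteq> \<zero>} \<subseteq> A" for A u
    using that
  proof (induction A arbitrary: u)
    case empty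
    then have "u = \<zero>\<^bsub>?F\<^esub>" by (auto simp: free_module_simps)
    then show ?case using F.submodule_zero_mem[OF W] by simp
  next
    case (insert a A)
    note u = free_moduleD[OF insert.prems(1)]
    have "finite {x. (u(a := \<zero>)) x \<noteq> \<zero>}"
      by (rule finite_subset[OF _ \<open>finite A\<close>]) (use insert.prems in auto)
    then have u': "u(a := \<zero>) \<in> carrier ?F"
      using u by (auto simp: free_module_simps)
    show ?case
    proof (cases "a \<in> B")
      case True
      have "u = u(a := \<zero>) \<oplus>\<^bsub>?F\<^esub> u a \<odot>\<^bsub>?F\<^esub> free_gen R a"
        using u by (auto simp: free_module_simps free_gen_def)
      moreover have "u(a := \<zero>) \<in> W"
        by (rule insert.IH[OF u']) (use insert.prems in auto)
      ultimately show ?thesis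
        using WE(4)[OF u(1) gen[OF True], of a] WE(5) by metis
    next
      case False
      then show ?thesis
        using u insert.prems by (intro insert.IH) auto
    qed
  qed
  then have "carrier ?F \<subseteq> W" by (auto simp: free_module_simps(1))
  then show ?thesis using WE(1) by blast
qed

lemma linear_map_eq_on_gens:
  assumes "module R N" "linear_map R (free_module R B) N f" "linear_map R (free_module R B) N g"
    and "\<And>b. b \<in> B \<Longrightarrow> f (free_gen R b) = g (free_gen R b)" "u \<in> carrier (free_module R B)"
  shows "f u = g u"
proof -
  interpret F: module R "free_module R B" by (rule module_free_module) (rule cring_axioms)
  have "{x \<in> carrier (free_module R B). f x = g x} = carrier (free_module R B)"
    by (rule free_module_spanned[OF F.submodule_equalizer[OF assms(1-3)]]) (use assms(4) free_gen_closed in auto)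
  then show ?thesis using assms(5) by blast
qed

lemma linear_functional_finsum:
  assumes "finite B" "\<And>x. x \<in> B \<Longrightarrow> f x \<in> carrier R"
    and "u \<in> carrier (free_module R B)" "w \<in> carrier (free_module R B)" "a \<in> carrier R"
  shows "(\<Oplus>x\<in>B. (u \<oplus>\<^bsub>free_module R B\<^esub> w) x \<otimes> f x) = (\<Oplus>x\<in>B. u x \<otimes> f x) \<oplus> (\<Oplus>x\<in>B. w x \<otimes> f x)"
    and "(\<Oplus>x\<in>B. (a \<odot>\<^bsub>free_module R B\<^esub> u) x \<otimes> f x) = a \<otimes> (\<Oplus>x\<in>B. u x \<otimes> f x)"
proof -
  note uw = free_moduleD(1)[OF assms(3)] free_moduleD(1)[OF assms(4)]
  have "(\<Oplus>x\<in>B. (u \<oplus>\<^bsub>free_module R B\<^esub> w) x \<otimes> f x) = (\<Oplus>x\<in>B. u x \<otimes> f x \<oplus> w x \<otimes> f x)"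
    using uw assms(2) by (intro finsum_cong') (auto simp: free_module_simps l_distr)
  then show "(\<Oplus>x\<in>B. (u \<oplus>\<^bsub>free_module R B\<^esub> w) x \<otimes> f x) = (\<Oplus>x\<in>B. u x \<otimes> f x) \<oplus> (\<Oplus>x\<in>B. w x \<otimes> f x)"
    using uw assms(2) by (simp add: finsum_addf Pi_iff)
  have "(\<Oplus>x\<in>B. (a \<odot>\<^bsub>free_module R B\<^esub> u) x \<otimes> f x) = (\<Oplus>x\<in>B. a \<otimes> (u x \<otimes> f x))"
    using uw assms(2,5) by (intro finsum_cong') (auto simp: free_module_simps m_assoc)
  then show "(\<Oplus>x\<in>B. (a \<odot>\<^bsub>free_module R B\<^esub> u) x \<otimes> f x) = a \<otimes> (\<Oplus>x\<in>B. u x \<otimes> f x)"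
    using uw assms by (simp add: finsum_rdistr Pi_iff)
qed

lemma finsum_free_gen:
  assumes "finite B" "b \<in> B" "\<And>x. x \<in> B \<Longrightarrow> f x \<in> carrier R"
  shows "(\<Oplus>x\<in>B. free_gen R b x \<otimes> f x) = f b"
proof -
  have "(\<Oplus>x\<in>B. free_gen R b x \<otimes> f x) = (\<Oplus>x\<in>B. if b = x then f x else \<zero>)"
    using assms by (intro finsum_cong') (auto simp: free_gen_def)
  also have "\<dots> = f b" by (rule finsum_singleton) (use assms in auto)
  finally show ?thesis .
qed

text \<open>The matrix form of a linear map. Both sides agree on generators; their values lie in
  \<open>R\<close>, which is not packaged as a module over itself, so the set where they agree is
  shown to be a submodule by hand.\<close>

lemma linear_map_coords:
  assumes B: "finite B" and f: "linear_map R (free_module R B) (free_module R C) f"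
    and u: "u \<in> carrier (free_module R B)"
  shows "f u i = (\<Oplus>j\<in>B. u j \<otimes> f (free_gen R j) i)"
proof -
  let ?F = "free_module R B"
  interpret F: module R ?F by (rule module_free_module) (rule cring_axioms)
  interpret C: module R "free_module R C" by (rule module_free_module) (rule cring_axioms)
  have c: "f (free_gen R j) i \<in> carrier R" if "j \<in> B" for j
    by (rule free_moduleD(1)[OF linear_mapD(1)[OF f free_gen_closed[OF that]]])
  define s where "s u = (\<Oplus>j\<in>B. u j \<otimes> f (free_gen R j) i)" for u
  have sa: "s (x \<oplus>\<^bsub>?F\<^esub> y) = s x \<oplus> s y" if "x \<in> carrier ?F" "y \<in> carrier ?F" for x y
    unfolding s_def by (rule linear_functional_finsum(1)[OF B c that zero_closed])
  have ss: "s (a \<odot>\<^bsub>?F\<^esub> x) = a \<otimes> s x" if "x \<in> carrier ?F" "a \<in> carrier R" for x a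
    unfolding s_def by (rule linear_functional_finsum(2)[OF B c that(1,1,2)])
  have s0: "s \<zero>\<^bsub>?F\<^esub> = \<zero>"
    unfolding s_def using c by (intro add.finprod_one_eqI) (simp add: free_module_simps)
  have f0: "f \<zero>\<^bsub>?F\<^esub> i = \<zero>"
    unfolding F.linear_map_zero[OF C.module_axioms f] by (simp add: free_module_simps)
  have fa: "f (x \<oplus>\<^bsub>?F\<^esub> y) i = f x i \<oplus> f y i" if "x \<in> carrier ?F" "y \<in> carrier ?F" for x y
    unfolding linear_mapD(2)[OF f that] by (simp only: free_module_simps)
  have fs: "f (a \<odot>\<^bsub>?F\<^esub> x) i = a \<otimes> f x i" if "a \<in> carrier R" "x \<in> carrier ?F" for x a
    unfolding linear_mapD(3)[OF f that] by (simp only: free_module_simps)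
  have "submodule {u \<in> carrier ?F. f u i = s u} R ?F"
    by (rule F.submoduleI') (simp_all add: s0 f0 fa fs sa ss)
  from free_module_spanned[OF this] have "f u i = s u"
    using u by (auto simp: s_def free_gen_closed finsum_free_gen[OF B _ c])
  then show ?thesis by (simp add: s_def)
qed

end

section \<open>Spanning families\<close>

text \<open>Spanning is expressed dually: only the zero functional vanishes on all of \<open>S\<close>.\<close>

definition spanning :: "('a, 'b) ring_scheme \<Rightarrow> 'x set \<Rightarrow> ('x \<Rightarrow> 'a) set \<Rightarrow> bool" where
  "spanning R D S \<longleftrightarrow>
     (\<forall>\<phi>\<in>D \<rightarrow> carrier R. (\<forall>s\<in>S. (\<Oplus>\<^bsub>R\<^esub>d\<in>D. \<phi> d \<otimes>\<^bsub>R\<^esub> s d) = \<zero>\<^bsub>R\<^esub>) \<longrightarrow> (\<forall>d\<in>D. \<phi> d = \<zero>\<^bsub>R\<^esub>))"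

context field
begin

text \<open>Induction on the equations: one of them is solved for an unknown with nonzero
  coefficient and substituted into the others. The application is a linear dependence among more
  vectors than there are coordinates.\<close>

lemma homogeneous_system:
  assumes "finite I" "finite J" "card I < card J"
    and "\<And>i j. i \<in> I \<Longrightarrow> j \<in> J \<Longrightarrow> a i j \<in> carrier R"
  shows "\<exists>c\<in>J \<rightarrow> carrier R. (\<exists>j\<in>J. c j \<noteq> \<zero>) \<and> (\<forall>i\<in>I. (\<Oplus>j\<in>J. c j \<otimes> a i j) = \<zero>)"
  using assms
proof (induction I arbitrary: J a)
  case empty
  then obtain j where "j \<in> J" by fastforce
  then show ?case by (intro bexI[of _ "\<lambda>_. \<one>"]) auto
next
  case (insert i I)
  note a = insert.prems(3)
  have "card I < card J" using insert by simp
  show ?case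
  proof (cases "\<forall>j\<in>J. a i j = \<zero>")
    case True
    obtain c where c: "c \<in> J \<rightarrow> carrier R" "\<exists>j\<in>J. c j \<noteq> \<zero>" "\<forall>i\<in>I. (\<Oplus>j\<in>J. c j \<otimes> a i j) = \<zero>"
      using insert.IH[of J a] insert.prems \<open>card I < card J\<close> by auto
    have "(\<Oplus>j\<in>J. c j \<otimes> a i j) = \<zero>"
      by (rule add.finprod_one_eqI) (use True c(1) in \<open>auto simp: Pi_iff\<close>)
    then show ?thesis using c by auto
  next
    case False
    then obtain p where p: "p \<in> J" "a i p \<noteq> \<zero>" by blast
    define q where "q = inv (a i p)"
    have q: "q \<in> carrier R" "q \<otimes> a i p = \<one>"
      using p a[of i p] field_Units by (auto simp: q_def)
    define J' where "J' = J - {p}"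
    have J: "J = insert p J'" "p \<notin> J'" "finite J'" using p insert.prems by (auto simp: J'_def)
    \<comment> \<open>\<open>b\<close> is what remains of equation \<open>k\<close> after
      substituting for unknown \<open>p\<close> the value that equation \<open>i\<close> forces on
      it.\<close>
    define b where "b k j = a k j \<ominus> a i j \<otimes> (q \<otimes> a k p)" for k j
    have ac: "a k j \<in> carrier R" if "k \<in> insert i I" "j \<in> insert p J'" for k j
      using that a J by auto
    have "\<exists>c\<in>J' \<rightarrow> carrier R. (\<exists>j\<in>J'. c j \<noteq> \<zero>) \<and> (\<forall>k\<in>I. (\<Oplus>j\<in>J'. c j \<otimes> b k j) = \<zero>)"
      by (rule insert.IH) (use insert.hyps insert.prems J ac q in \<open>auto simp: b_def\<close>)
    then obtain c where c: "c \<in> J' \<rightarrow> carrier R" "\<exists>j\<in>J'. c j \<noteq> \<zero>" "\<forall>k\<in>I. (\<Oplus>j\<in>J'. c j \<otimes> b k j) = \<zero>"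
      by blast
    define S where "S = (\<Oplus>j\<in>J'. c j \<otimes> a i j)"
    have S: "S \<in> carrier R" unfolding S_def using c(1) ac by (intro finsum_closed) auto
    \<comment> \<open>With this value of unknown \<open>p\<close>, equation \<open>i\<close> becomes
      \<open>\<ominus> S \<oplus> S = \<zero>\<close>.\<close>
    define c' where "c' = c(p := \<ominus> (S \<otimes> q))"
    have c': "c' \<in> J \<rightarrow> carrier R" using c(1) S q J by (auto simp: c'_def)
    have sum: "(\<Oplus>j\<in>J. c' j \<otimes> a k j) = (\<ominus> (S \<otimes> q)) \<otimes> a k p \<oplus> (\<Oplus>j\<in>J'. c j \<otimes> a k j)" if "k \<in> insert i I" for k
    proof -
      have "(\<Oplus>j\<in>J'. c' j \<otimes> a k j) = (\<Oplus>j\<in>J'. c j \<otimes> a k j)"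
        using c(1) ac that J by (intro finsum_cong') (auto simp: c'_def)
      moreover have "(\<Oplus>j\<in>J. c' j \<otimes> a k j) = c' p \<otimes> a k p \<oplus> (\<Oplus>j\<in>J'. c' j \<otimes> a k j)"
        unfolding J(1) using J(2,3) c' ac that by (intro finsum_insert) (auto simp: J(1))
      ultimately show ?thesis by (simp add: c'_def)
    qed
    have "(\<Oplus>j\<in>J. c' j \<otimes> a k j) = \<zero>" if k: "k \<in> insert i I" for k
    proof (cases "k = i")
      case True
      have "\<ominus> (S \<otimes> q) \<otimes> a i p = \<ominus> S"
        using S q ac[of i p] by (simp add: l_minus m_assoc)
      then show ?thesis using sum[OF k] S True by (simp add: l_neg flip: S_def)
    next
      case False
      then have kI: "k \<in> I" using k by simp
      have qk: "q \<otimes> a k p \<in> carrier R" using q(1) ac[OF k, of p] by auto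
      have "(\<Oplus>j\<in>J'. c j \<otimes> a k j) = (\<Oplus>j\<in>J'. c j \<otimes> b k j \<oplus> (c j \<otimes> a i j) \<otimes> (q \<otimes> a k p))"
      proof (rule finsum_cong')
        fix j assume j: "j \<in> J'"
        have *: "c j \<in> carrier R" "a k j \<in> carrier R" "a i j \<in> carrier R" using c(1) j ac kI by auto
        let ?t = "a i j \<otimes> (q \<otimes> a k p)"
        have t: "?t \<in> carrier R" using * qk by simp
        have "c j \<otimes> a k j = c j \<otimes> (b k j \<oplus> ?t)"
          using * t by (simp add: b_def a_minus_def a_assoc l_neg)
        then show "c j \<otimes> a k j = c j \<otimes> b k j \<oplus> (c j \<otimes> a i j) \<otimes> (q \<otimes> a k p)"
          using * t qk by (simp add: b_def r_distr m_assoc)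
      qed (use c(1) ac kI qk in \<open>auto simp: b_def Pi_iff\<close>)
      also have "\<dots> = (\<Oplus>j\<in>J'. c j \<otimes> b k j) \<oplus> (\<Oplus>j\<in>J'. (c j \<otimes> a i j) \<otimes> (q \<otimes> a k p))"
        using c(1) ac kI qk by (intro finsum_addf) (auto simp: b_def Pi_iff)
      also have "(\<Oplus>j\<in>J'. (c j \<otimes> a i j) \<otimes> (q \<otimes> a k p)) = S \<otimes> (q \<otimes> a k p)"
        unfolding S_def using c(1) ac qk J by (intro finsum_ldistr[symmetric]) auto
      finally have "(\<Oplus>j\<in>J'. c j \<otimes> a k j) = S \<otimes> (q \<otimes> a k p)"
        using c(3) kI S qk by simp
      then show ?thesis
        using sum[OF k] S q ac[OF k, of p] by (simp add: l_minus m_assoc l_neg)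
    qed
    moreover obtain j where "j \<in> J'" "c j \<noteq> \<zero>" using c(2) by blast
    then have "j \<in> J" "c' j \<noteq> \<zero>" using J by (auto simp: c'_def)
    ultimately show ?thesis using c' by blast
  qed
qed

text \<open>Only the values on \<open>D\<close> matter. The families compared later come from
  different formulas that agree on \<open>D\<close> but not necessarily elsewhere, so they need not
  be equal as sets of functions.\<close>

lemma spanning_cong:
  assumes "\<And>s. s \<in> S \<Longrightarrow> \<exists>t\<in>T. \<forall>d\<in>D. t d = s d" "\<And>t. t \<in> T \<Longrightarrow> \<exists>s\<in>S. \<forall>d\<in>D. s d = t d"
    and car: "\<And>s d. s \<in> S \<Longrightarrow> d \<in> D \<Longrightarrow> s d \<in> carrier R"
  shows "spanning R D S \<longleftrightarrow> spanning R D T"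
proof -
  have c: "(\<Oplus>d\<in>D. \<phi> d \<otimes> t d) = (\<Oplus>d\<in>D. \<phi> d \<otimes> s d)"
    if "\<forall>d\<in>D. t d = s d" "\<phi> \<in> D \<rightarrow> carrier R" "s \<in> S" for \<phi> s t
    by (rule finsum_cong') (use that car in auto)
  have "(\<forall>s\<in>S. (\<Oplus>d\<in>D. \<phi> d \<otimes> s d) = \<zero>) \<longleftrightarrow> (\<forall>s\<in>T. (\<Oplus>d\<in>D. \<phi> d \<otimes> s d) = \<zero>)"
    if "\<phi> \<in> D \<rightarrow> carrier R" for \<phi>
  proof (intro iffI ballI)
    fix t assume "t \<in> T" and 0: "\<forall>s\<in>S. (\<Oplus>d\<in>D. \<phi> d \<otimes> s d) = \<zero>"
    then obtain s where s: "s \<in> S" "\<forall>d\<in>D. s d = t d" using assms(2) by blast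
    then have "\<forall>d\<in>D. t d = s d" by simp
    from c[OF this that s(1)] show "(\<Oplus>d\<in>D. \<phi> d \<otimes> t d) = \<zero>" using 0 s(1) by simp
  next
    fix s assume s: "s \<in> S" and 0: "\<forall>s\<in>T. (\<Oplus>d\<in>D. \<phi> d \<otimes> s d) = \<zero>"
    then obtain t where t: "t \<in> T" "\<forall>d\<in>D. t d = s d" using assms(1) by blast
    from c[OF t(2) that s(1)] show "(\<Oplus>d\<in>D. \<phi> d \<otimes> s d) = \<zero>" using 0 t(1) by simp
  qed
  then show ?thesis unfolding spanning_def by blast
qed

text \<open>The functional reading off coordinate \<open>d\<close> kills \<open>S\<close> and is
  nonzero. Contrapositively, a spanning family offers a pivot in every coordinate.\<close>

lemma not_spanning_zero_coord:
  assumes "finite D" "d \<in> D" "\<And>s x. s \<in> S \<Longrightarrow> x \<in> D \<Longrightarrow> s x \<in> carrier R" "\<And>s. s \<in> S \<Longrightarrow> s d = \<zero>"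
  shows "\<not> spanning R D S"
proof
  assume "spanning R D S"
  moreover have "(\<Oplus>x\<in>D. free_gen R d x \<otimes> s x) = \<zero>" if "s \<in> S" for s
    using that assms by (subst finsum_free_gen) auto
  moreover have "free_gen R d \<in> D \<rightarrow> carrier R" by (auto simp: free_gen_def)
  ultimately have "free_gen R d d = \<zero>" using assms(2) unfolding spanning_def by blast
  then show False by (simp add: free_gen_def)
qed

text \<open>One step of Gaussian elimination, with pivot \<open>s d\<close>.\<close>

lemma spanning_eliminate:
  assumes D: "finite D" "d \<notin> D"
    and S: "\<And>t x. t \<in> S \<Longrightarrow> x \<in> insert d D \<Longrightarrow> t x \<in> carrier R"
    and s: "s \<in> S" "s d \<noteq> \<zero>"
  shows "spanning R (insert d D) S \<longleftrightarrow> spanning R D ((\<lambda>t x. s d \<otimes> t x \<ominus> t d \<otimes> s x) ` S)"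
proof -
  have sd: "s d \<in> carrier R" using S s by blast
  have elim: "(\<Oplus>x\<in>D. \<phi> x \<otimes> (s d \<otimes> t x \<ominus> t d \<otimes> s x))
      = s d \<otimes> (\<Oplus>x\<in>D. \<phi> x \<otimes> t x) \<ominus> t d \<otimes> (\<Oplus>x\<in>D. \<phi> x \<otimes> s x)"
    if \<phi>: "\<phi> \<in> D \<rightarrow> carrier R" and t: "t \<in> S" for \<phi> t
  proof -
    have td: "t d \<in> carrier R" using S t by blast
    have car: "\<phi> x \<in> carrier R" "t x \<in> carrier R" "s x \<in> carrier R" if "x \<in> D" for x
      using that \<phi> S t s by auto
    have "(\<Oplus>x\<in>D. \<phi> x \<otimes> (s d \<otimes> t x \<ominus> t d \<otimes> s x))
        = (\<Oplus>x\<in>D. s d \<otimes> (\<phi> x \<otimes> t x) \<oplus> (\<ominus> t d) \<otimes> (\<phi> x \<otimes> s x))"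
      using car sd td
      by (intro finsum_cong') (auto simp: a_minus_def r_distr l_minus r_minus m_lcomm)
    also have "\<dots> = (\<Oplus>x\<in>D. s d \<otimes> (\<phi> x \<otimes> t x)) \<oplus> (\<Oplus>x\<in>D. (\<ominus> t d) \<otimes> (\<phi> x \<otimes> s x))"
      using car sd td by (intro finsum_addf) auto
    also have "\<dots> = s d \<otimes> (\<Oplus>x\<in>D. \<phi> x \<otimes> t x) \<oplus> (\<ominus> t d) \<otimes> (\<Oplus>x\<in>D. \<phi> x \<otimes> s x)"
      using car sd td D by (simp add: finsum_rdistr Pi_iff)
    also have "\<dots> = s d \<otimes> (\<Oplus>x\<in>D. \<phi> x \<otimes> t x) \<ominus> t d \<otimes> (\<Oplus>x\<in>D. \<phi> x \<otimes> s x)"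
      using car td by (simp add: a_minus_def l_minus Pi_iff)
    finally show ?thesis .
  qed
  have split: "(\<Oplus>x\<in>insert d D. \<phi> x \<otimes> t x) = \<phi> d \<otimes> t d \<oplus> (\<Oplus>x\<in>D. \<phi> x \<otimes> t x)"
    if "\<phi> \<in> insert d D \<rightarrow> carrier R" "t \<in> S" for \<phi> t
    using that S D by (intro finsum_insert) auto
  show ?thesis
  proof
    assume sp: "spanning R (insert d D) S"
    show "spanning R D ((\<lambda>t x. s d \<otimes> t x \<ominus> t d \<otimes> s x) ` S)"
      unfolding spanning_def
    proof (intro ballI impI)
      fix \<phi> e assume \<phi>: "\<phi> \<in> D \<rightarrow> carrier R"
        and kill: "\<forall>s\<in>(\<lambda>t x. s d \<otimes> t x \<ominus> t d \<otimes> s x) ` S. (\<Oplus>d\<in>D. \<phi> d \<otimes> s d) = \<zero>" and e: "e \<in> D"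
      define A where "A = (\<Oplus>x\<in>D. \<phi> x \<otimes> s x)"
      have A: "A \<in> carrier R" unfolding A_def using \<phi> S s by (intro finsum_closed) auto
      \<comment> \<open>The value at \<open>d\<close> is the one for which \<open>\<psi>\<close>
        kills \<open>s\<close> itself. Given this, the assumption that \<open>\<phi>\<close> kills
        the eliminated vectors says precisely that \<open>\<psi>\<close> kills every
        \<open>t\<close> in \<open>S\<close>.\<close>
      define \<psi> where "\<psi> = \<phi>(d := \<ominus> (A \<otimes> inv (s d)))"
      have inv: "inv (s d) \<in> carrier R" "inv (s d) \<otimes> s d = \<one>"
        using sd s field_Units by auto
      have \<psi>: "\<psi> \<in> insert d D \<rightarrow> carrier R" using \<phi> A inv by (auto simp: \<psi>_def)
      have "(\<Oplus>x\<in>insert d D. \<psi> x \<otimes> t x) = \<zero>" if t: "t \<in> S" for t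
      proof -
        have td: "t d \<in> carrier R" using S t by blast
        define B where "B = (\<Oplus>x\<in>D. \<phi> x \<otimes> t x)"
        have B: "B \<in> carrier R" unfolding B_def using \<phi> S t by (intro finsum_closed) auto
        have "(\<Oplus>x\<in>D. \<psi> x \<otimes> t x) = B"
          unfolding B_def using \<phi> S t D by (intro finsum_cong') (auto simp: \<psi>_def)
        then have eq: "(\<Oplus>x\<in>insert d D. \<psi> x \<otimes> t x) = \<ominus> (A \<otimes> inv (s d)) \<otimes> t d \<oplus> B"
          using split[OF \<psi> t] by (simp add: \<psi>_def)
        have "s d \<otimes> B \<ominus> t d \<otimes> A = \<zero>"
          using kill t elim[OF \<phi> t] by (auto simp: A_def B_def)
        then have "s d \<otimes> B = t d \<otimes> A" using A B sd td by simp
        then have "inv (s d) \<otimes> s d \<otimes> B = inv (s d) \<otimes> (t d \<otimes> A)"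
          using B sd inv(1) by (simp add: m_assoc)
        then have "B = A \<otimes> inv (s d) \<otimes> t d"
          using A B td inv by (simp add: m_ac)
        then show ?thesis unfolding eq using A inv td by (simp add: l_minus l_neg)
      qed
      then have "\<psi> e = \<zero>" using sp \<psi> e unfolding spanning_def by blast
      then show "\<phi> e = \<zero>" using e D by (auto simp: \<psi>_def split: if_splits)
    qed
  next
    assume sp: "spanning R D ((\<lambda>t x. s d \<otimes> t x \<ominus> t d \<otimes> s x) ` S)"
    show "spanning R (insert d D) S"
      unfolding spanning_def
    proof (intro ballI impI)
      fix \<phi> e assume \<phi>: "\<phi> \<in> insert d D \<rightarrow> carrier R"
        and kill: "\<forall>s\<in>S. (\<Oplus>d\<in>insert d D. \<phi> d \<otimes> s d) = \<zero>" and e: "e \<in> insert d D"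
      have \<phi>': "\<phi> \<in> D \<rightarrow> carrier R" "\<phi> d \<in> carrier R" using \<phi> by auto
      have k: "(\<Oplus>x\<in>D. \<phi> x \<otimes> t x) = \<ominus> (\<phi> d \<otimes> t d)" if t: "t \<in> S" for t
      proof -
        have td: "t d \<in> carrier R" using S t by blast
        have sum: "(\<Oplus>x\<in>D. \<phi> x \<otimes> t x) \<in> carrier R"
          using S t \<phi>' by (intro finsum_closed) auto
        have "\<phi> d \<otimes> t d \<oplus> (\<Oplus>x\<in>D. \<phi> x \<otimes> t x) = \<zero>"
          using kill t split[OF \<phi> t] by simp
        then have "(\<Oplus>x\<in>D. \<phi> x \<otimes> t x) \<oplus> \<phi> d \<otimes> t d = \<zero>"
          using td sum \<phi>'(2) by (simp only: a_comm m_closed)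
        from minus_equality[OF this _ sum] show ?thesis
          using td \<phi>'(2) by simp
      qed
      \<comment> \<open>By \<open>k\<close>, the part of \<open>\<phi>\<close> on \<open>D\<close>
        acts on \<open>S\<close> as a multiple of coordinate \<open>d\<close>, so the two products
        in the eliminated vector cancel.\<close>
      have "(\<Oplus>x\<in>D. \<phi> x \<otimes> (s d \<otimes> t x \<ominus> t d \<otimes> s x)) = \<zero>" if t: "t \<in> S" for t
      proof -
        have "t d \<in> carrier R" using S t by blast
        then show ?thesis unfolding elim[OF \<phi>'(1) t] k[OF t] k[OF s(1)]
          using sd \<phi>' by algebra
      qed
      then have 0: "\<forall>x\<in>D. \<phi> x = \<zero>" using sp \<phi>' unfolding spanning_def by blast
      then have "(\<Oplus>x\<in>D. \<phi> x \<otimes> s x) = \<zero>"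
        using S s by (intro add.finprod_one_eqI) auto
      then have "\<ominus> (\<phi> d \<otimes> s d) = \<zero>" using k[OF s(1)] by simp
      then have "\<phi> d \<otimes> s d = \<zero>" using sd \<phi>' by simp
      then have "\<phi> d = \<zero>" using s sd \<phi>' integral by blast
      then show "\<phi> e = \<zero>" using 0 e by auto
    qed
  qed
qed

text \<open>For submodules the dual notion of spanning is the usual one. Elimination sends
  \<open>W\<close> to a spanning submodule with one coordinate fewer, which is everything by
  induction. Eliminated vectors of \<open>W\<close> stay in \<open>W\<close>, hence \<open>W\<close>
  contains \<open>s d\<close> times any vector, and the pivot is invertible.\<close>

lemma spanning_submodule:
  assumes "finite B" "submodule W R (free_module R B)" "spanning R B W"
  shows "W = carrier (free_module R B)"
  using assms
proof (induction B arbitrary: W)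
  case empty
  show ?case by (rule free_module_spanned[OF empty(1)]) simp
next
  case (insert d D)
  let ?F = "free_module R (insert d D)" and ?E = "free_module R D"
  interpret F: module R ?F by (rule module_free_module) (rule cring_axioms)
  interpret E: module R ?E by (rule module_free_module) (rule cring_axioms)
  note WE = F.submoduleE[OF insert.prems(1)]
  have car: "t x \<in> carrier R" if "t \<in> W" for t x
    by (rule free_moduleD(1)[OF subsetD[OF WE(1) that]])
  obtain s where s: "s \<in> W" "s d \<noteq> \<zero>"
    using not_spanning_zero_coord[of "insert d D" d W] insert.hyps insert.prems car by auto
  have sd: "s d \<in> carrier R" using s car by blast
  define \<pi> where "\<pi> t = (\<lambda>x. s d \<otimes> t x \<ominus> t d \<otimes> s x)" for t
  have \<pi>_eq: "\<pi> t = s d \<odot>\<^bsub>?F\<^esub> t \<oplus>\<^bsub>?F\<^esub> (\<ominus> t d) \<odot>\<^bsub>?F\<^esub> s" if "t \<in> carrier ?F" for t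
    using free_moduleD(1)[OF that] car s by (auto simp: \<pi>_def free_module_simps a_minus_def l_minus)
  have \<pi>: "linear_map R ?F ?E \<pi>"
  proof (rule linear_mapI)
    fix t assume t: "t \<in> carrier ?F"
    have "s x = \<zero>" if "x \<notin> insert d D" for x
      by (rule free_moduleD(2)[OF subsetD[OF WE(1) s(1)] that])
    moreover have "\<pi> t d = \<zero>"
      using free_moduleD[OF t] car[OF s(1)] by (simp add: \<pi>_def m_comm a_minus_def r_neg)
    ultimately have "\<pi> t x = \<zero>" if "x \<notin> D" for x
      using free_moduleD[OF t] car[OF s(1)] that by (cases "x = d") (auto simp: \<pi>_def)
    then show "\<pi> t \<in> carrier ?E"
      using free_moduleD(1)[OF t] car[OF s(1)] insert.hyps by (intro free_moduleI) (auto simp: \<pi>_def)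
    fix u assume u: "u \<in> carrier ?F"
    show "\<pi> (t \<oplus>\<^bsub>?F\<^esub> u) = \<pi> t \<oplus>\<^bsub>?E\<^esub> \<pi> u"
    proof
      fix x
      have "s d \<in> carrier R" "t x \<in> carrier R" "u x \<in> carrier R" "s x \<in> carrier R" "t d \<in> carrier R" "u d \<in> carrier R"
        using free_moduleD[OF t] free_moduleD[OF u] car[OF s(1)] by auto
      then show "\<pi> (t \<oplus>\<^bsub>?F\<^esub> u) x = (\<pi> t \<oplus>\<^bsub>?E\<^esub> \<pi> u) x"
        unfolding \<pi>_def free_module_simps by algebra
    qed
  next
    fix a t assume a: "a \<in> carrier R" and t: "t \<in> carrier ?F"
    show "\<pi> (a \<odot>\<^bsub>?F\<^esub> t) = a \<odot>\<^bsub>?E\<^esub> \<pi> t"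
    proof
      fix x
      have "s d \<in> carrier R" "t x \<in> carrier R" "s x \<in> carrier R" "t d \<in> carrier R"
        using free_moduleD[OF t] car[OF s(1)] by auto
      then show "\<pi> (a \<odot>\<^bsub>?F\<^esub> t) x = (a \<odot>\<^bsub>?E\<^esub> \<pi> t) x"
        unfolding \<pi>_def free_module_simps using a by algebra
    qed
  qed
  have "spanning R D (\<pi> ` W)"
    using spanning_eliminate[of D d W s] insert.hyps(1,2) car s insert.prems(2) unfolding \<pi>_def by blast
  with F.submodule_image[OF E.module_axioms \<pi> insert.prems(1)]
  have surj: "\<pi> ` W = carrier ?E" by (rule insert.IH)
  have "v \<in> W" if v: "v \<in> carrier ?F" for v
  proof -
    obtain w where w: "w \<in> W" "\<pi> v = \<pi> w"
      using linear_mapD(1)[OF \<pi> v] surj by blast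
    have "s d \<odot>\<^bsub>?F\<^esub> v = \<pi> w \<oplus>\<^bsub>?F\<^esub> v d \<odot>\<^bsub>?F\<^esub> s"
    proof
      fix x
      have "s d \<in> carrier R" "v x \<in> carrier R" "s x \<in> carrier R" "v d \<in> carrier R"
        using free_moduleD[OF v] car[OF s(1)] by auto
      then show "(s d \<odot>\<^bsub>?F\<^esub> v) x = (\<pi> w \<oplus>\<^bsub>?F\<^esub> v d \<odot>\<^bsub>?F\<^esub> s) x"
        unfolding w(2)[symmetric] unfolding \<pi>_def free_module_simps by algebra
    qed
    moreover have "\<pi> w \<in> W"
      using w(1) s sd WE(4,5) \<pi>_eq[of w] WE(1) car by (auto simp: subset_iff)
    ultimately have sv: "s d \<odot>\<^bsub>?F\<^esub> v \<in> W"
      using WE(4)[OF free_moduleD(1)[OF v] s(1)] WE(5) by simp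
    have inv: "inv (s d) \<in> carrier R" "inv (s d) \<otimes> s d = \<one>" using sd s field_Units by auto
    have "v = inv (s d) \<odot>\<^bsub>?F\<^esub> (s d \<odot>\<^bsub>?F\<^esub> v)"
      using v inv sd F.smult_assoc1[OF inv(1) sd v] F.smult_one[OF v] by simp
    then show ?thesis using WE(4)[OF inv(1) sv] by simp
  qed
  then show ?case using WE(1) by blast
qed

end

text \<open>The order of quantifiers is the point: \<open>T\<close> depends on the family over
  \<open>A\<close> alone and serves all fields \<open>L\<close> on the given type and all
  \<open>h\<close>. The induction therefore provides a set \<open>T s\<close> for every potential
  pivot \<open>s\<close>, before it is known whether \<open>h (s d)\<close> is nonzero.\<close>

lemma spanning_open:
  assumes A: "cring A" and "finite D" "S \<subseteq> D \<rightarrow> carrier A"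
  shows "\<exists>T\<subseteq>carrier A. \<forall>(L :: 'l ring) h. field L \<and> h \<in> ring_hom A L \<longrightarrow>
           (spanning L D ((\<lambda>s. h \<circ> s) ` S) \<longleftrightarrow> (\<exists>t\<in>T. h t \<noteq> \<zero>\<^bsub>L\<^esub>))"
  using assms(2,3)
proof (induction D arbitrary: S)
  case empty
  interpret A: cring A by fact
  have "h \<one>\<^bsub>A\<^esub> \<noteq> \<zero>\<^bsub>L\<^esub>" if "field L" "h \<in> ring_hom A L" for L :: "'l ring" and h
  proof -
    interpret field L by fact
    show ?thesis using ring_hom_one[OF that(2)] by simp
  qed
  \<comment> \<open>Without coordinates every family spans, and \<open>h\<close> sends one to one,
    which is nonzero in a field.\<close>
  then show ?case by (intro exI[of _ "{\<one>\<^bsub>A\<^esub>}"]) (auto simp: spanning_def)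
next
  case (insert d D)
  interpret A: cring A by fact
  have car: "t x \<in> carrier A" if "t \<in> S" "x \<in> insert d D" for t x using insert.prems that by auto
  define E where "E s = (\<lambda>t x. s d \<otimes>\<^bsub>A\<^esub> t x \<ominus>\<^bsub>A\<^esub> t d \<otimes>\<^bsub>A\<^esub> s x) ` S" for s
  have "\<forall>s\<in>S. \<exists>T\<subseteq>carrier A. \<forall>(L :: 'l ring) h. field L \<and> h \<in> ring_hom A L \<longrightarrow>
           (spanning L D ((\<lambda>s. h \<circ> s) ` E s) \<longleftrightarrow> (\<exists>t\<in>T. h t \<noteq> \<zero>\<^bsub>L\<^esub>))"
    by (intro ballI insert.IH) (auto simp: E_def car)
  then obtain T where T: "\<And>s. s \<in> S \<Longrightarrow> T s \<subseteq> carrier A"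
    "\<And>s (L :: 'l ring) h. s \<in> S \<Longrightarrow> field L \<Longrightarrow> h \<in> ring_hom A L \<Longrightarrow>
           spanning L D ((\<lambda>s. h \<circ> s) ` E s) \<longleftrightarrow> (\<exists>t\<in>T s. h t \<noteq> \<zero>\<^bsub>L\<^esub>)"
    by metis
  define U where "U = (\<Union>s\<in>S. (\<lambda>t. s d \<otimes>\<^bsub>A\<^esub> t) ` T s)"
  have "spanning L (insert d D) ((\<lambda>s. h \<circ> s) ` S) \<longleftrightarrow> (\<exists>t\<in>U. h t \<noteq> \<zero>\<^bsub>L\<^esub>)"
    if L: "field L" and h: "h \<in> ring_hom A L" for L :: "'l ring" and h
  proof -
    interpret L: field L by fact
    interpret h: ring_hom_cring A L h by unfold_locales (rule h)
    have car': "\<And>t x. t \<in> (\<lambda>s. h \<circ> s) ` S \<Longrightarrow> x \<in> insert d D \<Longrightarrow> t x \<in> carrier L"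
      using car by auto
    have *: "spanning L (insert d D) ((\<lambda>s. h \<circ> s) ` S) \<longleftrightarrow> (\<exists>t\<in>T s. h t \<noteq> \<zero>\<^bsub>L\<^esub>)"
      if s: "s \<in> S" "h (s d) \<noteq> \<zero>\<^bsub>L\<^esub>" for s
    proof -
      have eq: "(\<lambda>t x. (h \<circ> s) d \<otimes>\<^bsub>L\<^esub> t x \<ominus>\<^bsub>L\<^esub> t d \<otimes>\<^bsub>L\<^esub> (h \<circ> s) x) (h \<circ> t) x
          = (h \<circ> (\<lambda>x. s d \<otimes>\<^bsub>A\<^esub> t x \<ominus>\<^bsub>A\<^esub> t d \<otimes>\<^bsub>A\<^esub> s x)) x" if "t \<in> S" "x \<in> D" for t x
        using that s car by (simp add: a_minus_def)
      show ?thesis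
        unfolding T(2)[OF s(1) L h, symmetric]
      proof (subst L.spanning_eliminate[of D d _ "h \<circ> s"], goal_cases)
        \<comment> \<open>Goals 1 to 5 are side conditions of \<open>spanning_eliminate\<close>.
          This one compares elimination in \<open>L\<close> with the image under \<open>h\<close> of
          elimination in \<open>A\<close>.\<close>
        case 6
        show ?case
        proof (rule L.spanning_cong, goal_cases)
          case (1 x)
          then show ?case using eq unfolding E_def by (auto intro!: bexI)
        next
          case (2 x)
          then show ?case using eq unfolding E_def by (auto intro!: bexI)
        next
          case (3 x d)
          then show ?case using s car by auto
        qed
      qed (use s insert.hyps car' in auto)
    qed
    have prod: "h (s d \<otimes>\<^bsub>A\<^esub> t) \<noteq> \<zero>\<^bsub>L\<^esub> \<longleftrightarrow> h (s d) \<noteq> \<zero>\<^bsub>L\<^esub> \<and> h t \<noteq> \<zero>\<^bsub>L\<^esub>"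
      if "s \<in> S" "t \<in> T s" for s t
    proof -
      have "s d \<in> carrier A" "t \<in> carrier A" using that car T(1) by auto
      then show ?thesis using L.integral_iff by simp
    qed
    show ?thesis
    proof
      assume sp: "spanning L (insert d D) ((\<lambda>s. h \<circ> s) ` S)"
      then obtain s where s: "s \<in> S" "h (s d) \<noteq> \<zero>\<^bsub>L\<^esub>"
        using L.not_spanning_zero_coord[of "insert d D" d "(\<lambda>s. h \<circ> s) ` S"] insert.hyps car' by fastforce
      then show "\<exists>t\<in>U. h t \<noteq> \<zero>\<^bsub>L\<^esub>"
        using *[OF s] sp prod unfolding U_def by blast
    next
      assume "\<exists>t\<in>U. h t \<noteq> \<zero>\<^bsub>L\<^esub>"
      then obtain s t where "s \<in> S" "t \<in> T s" "h (s d \<otimes>\<^bsub>A\<^esub> t) \<noteq> \<zero>\<^bsub>L\<^esub>"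
        unfolding U_def by blast
      then show "spanning L (insert d D) ((\<lambda>s. h \<circ> s) ` S)"
        using * prod by blast
    qed
  qed
  moreover have "U \<subseteq> carrier A" unfolding U_def using T(1) car by blast
  ultimately show ?case by blast
qed

section \<open>Eigenvectors\<close>

context module
begin

text \<open>This is \<open>p(f) v\<close> for the polynomial with coefficient list \<open>p\<close>,
  leading coefficient first as for \<open>R.eval\<close>. Working with vectors avoids building a
  ring of endomorphisms.\<close>

primrec op_eval :: "('c \<Rightarrow> 'c) \<Rightarrow> 'a list \<Rightarrow> 'c \<Rightarrow> 'c" where
  "op_eval f [] v = \<zero>\<^bsub>M\<^esub>"
| "op_eval f (a # p) v = a \<odot>\<^bsub>M\<^esub> (f ^^ length p) v \<oplus>\<^bsub>M\<^esub> op_eval f p v"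

context
  fixes f assumes f: "linear_map R M M f"
begin

lemma funpow_closed: "v \<in> carrier M \<Longrightarrow> (f ^^ k) v \<in> carrier M"
  by (induction k) (auto simp: linear_mapD(1)[OF f])

lemma op_eval_closed: "set p \<subseteq> carrier R \<Longrightarrow> v \<in> carrier M \<Longrightarrow> op_eval f p v \<in> carrier M"
  by (induction p) (auto simp: funpow_closed)

text \<open>Horner's rule: appending a constant coefficient multiplies the polynomial by the
  variable and adds the constant.\<close>

lemma op_eval_snoc:
  assumes "set p \<subseteq> carrier R" "a \<in> carrier R" "v \<in> carrier M"
  shows "op_eval f (p @ [a]) v = f (op_eval f p v) \<oplus>\<^bsub>M\<^esub> a \<odot>\<^bsub>M\<^esub> v"
  using assms(1)
proof (induction p)
  case Nil
  then show ?case using assms linear_map_zero[OF module_axioms f] by simp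
next
  case (Cons b p)
  then show ?case
    using assms op_eval_closed[of p v] funpow_closed[of v] linear_mapD[OF f]
    by (simp add: M.a_assoc)
qed

text \<open>Synthetic division: \<open>p(f) = (f - \<lambda>) q(f) + p(\<lambda>)\<close>.\<close>

lemma op_eval_divide_root:
  assumes "set p \<subseteq> carrier R" "l \<in> carrier R" "p \<noteq> []"
  shows "\<exists>q. set q \<subseteq> carrier R \<and> Suc (length q) = length p \<and> (q \<noteq> [] \<longrightarrow> hd q = hd p) \<and>
           (\<forall>v\<in>carrier M. op_eval f p v =
              f (op_eval f q v) \<oplus>\<^bsub>M\<^esub> (\<ominus> l) \<odot>\<^bsub>M\<^esub> op_eval f q v \<oplus>\<^bsub>M\<^esub> R.eval p l \<odot>\<^bsub>M\<^esub> v)"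
  using assms(1,3)
proof (induction p rule: rev_induct)
  case (snoc a p)
  show ?case
  proof (cases "p = []")
    case True
    then show ?thesis
      using snoc.prems assms(2) linear_map_zero[OF module_axioms f] by (intro exI[of _ "[]"]) simp
  next
    case False
    then obtain q where q: "set q \<subseteq> carrier R" "Suc (length q) = length p" "q \<noteq> [] \<longrightarrow> hd q = hd p"
      "\<And>v. v \<in> carrier M \<Longrightarrow> op_eval f p v =
              f (op_eval f q v) \<oplus>\<^bsub>M\<^esub> (\<ominus> l) \<odot>\<^bsub>M\<^esub> op_eval f q v \<oplus>\<^bsub>M\<^esub> R.eval p l \<odot>\<^bsub>M\<^esub> v"
      using snoc by auto
    \<comment> \<open>The coefficients of the quotient are the successive Horner values, so the
      value of \<open>p\<close> at \<open>l\<close> becomes the last coefficient of the new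
      quotient.\<close>
    define c where "c = R.eval p l"
    have p: "set p \<subseteq> carrier R" "a \<in> carrier R" using snoc.prems by auto
    have c: "c \<in> carrier R" unfolding c_def using p assms(2) by (intro R.eval_in_carrier) auto
    have ev: "R.eval (p @ [a]) l = c \<otimes> l \<oplus> a"
      unfolding c_def by (rule R.eval_append_aux) (use p assms(2) in auto)
    \<comment> \<open>The quotient keeps the leading coefficient; this is how it is later recognized
      as a nonzero polynomial.\<close>
    have hd: "hd (q @ [c]) = hd (p @ [a])"
    proof (cases q)
      case Nil
      then obtain b where "p = [b]" using q(2) by (cases p) auto
      then show ?thesis using Nil p by (simp add: c_def)
    qed (use q False in auto)
    have "op_eval f (p @ [a]) v = f (op_eval f (q @ [c]) v)
        \<oplus>\<^bsub>M\<^esub> (\<ominus> l) \<odot>\<^bsub>M\<^esub> op_eval f (q @ [c]) v \<oplus>\<^bsub>M\<^esub> R.eval (p @ [a]) l \<odot>\<^bsub>M\<^esub> v" if v: "v \<in> carrier M" for v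
    proof -
      define Q where "Q = op_eval f q v"
      have Q: "Q \<in> carrier M" "f Q \<in> carrier M" "f (f Q) \<in> carrier M" "f v \<in> carrier M"
        using op_eval_closed[OF q(1) v] linear_mapD(1)[OF f] v by (auto simp: Q_def)
      \<comment> \<open>A zero to be inserted below: one summand completes the multiple of the new
        quotient by \<open>\<ominus> l\<close>, the other goes into the new remainder
        \<open>c \<otimes> l \<oplus> a\<close>.\<close>
      have cv: "(\<ominus> l) \<odot>\<^bsub>M\<^esub> (c \<odot>\<^bsub>M\<^esub> v) \<oplus>\<^bsub>M\<^esub> (c \<otimes> l) \<odot>\<^bsub>M\<^esub> v = \<zero>\<^bsub>M\<^esub>"
      proof -
        have "(\<ominus> l) \<odot>\<^bsub>M\<^esub> (c \<odot>\<^bsub>M\<^esub> v) \<oplus>\<^bsub>M\<^esub> (c \<otimes> l) \<odot>\<^bsub>M\<^esub> v = (\<ominus> l \<otimes> c \<oplus> c \<otimes> l) \<odot>\<^bsub>M\<^esub> v"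
          using v c assms(2) by (simp add: smult_l_distr smult_assoc1)
        also have "\<ominus> l \<otimes> c \<oplus> c \<otimes> l = \<zero>" using c assms(2) by algebra
        finally show ?thesis using v by simp
      qed
      have "op_eval f (p @ [a]) v = f (f Q \<oplus>\<^bsub>M\<^esub> (\<ominus> l) \<odot>\<^bsub>M\<^esub> Q \<oplus>\<^bsub>M\<^esub> c \<odot>\<^bsub>M\<^esub> v) \<oplus>\<^bsub>M\<^esub> a \<odot>\<^bsub>M\<^esub> v"
        unfolding op_eval_snoc[OF p v] q(4)[OF v] Q_def c_def ..
      also have "\<dots> = f (f Q) \<oplus>\<^bsub>M\<^esub> (\<ominus> l) \<odot>\<^bsub>M\<^esub> f Q \<oplus>\<^bsub>M\<^esub> c \<odot>\<^bsub>M\<^esub> f v \<oplus>\<^bsub>M\<^esub> a \<odot>\<^bsub>M\<^esub> v"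
        using Q v c assms(2) by (simp add: linear_mapD[OF f])
      also have "\<dots> = f (f Q) \<oplus>\<^bsub>M\<^esub> (\<ominus> l) \<odot>\<^bsub>M\<^esub> f Q \<oplus>\<^bsub>M\<^esub> c \<odot>\<^bsub>M\<^esub> f v \<oplus>\<^bsub>M\<^esub>
          ((\<ominus> l) \<odot>\<^bsub>M\<^esub> (c \<odot>\<^bsub>M\<^esub> v) \<oplus>\<^bsub>M\<^esub> (c \<otimes> l) \<odot>\<^bsub>M\<^esub> v) \<oplus>\<^bsub>M\<^esub> a \<odot>\<^bsub>M\<^esub> v"
        unfolding cv using Q v c assms(2) p by simp
      also have "\<dots> = (f (f Q) \<oplus>\<^bsub>M\<^esub> c \<odot>\<^bsub>M\<^esub> f v) \<oplus>\<^bsub>M\<^esub> ((\<ominus> l) \<odot>\<^bsub>M\<^esub> f Q \<oplus>\<^bsub>M\<^esub> (\<ominus> l) \<odot>\<^bsub>M\<^esub> (c \<odot>\<^bsub>M\<^esub> v))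
          \<oplus>\<^bsub>M\<^esub> ((c \<otimes> l) \<odot>\<^bsub>M\<^esub> v \<oplus>\<^bsub>M\<^esub> a \<odot>\<^bsub>M\<^esub> v)"
        using Q v c assms(2) p by (simp add: M.a_ac)
      also have "\<dots> = f (f Q \<oplus>\<^bsub>M\<^esub> c \<odot>\<^bsub>M\<^esub> v) \<oplus>\<^bsub>M\<^esub> (\<ominus> l) \<odot>\<^bsub>M\<^esub> (f Q \<oplus>\<^bsub>M\<^esub> c \<odot>\<^bsub>M\<^esub> v)
          \<oplus>\<^bsub>M\<^esub> (c \<otimes> l \<oplus> a) \<odot>\<^bsub>M\<^esub> v"
        using Q v c assms(2) p by (simp add: linear_mapD[OF f] smult_r_distr smult_l_distr)
      finally show ?thesis
        unfolding op_eval_snoc[OF q(1) c v] Q_def[symmetric] ev .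
    qed
    then show ?thesis
      using q(1,2) c hd by (intro exI[of _ "q @ [c]"]) auto
  qed
qed simp

text \<open>Take a nonzero polynomial \<open>p\<close> of least length that annihilates some nonzero
  vector \<open>v\<close>, and divide it by the factor of a root \<open>l\<close>. By minimality the
  quotient does not annihilate \<open>v\<close>, so it sends \<open>v\<close> to an eigenvector for
  \<open>l\<close>.\<close>

lemma eigenvector_of_annihilator:
  assumes R: "algebraically_closed R"
    and "set p \<subseteq> carrier R" "\<exists>x\<in>set p. x \<noteq> \<zero>"
    and "v \<in> carrier M" "v \<noteq> \<zero>\<^bsub>M\<^esub>" "op_eval f p v = \<zero>\<^bsub>M\<^esub>"
  shows "\<exists>l\<in>carrier R. \<exists>v\<in>carrier M. v \<noteq> \<zero>\<^bsub>M\<^esub> \<and> f v = l \<odot>\<^bsub>M\<^esub> v"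
proof -
  interpret K: algebraically_closed R by fact
  \<comment> \<open>Minimality is over all nonzero vectors together; the minimal \<open>p\<close>
    may annihilate a vector other than the given one.\<close>
  define P where "P p \<longleftrightarrow> set p \<subseteq> carrier R \<and> (\<exists>x\<in>set p. x \<noteq> \<zero>) \<and>
    (\<exists>v\<in>carrier M. v \<noteq> \<zero>\<^bsub>M\<^esub> \<and> op_eval f p v = \<zero>\<^bsub>M\<^esub>)" for p
  have "P p" using assms by (auto simp: P_def)
  then obtain p where p: "P p" and min: "\<And>q. P q \<Longrightarrow> length p \<le> length q"
    using ex_has_least_nat[of P p length] by blast
  obtain v where v: "v \<in> carrier M" "v \<noteq> \<zero>\<^bsub>M\<^esub>" "op_eval f p v = \<zero>\<^bsub>M\<^esub>"
    using p by (auto simp: P_def)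
  obtain a p' where p': "p = a # p'" using p by (cases p) (auto simp: P_def)
  have car: "a \<in> carrier R" "set p' \<subseteq> carrier R" using p by (auto simp: P_def p')
  \<comment> \<open>A zero leading coefficient could be dropped. With \<open>a\<close> nonzero, the
    list is an element of \<open>poly_ring R\<close>, so the theory of roots applies.\<close>
  have a0: "a \<noteq> \<zero>"
  proof
    assume "a = \<zero>"
    then have "P p'"
      using p v car by (auto simp: P_def p' funpow_closed op_eval_closed)
    then show False using min[of p'] by (simp add: p')
  qed
  have "p' \<noteq> []"
  proof
    assume "p' = []"
    then have "a \<odot>\<^bsub>M\<^esub> v = \<zero>\<^bsub>M\<^esub>" using v car by (simp add: p')
    moreover have "inv a \<in> carrier R" "inv a \<otimes> a = \<one>" using a0 car K.field_Units by auto
    ultimately have "v = \<zero>\<^bsub>M\<^esub>"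
      using v(1) car smult_assoc1[of "inv a" a v] smult_r_null[of "inv a"] by simp
    then show False using v by simp
  qed
  then have deg: "degree p > 0" by (simp add: p')
  have pc: "p \<in> carrier (poly_ring R)"
    using car a0 by (simp add: p' polynomial_def flip: univ_poly_carrier)
  then have "size (R.roots p) > 0"
    using K.roots_over_carrier deg by (simp add: R.splitted_def)
  then obtain l where "l \<in># R.roots p" by (metis multiset_nonemptyE size_empty less_irrefl)
  then have l: "l \<in> carrier R" "R.eval p l = \<zero>"
    using K.roots_mem_iff_is_root[OF pc] by (auto simp: R.is_root_def)
  obtain q where q: "set q \<subseteq> carrier R" "Suc (length q) = length p" "q \<noteq> [] \<longrightarrow> hd q = hd p"
    "\<And>v. v \<in> carrier M \<Longrightarrow> op_eval f p v =
        f (op_eval f q v) \<oplus>\<^bsub>M\<^esub> (\<ominus> l) \<odot>\<^bsub>M\<^esub> op_eval f q v \<oplus>\<^bsub>M\<^esub> R.eval p l \<odot>\<^bsub>M\<^esub> v"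
    using op_eval_divide_root[of p l] car l by (auto simp: p')
  define w where "w = op_eval f q v"
  have w: "w \<in> carrier M" "f w \<in> carrier M"
    using op_eval_closed[OF q(1) v(1)] linear_mapD(1)[OF f] by (auto simp: w_def)
  have "f w \<oplus>\<^bsub>M\<^esub> (\<ominus> l) \<odot>\<^bsub>M\<^esub> w = \<zero>\<^bsub>M\<^esub>"
    using q(4)[OF v(1)] v w l by (simp add: w_def[symmetric])
  then have "f w = \<ominus>\<^bsub>M\<^esub> ((\<ominus> l) \<odot>\<^bsub>M\<^esub> w)"
    using w l by (intro M.minus_equality[symmetric]) auto
  then have "f w = l \<odot>\<^bsub>M\<^esub> w" using w l by (simp add: smult_l_minus)
  \<comment> \<open>Otherwise \<open>q\<close> would be a shorter annihilating polynomial of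
    \<open>v\<close>, nonzero because it starts with \<open>a\<close>.\<close>
  moreover have "w \<noteq> \<zero>\<^bsub>M\<^esub>"
  proof
    assume "w = \<zero>\<^bsub>M\<^esub>"
    moreover have "a \<in> set q" using q(2,3) \<open>p' \<noteq> []\<close> by (cases q) (auto simp: p')
    ultimately have "P q" using q(1) v a0 by (auto simp: P_def w_def)
    then show False using min[of q] q(2) by simp
  qed
  ultimately show ?thesis using w(1) l(1) by blast
qed

end

end

text \<open>The iterates of \<open>v\<close> under \<open>f\<close> with exponents \<open>0\<close>
  to \<open>card B\<close> are one more than there are coordinates, hence dependent; a dependence
  relation is a polynomial annihilating \<open>v\<close>.\<close>

lemma (in algebraically_closed) free_module_eigenvector:
  assumes B: "finite B" and f: "linear_map L (free_module L B) (free_module L B) f"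
    and v: "v \<in> carrier (free_module L B)" "v \<noteq> \<zero>\<^bsub>free_module L B\<^esub>"
  shows "\<exists>l\<in>carrier L. \<exists>v\<in>carrier (free_module L B). v \<noteq> \<zero>\<^bsub>free_module L B\<^esub> \<and> f v = l \<odot>\<^bsub>free_module L B\<^esub> v"
proof -
  let ?F = "free_module L B"
  interpret F: module L ?F by (rule module_free_module) (rule cring_axioms)
  have pow: "(f ^^ j) v \<in> carrier ?F" for j by (rule F.funpow_closed[OF f v(1)])
  note powc = free_moduleD(1)[OF pow]
  obtain c where c: "c \<in> {..card B} \<rightarrow> carrier L" "\<exists>j\<in>{..card B}. c j \<noteq> \<zero>"
    "\<forall>i\<in>B. (\<Oplus>j\<in>{..card B}. c j \<otimes> (f ^^ j) v i) = \<zero>"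
    using homogeneous_system[of B "{..card B}" "\<lambda>i j. (f ^^ j) v i"] B powc by auto
  have ev: "F.op_eval f (rev (map c [0..<k])) v i = (\<Oplus>j\<in>{..<k}. c j \<otimes> (f ^^ j) v i)"
    if "k \<le> Suc (card B)" for k i
    using that
  proof (induction k)
    case (Suc k)
    have ck: "c j \<in> carrier L" if "j \<le> k" for j using c(1) Suc.prems that by auto
    have "(\<Oplus>j\<in>{..<Suc k}. c j \<otimes> (f ^^ j) v i) = c k \<otimes> (f ^^ k) v i \<oplus> (\<Oplus>j\<in>{..<k}. c j \<otimes> (f ^^ j) v i)"
      unfolding lessThan_Suc using ck powc by (intro finsum_insert) auto
    then show ?case using Suc by (simp add: free_module_simps)
  qed (simp add: free_module_simps)
  \<comment> \<open>Reversed because \<open>op_eval\<close> expects the coefficient of the highest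
    power first.\<close>
  let ?p = "rev (map c [0..<Suc (card B)])"
  have "set ?p = c ` {..card B}" by (auto simp: less_Suc_eq_le simp del: upt_Suc)
  then have p: "set ?p \<subseteq> carrier L" "\<exists>x\<in>set ?p. x \<noteq> \<zero>"
    using c(1,2) by auto
  have "F.op_eval f ?p v i = \<zero>" for i
  proof (cases "i \<in> B")
    case True
    then show ?thesis
      using ev[of "Suc (card B)" i] c(3) by (simp add: lessThan_Suc_atMost)
  next
    case False
    show ?thesis
      by (rule free_moduleD(2)[OF F.op_eval_closed[OF f p(1) v(1)] False])
  qed
  then have "F.op_eval f ?p v = \<zero>\<^bsub>?F\<^esub>" by (auto simp: free_module_simps)
  then show ?thesis
    using F.eigenvector_of_annihilator[OF f algebraically_closed_axioms p v] by blast
qed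

lemma (in abelian_monoid) finsum_cartesian:
  assumes "finite A" "finite B" "\<And>i j. i \<in> A \<Longrightarrow> j \<in> B \<Longrightarrow> f (i, j) \<in> carrier G"
  shows "(\<Oplus>x\<in>A \<times> B. f x) = (\<Oplus>i\<in>A. \<Oplus>j\<in>B. f (i, j))"
  using assms(1,3)
proof (induction A)
  case (insert a A)
  have "(\<Oplus>x\<in>insert a A \<times> B. f x) = (\<Oplus>x\<in>Pair a ` B \<union> A \<times> B. f x)"
    by (rule arg_cong[where f = "finsum G f"]) auto
  also have "\<dots> = (\<Oplus>x\<in>Pair a ` B. f x) \<oplus> (\<Oplus>x\<in>A \<times> B. f x)"
    using insert assms(2) by (intro finsum_Un_disjoint) auto
  also have "(\<Oplus>x\<in>Pair a ` B. f x) = (\<Oplus>j\<in>B. f (a, j))"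
    using insert.prems by (intro finsum_reindex) (auto simp: inj_on_def)
  finally show ?case
    using insert assms(2) by (subst finsum_insert) (auto intro!: finsum_closed)
qed simp

section \<open>Burnside's theorem\<close>

text \<open>A chosen finite basis makes functionals on endomorphisms into families of vectors. In
  the application \<open>B\<close> is the set of strictly increasing lists that indexes the basis of
  the exterior power.\<close>

locale coord_rep = algebraically_closed L for L (structure) +
  fixes G :: "('g, 'd) monoid_scheme" (structure) and B :: "'x set" and \<rho> :: "'g \<Rightarrow> ('x \<Rightarrow> 'a) \<Rightarrow> 'x \<Rightarrow> 'a"
  assumes G: "monoid G" and finite_B: "finite B" and B_ne: "B \<noteq> {}"
    and lin: "\<And>g. g \<in> carrier G \<Longrightarrow> linear_map L (free_module L B) (free_module L B) (\<rho> g)"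
    and mult: "\<And>g h v. g \<in> carrier G \<Longrightarrow> h \<in> carrier G \<Longrightarrow> v \<in> carrier (free_module L B) \<Longrightarrow>
                 \<rho> (g \<otimes>\<^bsub>G\<^esub> h) v = \<rho> g (\<rho> h v)"
    and one: "\<And>v. v \<in> carrier (free_module L B) \<Longrightarrow> \<rho> \<one>\<^bsub>G\<^esub> v = v"
begin

abbreviation V where "V \<equiv> free_module L B"

sublocale V: module L V by (rule module_free_module) (rule cring_axioms)

sublocale G: monoid G by (rule G)

lemma rho_closed: "g \<in> carrier G \<Longrightarrow> v \<in> carrier V \<Longrightarrow> \<rho> g v \<in> carrier V"
  using linear_mapD(1)[OF lin] .

text \<open>The eigenspace of \<open>\<theta>\<close> for any of its eigenvalues is an invariant
  nonzero submodule, hence everything.\<close>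

lemma schur:
  assumes irr: "irreducible_rep L V G \<rho>" and \<theta>: "linear_map L V V \<theta>"
    and comm: "\<And>g v. g \<in> carrier G \<Longrightarrow> v \<in> carrier V \<Longrightarrow> \<theta> (\<rho> g v) = \<rho> g (\<theta> v)"
  shows "\<exists>l\<in>carrier L. \<forall>v\<in>carrier V. \<theta> v = l \<odot>\<^bsub>V\<^esub> v"
proof -
  obtain b where "b \<in> B" using B_ne by blast
  then have "free_gen L b \<in> carrier V" "free_gen L b \<noteq> \<zero>\<^bsub>V\<^esub>"
    using free_gen_closed by (auto simp: free_module_simps free_gen_def fun_eq_iff)
  then obtain l v where l: "l \<in> carrier L" and v: "v \<in> carrier V" "v \<noteq> \<zero>\<^bsub>V\<^esub>" "\<theta> v = l \<odot>\<^bsub>V\<^esub> v"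
    using free_module_eigenvector[OF finite_B \<theta>] by blast
  let ?W = "{v \<in> carrier V. \<theta> v = l \<odot>\<^bsub>V\<^esub> v}"
  have sl: "linear_map L V V (\<lambda>v. l \<odot>\<^bsub>V\<^esub> v)"
    using l by (intro linear_mapI) (auto simp: V.smult_r_distr m_comm simp flip: V.smult_assoc1)
  have "submodule ?W L V"
    by (rule V.submodule_equalizer[OF V.module_axioms \<theta> sl])
  moreover have "\<rho> g ` ?W \<subseteq> ?W" if "g \<in> carrier G" for g
    using that l rho_closed by (auto simp: comm linear_mapD(3)[OF lin])
  ultimately have "?W = {\<zero>\<^bsub>V\<^esub>} \<or> ?W = carrier V"
    using irr unfolding irreducible_rep_def by blast
  then show ?thesis using v l by blast
qed

text \<open>
  A family \<open>w\<close> of vectors encodes the functional \<open>A \<mapsto> \<Sum>\<^sub>i (A (w i))\<^sub>i\<close> on the endomorphisms;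
  \<open>annihilates J w\<close> says that this functional vanishes on the image of \<open>G\<close>.
\<close>

definition annihilates :: "'x set \<Rightarrow> ('x \<Rightarrow> 'x \<Rightarrow> 'a) \<Rightarrow> bool" where
  "annihilates J w \<longleftrightarrow> w \<in> J \<rightarrow> carrier V \<and> (\<forall>g\<in>carrier G. (\<Oplus>i\<in>J. \<rho> g (w i) i) = \<zero>)"

lemma annihilatesD:
  assumes "annihilates J w"
  shows "i \<in> J \<Longrightarrow> w i \<in> carrier V" "g \<in> carrier G \<Longrightarrow> (\<Oplus>i\<in>J. \<rho> g (w i) i) = \<zero>"
  using assms by (auto simp: annihilates_def)

lemma annihilates_entry:
  assumes "annihilates J w" "i \<in> J" "g \<in> carrier G"
  shows "\<rho> g (w i) j \<in> carrier L"
  by (rule free_moduleD(1)[OF rho_closed[OF assms(3) annihilatesD(1)[OF assms(1,2)]]])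

lemma rho_apply:
  assumes "g \<in> carrier G" "x \<in> carrier V"
  shows "y \<in> carrier V \<Longrightarrow> \<rho> g (x \<oplus>\<^bsub>V\<^esub> y) i = \<rho> g x i \<oplus> \<rho> g y i"
    and "a \<in> carrier L \<Longrightarrow> \<rho> g (a \<odot>\<^bsub>V\<^esub> x) i = a \<otimes> \<rho> g x i"
    and "\<rho> g \<zero>\<^bsub>V\<^esub> i = \<zero>"
proof -
  show "\<rho> g (x \<oplus>\<^bsub>V\<^esub> y) i = \<rho> g x i \<oplus> \<rho> g y i" if "y \<in> carrier V"
    unfolding linear_mapD(2)[OF lin[OF assms(1)] assms(2) that] by (rule free_module_simps(3)[THEN fun_cong])
  show "\<rho> g (a \<odot>\<^bsub>V\<^esub> x) i = a \<otimes> \<rho> g x i" if "a \<in> carrier L"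
    unfolding linear_mapD(3)[OF lin[OF assms(1)] that assms(2)] by (rule free_module_simps(4)[THEN fun_cong])
  show "\<rho> g \<zero>\<^bsub>V\<^esub> i = \<zero>"
    unfolding V.linear_map_zero[OF V.module_axioms lin[OF assms(1)]] by (rule free_module_simps(2)[THEN fun_cong])
qed

lemmas rho_zero = rho_apply(3)[OF _ V.M.zero_closed]

lemma annihilates_add:
  assumes "annihilates J w" "annihilates J w'"
  shows "annihilates J (\<lambda>i. w i \<oplus>\<^bsub>V\<^esub> w' i)"
  unfolding annihilates_def
proof (intro conjI ballI)
  fix g assume g: "g \<in> carrier G"
  have "(\<Oplus>i\<in>J. \<rho> g (w i \<oplus>\<^bsub>V\<^esub> w' i) i) = (\<Oplus>i\<in>J. \<rho> g (w i) i \<oplus> \<rho> g (w' i) i)"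
    using annihilatesD(1)[OF assms(1)] annihilatesD(1)[OF assms(2)] annihilates_entry[OF assms(1) _ g] annihilates_entry[OF assms(2) _ g]
    by (intro finsum_cong') (auto simp: rho_apply(1)[OF g])
  also have "\<dots> = (\<Oplus>i\<in>J. \<rho> g (w i) i) \<oplus> (\<Oplus>i\<in>J. \<rho> g (w' i) i)"
    using annihilates_entry[OF assms(1) _ g] annihilates_entry[OF assms(2) _ g] by (intro finsum_addf) auto
  finally show "(\<Oplus>i\<in>J. \<rho> g (w i \<oplus>\<^bsub>V\<^esub> w' i) i) = \<zero>"
    using annihilatesD(2)[OF assms(1) g] annihilatesD(2)[OF assms(2) g] by simp
qed (use assms annihilatesD(1) in auto)

lemma annihilates_smult:
  assumes "finite J" "annihilates J w" "a \<in> carrier L"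
  shows "annihilates J (\<lambda>i. a \<odot>\<^bsub>V\<^esub> w i)"
  unfolding annihilates_def
proof (intro conjI ballI)
  fix g assume g: "g \<in> carrier G"
  have "(\<Oplus>i\<in>J. \<rho> g (a \<odot>\<^bsub>V\<^esub> w i) i) = (\<Oplus>i\<in>J. a \<otimes> \<rho> g (w i) i)"
    using annihilatesD(1)[OF assms(2)] annihilates_entry[OF assms(2) _ g] assms(3)
    by (intro finsum_cong') (auto simp: rho_apply(2)[OF g])
  also have "\<dots> = a \<otimes> (\<Oplus>i\<in>J. \<rho> g (w i) i)"
    using annihilates_entry[OF assms(2) _ g] assms by (intro finsum_rdistr[symmetric]) auto
  finally show "(\<Oplus>i\<in>J. \<rho> g (a \<odot>\<^bsub>V\<^esub> w i) i) = \<zero>"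
    using annihilatesD(2)[OF assms(2) g] assms by simp
qed (use assms annihilatesD(1) in auto)

text \<open>Applying \<open>\<rho> h\<close> to the family replaces \<open>g\<close> by the product
  of \<open>g\<close> and \<open>h\<close> in the vanishing condition, which is imposed on all of
  \<open>G\<close>. This makes the set \<open>Z\<close> of the induction below invariant.\<close>

lemma annihilates_rho:
  assumes "annihilates J w" "h \<in> carrier G"
  shows "annihilates J (\<lambda>i. \<rho> h (w i))"
  unfolding annihilates_def
proof (intro conjI ballI)
  fix g assume g: "g \<in> carrier G"
  have "(\<Oplus>i\<in>J. \<rho> g (\<rho> h (w i)) i) = (\<Oplus>i\<in>J. \<rho> (g \<otimes>\<^bsub>G\<^esub> h) (w i) i)"
    using annihilatesD(1)[OF assms(1)] annihilates_entry[OF assms(1)] g assms(2)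
    by (intro finsum_cong') (auto simp flip: mult)
  then show "(\<Oplus>i\<in>J. \<rho> g (\<rho> h (w i)) i) = \<zero>"
    using annihilatesD(2)[OF assms(1)] g assms(2) by simp
qed (use assms annihilatesD(1) rho_closed in auto)

lemma annihilates_insert_zero:
  assumes "annihilates (insert k J) w" "w k = \<zero>\<^bsub>V\<^esub>" "finite J" "k \<notin> J"
  shows "annihilates J w"
  unfolding annihilates_def
proof (intro conjI ballI)
  fix g assume g: "g \<in> carrier G"
  have "(\<Oplus>i\<in>insert k J. \<rho> g (w i) i) = \<rho> g (w k) k \<oplus> (\<Oplus>i\<in>J. \<rho> g (w i) i)"
    using assms(3,4) annihilates_entry[OF assms(1) _ g] by (intro finsum_insert) auto
  moreover have "(\<Oplus>i\<in>J. \<rho> g (w i) i) \<in> carrier L"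
    using annihilates_entry[OF assms(1) _ g] by (intro finsum_closed) auto
  ultimately show "(\<Oplus>i\<in>J. \<rho> g (w i) i) = \<zero>"
    using annihilatesD(2)[OF assms(1) g] rho_zero[OF g, of k] assms(2) by simp
qed (use assms annihilatesD(1) in auto)

text \<open>
  If the vectors \<open>w k\<close> of annihilating families on \<open>insert k J\<close> fill all of \<open>V\<close>, they determine the
  rest of the family by induction, so the other components are intertwiners applied to \<open>w k\<close>, that is,
  multiples of \<open>w k\<close>; the basis vector at \<open>k\<close> and the identity of \<open>G\<close> then give a contradiction.
\<close>

lemma annihilates_imp_zero:
  assumes irr: "irreducible_rep L V G \<rho>" and "finite J" "J \<subseteq> B"
  shows "annihilates J w \<Longrightarrow> i \<in> J \<Longrightarrow> w i = \<zero>\<^bsub>V\<^esub>"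
  using assms(2,3)
proof (induction J arbitrary: w i)
  case (insert k J)
  note IH = insert.IH
  have k: "k \<in> B" "J \<subseteq> B" "finite (insert k J)" using insert.prems insert.hyps by auto
  \<comment> \<open>The difference of the two families vanishes at \<open>k\<close>, so it
    annihilates on \<open>J\<close> and the induction hypothesis makes it zero.\<close>
  have uniq: "w i = w' i"
    if w: "annihilates (insert k J) w" and w': "annihilates (insert k J) w'" and "w k = w' k" "i \<in> J" for w w' i
  proof -
    let ?d = "\<lambda>i. w i \<oplus>\<^bsub>V\<^esub> (\<ominus> \<one>) \<odot>\<^bsub>V\<^esub> w' i"
    have d: "annihilates (insert k J) ?d"
      by (intro annihilates_add annihilates_smult w w' k) simp
    have c: "w j \<in> carrier V" "w' j \<in> carrier V" if "j \<in> insert k J" for j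
      using that annihilatesD(1)[OF w] annihilatesD(1)[OF w'] by auto
    have "?d k = \<zero>\<^bsub>V\<^esub>" using c[of k] \<open>w k = w' k\<close> by (simp add: V.M.r_neg flip: V.smult_minus_one)
    then have "annihilates J ?d" using annihilates_insert_zero[OF d] insert.hyps by blast
    then have "?d i = \<zero>\<^bsub>V\<^esub>" using IH[of ?d i] k \<open>i \<in> J\<close> by blast
    then show ?thesis using c[of i] \<open>i \<in> J\<close>
      by (simp add: V.M.minus_eq flip: V.smult_minus_one) (metis V.M.minus_equality V.M.minus_minus V.M.a_inv_closed)
  qed
  \<comment> \<open>The possible components at \<open>k\<close> form an invariant submodule, so
    irreducibility leaves two cases: none but zero occurs, or every vector does.\<close>
  define Z where "Z = {w k | w. annihilates (insert k J) w}"
  have zero: "annihilates (insert k J) (\<lambda>_. \<zero>\<^bsub>V\<^esub>)"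
    by (auto simp: annihilates_def rho_zero)
  have "submodule Z L V"
  proof (rule V.submoduleI')
    show "Z \<subseteq> carrier V" using annihilatesD(1) by (auto simp: Z_def)
    show "\<zero>\<^bsub>V\<^esub> \<in> Z" using zero unfolding Z_def by fast
    show "x \<oplus>\<^bsub>V\<^esub> y \<in> Z" if "x \<in> Z" "y \<in> Z" for x y
      using that annihilates_add unfolding Z_def by fast
    show "a \<odot>\<^bsub>V\<^esub> x \<in> Z" if "a \<in> carrier L" "x \<in> Z" for a x
      using that annihilates_smult[OF k(3)] unfolding Z_def by fast
  qed
  moreover have "\<forall>g\<in>carrier G. \<rho> g ` Z \<subseteq> Z"
    using annihilates_rho unfolding Z_def by fast
  ultimately consider "Z = {\<zero>\<^bsub>V\<^esub>}" | "Z = carrier V"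
    using irr unfolding irreducible_rep_def by blast
  then show ?case
  proof cases
    case 1
    then have wk: "w k = \<zero>\<^bsub>V\<^esub>" using insert.prems(1) unfolding Z_def by blast
    show ?thesis
    proof (cases "i = k")
      case False
      then have "i \<in> J" using insert.prems(2) by simp
      then show ?thesis by (rule uniq[OF insert.prems(1) zero wk])
    qed (simp add: wk)
  next
    case 2
    have "\<exists>w. annihilates (insert k J) w \<and> w k = v" if "v \<in> carrier V" for v
    proof -
      have "v \<in> Z" using that 2 by simp
      then show ?thesis by (auto simp: Z_def)
    qed
    then obtain W where W: "\<And>v. v \<in> carrier V \<Longrightarrow> annihilates (insert k J) (W v)"
      "\<And>v. v \<in> carrier V \<Longrightarrow> W v k = v" by metis
    have Wc: "W v j \<in> carrier V" if "v \<in> carrier V" "j \<in> J" for v j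
      using annihilatesD(1)[OF W(1)] that by auto
    \<comment> \<open>Sums, multiples and translates of the families \<open>W v\<close> annihilate
      again and have the expected component at \<open>k\<close>. By \<open>uniq\<close> their other
      components are the expected ones too, so \<open>\<lambda>v. W v j\<close> is linear and
      commutes with \<open>G\<close>.\<close>
    have scalar: "\<exists>l\<in>carrier L. \<forall>v\<in>carrier V. W v j = l \<odot>\<^bsub>V\<^esub> v" if j: "j \<in> J" for j
    proof (rule schur[OF irr])
      show "linear_map L V V (\<lambda>v. W v j)"
      proof (rule linear_mapI)
        fix x y assume *: "x \<in> carrier V" "y \<in> carrier V"
        then show "W (x \<oplus>\<^bsub>V\<^esub> y) j = W x j \<oplus>\<^bsub>V\<^esub> W y j"
          using uniq[OF W(1) annihilates_add[OF W(1) W(1)] _ j, of "x \<oplus>\<^bsub>V\<^esub> y" x y] W(2) by simp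
      next
        fix a x assume *: "a \<in> carrier L" "x \<in> carrier V"
        then show "W (a \<odot>\<^bsub>V\<^esub> x) j = a \<odot>\<^bsub>V\<^esub> W x j"
          using uniq[OF W(1) annihilates_smult[OF k(3) W(1)] _ j, of "a \<odot>\<^bsub>V\<^esub> x" x a] W(2) by simp
      qed (use Wc j in auto)
      fix g v assume *: "g \<in> carrier G" "v \<in> carrier V"
      then show "W (\<rho> g v) j = \<rho> g (W v j)"
        using uniq[OF W(1) annihilates_rho[OF W(1)] _ j, of "\<rho> g v" v g] W(2) rho_closed by simp
    qed
    define e where "e = free_gen L k"
    have e: "e \<in> carrier V" unfolding e_def by (rule free_gen_closed[OF k(1)])
    \<comment> \<open>\<open>W e j\<close> is a multiple of the basis vector \<open>e\<close>, whose
      coordinate \<open>j\<close> is zero. Evaluated at the identity of \<open>G\<close>, the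
      functional thus keeps only its term at \<open>k\<close>, which is one, although it must
      vanish.\<close>
    have "\<rho> \<one>\<^bsub>G\<^esub> (W e j) j = \<zero>" if j: "j \<in> J" for j
    proof -
      obtain l where l: "l \<in> carrier L" "W e j = l \<odot>\<^bsub>V\<^esub> e" using scalar[OF j] e by blast
      have "j \<noteq> k" using j insert.hyps by blast
      then have "e j = \<zero>" by (simp add: e_def free_gen_def)
      then show ?thesis using l one[OF Wc[OF e j]] by (simp add: free_module_simps)
    qed
    moreover have "\<rho> \<one>\<^bsub>G\<^esub> (W e k) k = \<one>"
      using W(2)[OF e] one[OF e] by (simp add: e_def free_gen_def)
    moreover have "(\<Oplus>i\<in>insert k J. \<rho> \<one>\<^bsub>G\<^esub> (W e i) i) = \<rho> \<one>\<^bsub>G\<^esub> (W e k) k \<oplus> (\<Oplus>i\<in>J. \<rho> \<one>\<^bsub>G\<^esub> (W e i) i)"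
      using insert.hyps annihilates_entry[OF W(1)[OF e]] by (intro finsum_insert) auto
    moreover have "(\<Oplus>i\<in>J. \<rho> \<one>\<^bsub>G\<^esub> (W e i) i) = \<zero>"
      using calculation(1) by (intro add.finprod_one_eqI) auto
    ultimately have "\<one> = \<zero>" using annihilatesD(2)[OF W(1)[OF e] G.one_closed] by simp
    then show ?thesis by simp
  qed
qed simp

text \<open>This is Burnside's theorem on the span of an irreducible matrix group.\<close>

theorem irreducible_iff_spanning:
  "irreducible_rep L V G \<rho> \<longleftrightarrow>
     spanning L (B \<times> B) ((\<lambda>g (i, j). \<rho> g (free_gen L j) i) ` carrier G)"
proof
  have entry: "\<rho> g (free_gen L j) i \<in> carrier L" if "g \<in> carrier G" "j \<in> B" for g i j
    by (rule free_moduleD(1)[OF rho_closed[OF that(1) free_gen_closed[OF that(2)]]])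
  have expand: "\<rho> g v i = (\<Oplus>j\<in>B. v j \<otimes> \<rho> g (free_gen L j) i)" if "g \<in> carrier G" "v \<in> carrier V" for g v i
    by (rule linear_map_coords[OF finite_B lin[OF that(1)] that(2)])
  {
    assume irr: "irreducible_rep L V G \<rho>"
    show "spanning L (B \<times> B) ((\<lambda>g (i, j). \<rho> g (free_gen L j) i) ` carrier G)"
      unfolding spanning_def
    proof (intro ballI impI)
      fix \<phi> d assume \<phi>: "\<phi> \<in> B \<times> B \<rightarrow> carrier L" and d: "d \<in> B \<times> B"
        and kill: "\<forall>s\<in>(\<lambda>g (i, j). \<rho> g (free_gen L j) i) ` carrier G. (\<Oplus>d\<in>B \<times> B. \<phi> d \<otimes> s d) = \<zero>"
      \<comment> \<open>Row \<open>i\<close> of the coefficient matrix \<open>\<phi>\<close>,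
        extended by zero. Pairing \<open>\<phi>\<close> with the matrix of \<open>\<rho> g\<close>
        gives the sum over \<open>i\<close> of coordinate \<open>i\<close> of
        \<open>\<rho> g (w i)\<close>, which is the shape of \<open>annihilates\<close>.\<close>
      define w where "w i j = (if j \<in> B then \<phi> (i, j) else \<zero>)" for i j
      have w: "w i \<in> carrier V" if "i \<in> B" for i
        using \<phi> finite_B that by (intro free_moduleI) (auto simp: w_def)
      have "(\<Oplus>i\<in>B. \<rho> g (w i) i) = \<zero>" if g: "g \<in> carrier G" for g
      proof -
        have "(\<Oplus>i\<in>B. \<rho> g (w i) i) = (\<Oplus>i\<in>B. \<Oplus>j\<in>B. \<phi> (i, j) \<otimes> \<rho> g (free_gen L j) i)"
        proof (rule finsum_cong')
          fix i assume i: "i \<in> B"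
          show "\<rho> g (w i) i = (\<Oplus>j\<in>B. \<phi> (i, j) \<otimes> \<rho> g (free_gen L j) i)"
            unfolding expand[OF g w[OF i]] using \<phi> i entry[OF g]
            by (intro finsum_cong') (auto simp: w_def)
        qed (use \<phi> entry[OF g] in \<open>auto intro!: finsum_closed\<close>)
        also have "\<dots> = (\<Oplus>d\<in>B \<times> B. \<phi> d \<otimes> (case d of (i, j) \<Rightarrow> \<rho> g (free_gen L j) i))"
          using \<phi> entry[OF g] finite_B by (subst finsum_cartesian) auto
        also have "\<dots> = \<zero>" using kill g by auto
        finally show ?thesis .
      qed
      then have "annihilates B w" using w by (auto simp: annihilates_def)
      then have "w (fst d) = \<zero>\<^bsub>V\<^esub>"
        using annihilates_imp_zero[OF irr finite_B subset_refl] d by auto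
      then have "w (fst d) (snd d) = \<zero>" by (simp add: free_module_simps)
      then show "\<phi> d = \<zero>" using d by (auto simp: w_def)
    qed
  }
  {
    assume sp: "spanning L (B \<times> B) ((\<lambda>g (i, j). \<rho> g (free_gen L j) i) ` carrier G)"
    show "irreducible_rep L V G \<rho>"
      unfolding irreducible_rep_def
    proof (intro conjI allI impI)
      obtain b where "b \<in> B" using B_ne by blast
      then have "free_gen L b \<in> carrier V" "free_gen L b \<noteq> \<zero>\<^bsub>V\<^esub>"
        using free_gen_closed by (auto simp: free_module_simps free_gen_def fun_eq_iff)
      then show "carrier V \<noteq> {\<zero>\<^bsub>V\<^esub>}" by blast
      fix W assume *: "submodule W L V \<and> (\<forall>g\<in>carrier G. \<rho> g ` W \<subseteq> W)"
      note WE = V.submoduleE[OF conjunct1[OF *]]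
      show "W = {\<zero>\<^bsub>V\<^esub>} \<or> W = carrier V"
      proof (rule disjCI)
        assume "W \<noteq> carrier V"
        show "W = {\<zero>\<^bsub>V\<^esub>}"
        proof (rule ccontr)
          assume "W \<noteq> {\<zero>\<^bsub>V\<^esub>}"
          then obtain w where w: "w \<in> W" "w \<noteq> \<zero>\<^bsub>V\<^esub>" using V.submodule_zero_mem[OF conjunct1[OF *]] by blast
          have wV: "w \<in> carrier V" using w WE(1) by blast
          obtain j0 where j0: "w j0 \<noteq> \<zero>" using w by (auto simp: free_module_simps)
          then have j0B: "j0 \<in> B" using free_moduleD(2)[OF wV] by blast
          \<comment> \<open>By \<open>spanning_submodule\<close> this already contradicts
            \<open>W \<noteq> carrier V\<close>.\<close>
          have "spanning L B W"
            unfolding spanning_def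
          proof (intro ballI impI)
            fix \<phi> i0 assume \<phi>: "\<phi> \<in> B \<rightarrow> carrier L" and kill: "\<forall>s\<in>W. (\<Oplus>d\<in>B. \<phi> d \<otimes> s d) = \<zero>" and i0: "i0 \<in> B"
            \<comment> \<open>The rank one functional sending an endomorphism to
              \<open>\<phi>\<close> of its value at \<open>w\<close>. It vanishes on
              \<open>\<rho> g\<close>, since \<open>\<rho> g w\<close> lies in \<open>W\<close>; as
              \<open>w j0\<close> is nonzero, its vanishing forces that of
              \<open>\<phi>\<close>.\<close>
            let ?\<phi> = "\<lambda>(i, j). \<phi> i \<otimes> w j"
            have wc: "w j \<in> carrier L" for j by (rule free_moduleD(1)[OF wV])
            have "(\<Oplus>d\<in>B \<times> B. ?\<phi> d \<otimes> (case d of (i, j) \<Rightarrow> \<rho> g (free_gen L j) i)) = \<zero>" if g: "g \<in> carrier G" for g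
            proof -
              have "(\<Oplus>d\<in>B \<times> B. ?\<phi> d \<otimes> (case d of (i, j) \<Rightarrow> \<rho> g (free_gen L j) i))
                  = (\<Oplus>i\<in>B. \<Oplus>j\<in>B. \<phi> i \<otimes> w j \<otimes> \<rho> g (free_gen L j) i)"
                using \<phi> wc entry[OF g] finite_B by (subst finsum_cartesian) (auto simp: Pi_iff)
              also have "\<dots> = (\<Oplus>i\<in>B. \<phi> i \<otimes> \<rho> g w i)"
              proof (rule finsum_cong')
                fix i assume i: "i \<in> B"
                have \<phi>i: "\<phi> i \<in> carrier L" using \<phi> i by blast
                have "(\<Oplus>j\<in>B. \<phi> i \<otimes> w j \<otimes> \<rho> g (free_gen L j) i) = (\<Oplus>j\<in>B. \<phi> i \<otimes> (w j \<otimes> \<rho> g (free_gen L j) i))"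
                  using \<phi>i wc entry[OF g] by (intro finsum_cong') (auto simp: m_assoc)
                also have "\<dots> = \<phi> i \<otimes> (\<Oplus>j\<in>B. w j \<otimes> \<rho> g (free_gen L j) i)"
                  using \<phi>i wc entry[OF g] finite_B by (intro finsum_rdistr[symmetric]) auto
                finally show "(\<Oplus>j\<in>B. \<phi> i \<otimes> w j \<otimes> \<rho> g (free_gen L j) i) = \<phi> i \<otimes> \<rho> g w i"
                  unfolding expand[OF g wV] .
              qed (use \<phi> free_moduleD(1)[OF rho_closed[OF g wV]] in auto)
              also have "\<dots> = \<zero>" using kill * g w by blast
              finally show ?thesis .
            qed
            moreover have "?\<phi> \<in> B \<times> B \<rightarrow> carrier L" using \<phi> wc by auto
            ultimately have "?\<phi> (i0, j0) = \<zero>"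
              using sp i0 j0B unfolding spanning_def by blast
            then show "\<phi> i0 = \<zero>" using j0 wc[of j0] \<phi> i0 integral_iff by (auto simp: Pi_iff)
          qed
          then show False using spanning_submodule[OF finite_B conjunct1[OF *]] \<open>W \<noteq> carrier V\<close> by blast
        qed
      qed
    qed
  }
qed

end

section \<open>Determinants\<close>

text \<open>The Leibniz formula, with permutations sending columns to rows. The entries are a plain
  function rather than a matrix, so that minors are written by reindexing.\<close>

definition ring_det :: "('a, 'b) ring_scheme \<Rightarrow> nat \<Rightarrow> (nat \<Rightarrow> nat \<Rightarrow> 'a) \<Rightarrow> 'a" where
  "ring_det R m E =
     (\<Oplus>\<^bsub>R\<^esub>\<pi>\<in>{\<pi>. \<pi> permutes {..<m}}.
        (if evenperm \<pi> then \<one>\<^bsub>R\<^esub> else \<ominus>\<^bsub>R\<^esub> \<one>\<^bsub>R\<^esub>) \<otimes>\<^bsub>R\<^esub> (\<Otimes>\<^bsub>R\<^esub>c\<in>{..<m}. E (\<pi> c) c))"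

context cring
begin

definition det_term :: "nat \<Rightarrow> (nat \<Rightarrow> nat \<Rightarrow> 'a) \<Rightarrow> (nat \<Rightarrow> nat) \<Rightarrow> 'a" where
  "det_term m E \<pi> = (if evenperm \<pi> then \<one> else \<ominus> \<one>) \<otimes> (\<Otimes>c\<in>{..<m}. E (\<pi> c) c)"

lemma ring_det_alt: "ring_det R m E = (\<Oplus>\<pi>\<in>{\<pi>. \<pi> permutes {..<m}}. det_term m E \<pi>)"
  by (simp add: ring_det_def det_term_def)

lemma permutes_less: "\<pi> permutes {..<m} \<Longrightarrow> c < m \<Longrightarrow> \<pi> c < m" for m :: nat
  using permutes_in_image[of \<pi> "{..<m}" c] by simp

lemma finprod_remove:
  assumes "finite A" "c \<in> A" "\<And>x. x \<in> A \<Longrightarrow> F x \<in> carrier R"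
  shows "(\<Otimes>x\<in>A. F x) = F c \<otimes> (\<Otimes>x\<in>A - {c}. F x)"
  using finprod_insert[of "A - {c}" c F] assms by (auto simp: insert_absorb)

lemma finprod_zero:
  assumes "finite A" "c \<in> A" "\<And>x. x \<in> A \<Longrightarrow> F x \<in> carrier R" "F c = \<zero>"
  shows "(\<Otimes>x\<in>A. F x) = \<zero>"
  using finprod_remove[OF assms(1-3)] assms by simp

lemma det_term_closed:
  assumes "\<And>i j. i < m \<Longrightarrow> j < m \<Longrightarrow> E i j \<in> carrier R" "\<pi> permutes {..<m}"
  shows "det_term m E \<pi> \<in> carrier R"
proof -
  have "(\<Otimes>c\<in>{..<m}. E (\<pi> c) c) \<in> carrier R"
    using assms permutes_less by (intro finprod_closed) auto
  then show ?thesis by (simp add: det_term_def)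
qed

lemma ring_det_closed:
  assumes "\<And>i j. i < m \<Longrightarrow> j < m \<Longrightarrow> E i j \<in> carrier R"
  shows "ring_det R m E \<in> carrier R"
  unfolding ring_det_alt using det_term_closed[OF assms] by (intro finsum_closed) auto

lemma ring_det_cong:
  assumes "\<And>i j. i < m \<Longrightarrow> j < m \<Longrightarrow> E i j = F i j" "\<And>i j. i < m \<Longrightarrow> j < m \<Longrightarrow> F i j \<in> carrier R"
  shows "ring_det R m E = ring_det R m F"
proof -
  have "det_term m E \<pi> = det_term m F \<pi>" if "\<pi> permutes {..<m}" for \<pi>
  proof -
    have "(\<Otimes>c\<in>{..<m}. E (\<pi> c) c) = (\<Otimes>c\<in>{..<m}. F (\<pi> c) c)"
      using assms permutes_less[OF that] by (intro finprod_cong') auto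
    then show ?thesis by (simp add: det_term_def)
  qed
  then show ?thesis
    unfolding ring_det_alt using det_term_closed[OF assms(2)] by (intro finsum_cong') auto
qed

text \<open>Each Leibniz term has exactly one factor from row \<open>k\<close>, in the column that
  \<open>\<pi>\<close> maps to \<open>k\<close>. Additivity and homogeneity are joined in one
  identity to match the form of \<open>ext_relations\<close>.\<close>

lemma ring_det_row_linear:
  assumes E: "\<And>i j. i < m \<Longrightarrow> j < m \<Longrightarrow> E i j \<in> carrier R"
    and k: "k < m" and a: "a \<in> carrier R"
    and x: "\<And>j. j < m \<Longrightarrow> x j \<in> carrier R" and y: "\<And>j. j < m \<Longrightarrow> y j \<in> carrier R"
  shows "ring_det R m (E(k := \<lambda>j. a \<otimes> x j \<oplus> y j))
           = a \<otimes> ring_det R m (E(k := x)) \<oplus> ring_det R m (E(k := y))"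
proof -
  have car: "\<And>i j. i < m \<Longrightarrow> j < m \<Longrightarrow> (E(k := z)) i j \<in> carrier R"
    if "\<And>j. j < m \<Longrightarrow> z j \<in> carrier R" for z using E that by auto
  have tx: "det_term m (E(k := x)) \<pi> \<in> carrier R" and ty: "det_term m (E(k := y)) \<pi> \<in> carrier R"
    if "\<pi> permutes {..<m}" for \<pi>
    by (rule det_term_closed[OF car[OF x] that]; assumption) (rule det_term_closed[OF car[OF y] that]; assumption)
  have lin: "det_term m (E(k := \<lambda>j. a \<otimes> x j \<oplus> y j)) \<pi>
      = a \<otimes> det_term m (E(k := x)) \<pi> \<oplus> det_term m (E(k := y)) \<pi>" if \<pi>: "\<pi> permutes {..<m}" for \<pi>
  proof -
    define c where "c = inv_into UNIV \<pi> k"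
    have c: "c < m" "\<pi> c = k"
      using permutes_less[OF permutes_inv[OF \<pi>] k] permutes_inverses(1)[OF \<pi>] by (auto simp: c_def)
    define P where "P = (\<Otimes>d\<in>{..<m} - {c}. E (\<pi> d) d)"
    define s where "s = (if evenperm \<pi> then \<one> else \<ominus> \<one>)"
    have P: "P \<in> carrier R" unfolding P_def using E permutes_less[OF \<pi>] by (intro finprod_closed) auto
    have s: "s \<in> carrier R" by (simp add: s_def)
    have prod: "det_term m (E(k := z)) \<pi> = s \<otimes> (z c \<otimes> P)" if z: "\<And>j. j < m \<Longrightarrow> z j \<in> carrier R" for z
    proof -
      have "(\<Otimes>d\<in>{..<m}. (E(k := z)) (\<pi> d) d) = (E(k := z)) (\<pi> c) c \<otimes> (\<Otimes>d\<in>{..<m} - {c}. (E(k := z)) (\<pi> d) d)"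
        using c car[OF z] permutes_less[OF \<pi>] by (intro finprod_remove) auto
      also have "(\<Otimes>d\<in>{..<m} - {c}. (E(k := z)) (\<pi> d) d) = P"
        unfolding P_def
      proof (rule finprod_cong')
        fix d assume d: "d \<in> {..<m} - {c}"
        then have "\<pi> d \<noteq> k" using c permutes_inj[OF \<pi>] by (auto dest: injD)
        then show "(E(k := z)) (\<pi> d) d = E (\<pi> d) d" by simp
      qed (use E permutes_less[OF \<pi>] in auto)
      finally show ?thesis by (simp add: det_term_def s_def c)
    qed
    have "x c \<in> carrier R" "y c \<in> carrier R" using x y c by auto
    then have "s \<otimes> ((a \<otimes> x c \<oplus> y c) \<otimes> P) = a \<otimes> (s \<otimes> (x c \<otimes> P)) \<oplus> s \<otimes> (y c \<otimes> P)"
      using s P a by algebra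
    then show ?thesis using prod[of "\<lambda>j. a \<otimes> x j \<oplus> y j"] prod[OF x] prod[OF y] a x y by simp
  qed
  have "ring_det R m (E(k := \<lambda>j. a \<otimes> x j \<oplus> y j))
      = (\<Oplus>\<pi>\<in>{\<pi>. \<pi> permutes {..<m}}. a \<otimes> det_term m (E(k := x)) \<pi> \<oplus> det_term m (E(k := y)) \<pi>)"
    unfolding ring_det_alt using lin a tx ty
    by (intro finsum_cong') auto
  also have "\<dots> = (\<Oplus>\<pi>\<in>{\<pi>. \<pi> permutes {..<m}}. a \<otimes> det_term m (E(k := x)) \<pi>) \<oplus> ring_det R m (E(k := y))"
    unfolding ring_det_alt using a tx ty
    by (intro finsum_addf) auto
  also have "(\<Oplus>\<pi>\<in>{\<pi>. \<pi> permutes {..<m}}. a \<otimes> det_term m (E(k := x)) \<pi>) = a \<otimes> ring_det R m (E(k := x))"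
    unfolding ring_det_alt using a tx
    by (intro finsum_rdistr[symmetric]) (auto simp: finite_permutations)
  finally show ?thesis .
qed

text \<open>Composition with the transposition of \<open>a\<close> and \<open>b\<close> maps even
  permutations bijectively to odd ones and negates their terms. Cancelling in pairs also works in
  characteristic two, where antisymmetry alone would not give zero.\<close>

lemma ring_det_identical_rows:
  assumes E: "\<And>i j. i < m \<Longrightarrow> j < m \<Longrightarrow> E i j \<in> carrier R"
    and ab: "a < m" "b < m" "a \<noteq> b" and eq: "\<And>j. j < m \<Longrightarrow> E a j = E b j"
  shows "ring_det R m E = \<zero>"
proof -
  define \<tau> where "\<tau> = transpose a b"
  have \<tau>: "\<tau> permutes {..<m}" unfolding \<tau>_def using ab by (intro permutes_swap_id) auto
  define P where "P = {\<pi>. \<pi> permutes {..<m} \<and> evenperm \<pi>}"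
  define Q where "Q = {\<pi>. \<pi> permutes {..<m} \<and> \<not> evenperm \<pi>}"
  have even: "evenperm (\<tau> \<circ> \<pi>) \<longleftrightarrow> \<not> evenperm \<pi>" if "\<pi> permutes {..<m}" for \<pi>
  proof -
    have "permutation \<pi>" "permutation \<tau>" using that \<tau> permutation_permutes by blast+
    then show ?thesis using ab by (simp add: evenperm_comp \<tau>_def evenperm_swap)
  qed
  have \<tau>\<tau>: "\<tau> \<circ> (\<tau> \<circ> \<pi>) = \<pi>" for \<pi> by (simp add: \<tau>_def fun_eq_iff)
  have Q: "Q = (\<lambda>\<pi>. \<tau> \<circ> \<pi>) ` P"
  proof (intro equalityI subsetI)
    fix \<pi> assume "\<pi> \<in> Q"
    then have "\<tau> \<circ> \<pi> \<in> P" using even permutes_compose[OF _ \<tau>] by (auto simp: P_def Q_def)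
    then have "\<tau> \<circ> (\<tau> \<circ> \<pi>) \<in> (\<lambda>\<pi>. \<tau> \<circ> \<pi>) ` P" by (rule imageI)
    then show "\<pi> \<in> (\<lambda>\<pi>. \<tau> \<circ> \<pi>) ` P" by (simp only: \<tau>\<tau>)
  qed (use even permutes_compose[OF _ \<tau>] in \<open>auto simp: P_def Q_def\<close>)
  have inj: "inj_on (\<lambda>\<pi>. \<tau> \<circ> \<pi>) P" by (rule inj_on_inverseI[of _ "\<lambda>\<pi>. \<tau> \<circ> \<pi>"]) (rule \<tau>\<tau>)
  have fin: "finite P" "finite Q"
    using finite_permutations[of "{..<m}"] by (auto simp: P_def Q_def elim: rev_finite_subset)
  have car: "det_term m E \<pi> \<in> carrier R" if "\<pi> \<in> P \<union> Q" for \<pi>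
    using det_term_closed[OF E] that by (auto simp: P_def Q_def)
  have neg: "det_term m E (\<tau> \<circ> \<pi>) = \<ominus> det_term m E \<pi>" if "\<pi> \<in> P" for \<pi>
  proof -
    have \<pi>: "\<pi> permutes {..<m}" "evenperm \<pi>" using that by (auto simp: P_def)
    have "(\<Otimes>c\<in>{..<m}. E ((\<tau> \<circ> \<pi>) c) c) = (\<Otimes>c\<in>{..<m}. E (\<pi> c) c)"
      using E eq permutes_less[OF \<pi>(1)] by (intro finprod_cong') (auto simp: \<tau>_def transpose_def)
    moreover have "(\<Otimes>c\<in>{..<m}. E (\<pi> c) c) \<in> carrier R"
      using E permutes_less[OF \<pi>(1)] by (intro finprod_closed) auto
    ultimately show ?thesis using even[OF \<pi>(1)] \<pi>(2) by (simp add: det_term_def l_minus)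
  qed
  have PQ: "{\<pi>. \<pi> permutes {..<m}} = P \<union> Q" by (auto simp: P_def Q_def)
  have "P \<inter> Q = {}" by (auto simp: P_def Q_def)
  then have "ring_det R m E = (\<Oplus>\<pi>\<in>P. det_term m E \<pi>) \<oplus> (\<Oplus>\<pi>\<in>Q. det_term m E \<pi>)"
    unfolding ring_det_alt PQ using fin car by (intro finsum_Un_disjoint) auto
  also have "(\<Oplus>\<pi>\<in>Q. det_term m E \<pi>) = (\<Oplus>\<pi>\<in>P. det_term m E (\<tau> \<circ> \<pi>))"
    unfolding Q by (rule finsum_reindex[OF _ inj]) (use car Q in auto)
  also have "(\<Oplus>\<pi>\<in>P. det_term m E \<pi>) \<oplus> \<dots> = (\<Oplus>\<pi>\<in>P. det_term m E \<pi> \<oplus> det_term m E (\<tau> \<circ> \<pi>))"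
    using car neg by (intro finsum_addf[symmetric]) auto
  also have "\<dots> = \<zero>" using car neg by (intro add.finprod_one_eqI) (simp add: r_neg)
  finally show ?thesis .
qed

text \<open>A nonzero Leibniz term requires \<open>s ! \<pi> c = t ! c\<close> for all
  \<open>c\<close>. Then \<open>s\<close> and \<open>t\<close> have the same elements, so they
  coincide as strictly increasing lists, and distinctness leaves only the identity
  permutation.\<close>

lemma ring_det_delta:
  fixes s t :: "'i :: linorder list"
  assumes s: "sorted_wrt (<) s" "length s = m" and t: "sorted_wrt (<) t" "length t = m"
  shows "ring_det R m (\<lambda>i c. if s ! i = t ! c then \<one> else \<zero>) = (if s = t then \<one> else \<zero>)"
proof -
  let ?E = "\<lambda>i c. if s ! i = t ! c then \<one> else \<zero>"
  have zero: "det_term m ?E \<pi> = \<zero>" if "\<pi> permutes {..<m}" "c < m" "s ! \<pi> c \<noteq> t ! c" for \<pi> c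
  proof -
    have "(\<Otimes>c\<in>{..<m}. ?E (\<pi> c) c) = \<zero>" by (rule finprod_zero[of _ c]) (use that in auto)
    then show ?thesis by (simp add: det_term_def)
  qed
  have d: "distinct s" "distinct t" using s t by (auto simp: strict_sorted_iff)
  show ?thesis
  proof (cases "s = t")
    case True
    have 0: "det_term m ?E \<pi> = (if id = \<pi> then \<one> else \<zero>)" if \<pi>: "\<pi> permutes {..<m}" for \<pi>
    proof (cases "\<pi> = id")
      case True
      have "(\<Otimes>c\<in>{..<m}. ?E (\<pi> c) c) = \<one>"
        by (rule finprod_one_eqI) (simp add: True \<open>s = t\<close>)
      then show ?thesis by (simp add: det_term_def True)
    next
      case False
      then obtain c where "\<pi> c \<noteq> c" by (auto simp: fun_eq_iff)
      moreover from this have "c < m" using permutes_not_in[OF \<pi>] by force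
      ultimately have "det_term m ?E \<pi> = \<zero>"
        using d t permutes_less[OF \<pi>] \<open>s = t\<close> by (intro zero[OF \<pi>]) (auto simp: nth_eq_iff_index_eq)
      then show ?thesis using False by auto
    qed
    have "ring_det R m ?E = (\<Oplus>\<pi>\<in>{\<pi>. \<pi> permutes {..<m}}. if id = \<pi> then \<one> else \<zero>)"
      unfolding ring_det_alt using 0 by (intro finsum_cong') auto
    also have "\<dots> = \<one>"
      by (rule finsum_singleton[where f = "\<lambda>_. \<one>"]) (auto simp: permutes_id finite_permutations)
    finally show ?thesis using True by simp
  next
    case False
    have "det_term m ?E \<pi> = \<zero>" if \<pi>: "\<pi> permutes {..<m}" for \<pi>
    proof (rule ccontr)
      assume "det_term m ?E \<pi> \<noteq> \<zero>"
      then have "\<forall>c<m. s ! \<pi> c = t ! c" using zero[OF \<pi>] by blast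
      then have "set t \<subseteq> set s" using permutes_less[OF \<pi>] s t by (auto simp: in_set_conv_nth) (metis nth_mem)
      moreover have "card (set s) = card (set t)" using d s t by (simp add: distinct_card)
      ultimately have "set s = set t" by (metis List.finite_set card_subset_eq)
      then have "s = t" using s t by (metis strict_sorted_equal)
      then show False using False by simp
    qed
    then have "ring_det R m ?E = \<zero>" unfolding ring_det_alt by (intro add.finprod_one_eqI) auto
    then show ?thesis using False by simp
  qed
qed

end

lemma (in ring_hom_cring) hom_ring_det:
  assumes "\<And>i j. i < m \<Longrightarrow> j < m \<Longrightarrow> E i j \<in> carrier R"
  shows "h (ring_det R m E) = ring_det S m (\<lambda>i j. h (E i j))"
proof -
  have "h (R.det_term m E \<pi>) = S.det_term m (\<lambda>i j. h (E i j)) \<pi>" if \<pi>: "\<pi> permutes {..<m}" for \<pi>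
  proof -
    have c: "(\<lambda>c. E (\<pi> c) c) \<in> {..<m} \<rightarrow> carrier R" using assms permutes_less[OF \<pi>] by auto
    have "h (\<Otimes>\<^bsub>R\<^esub>c\<in>{..<m}. E (\<pi> c) c) = (\<Otimes>\<^bsub>S\<^esub>c\<in>{..<m}. h (E (\<pi> c) c))"
      using hom_finprod[OF c] by (simp add: o_def)
    then show ?thesis
      using R.finprod_closed[OF c] by (simp add: R.det_term_def S.det_term_def)
  qed
  then show ?thesis
    unfolding R.ring_det_alt S.ring_det_alt using R.det_term_closed[OF assms] S.det_term_closed assms
    by (subst hom_finsum) (auto simp: Pi_iff intro!: S.finsum_cong')
qed

section \<open>Exterior powers\<close>

text \<open>The linear extension of a function given on generators. Summing over the support keeps
  the sum finite for the infinite set of tuples.\<close>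

definition free_ext :: "('a, 'b) ring_scheme \<Rightarrow> ('x \<Rightarrow> 'y \<Rightarrow> 'a) \<Rightarrow> ('x \<Rightarrow> 'a) \<Rightarrow> 'y \<Rightarrow> 'a" where
  "free_ext R f u = (\<lambda>y. \<Oplus>\<^bsub>R\<^esub>x\<in>{x. u x \<noteq> \<zero>\<^bsub>R\<^esub>}. u x \<otimes>\<^bsub>R\<^esub> f x y)"

lemma linear_map_comp:
  "linear_map R M N f \<Longrightarrow> linear_map R N P g \<Longrightarrow> linear_map R M P (\<lambda>x. g (f x))"
  by (auto simp: linear_map_def Pi_iff)

context cring
begin

lemma linear_map_free_map:
  assumes "f \<in> B \<rightarrow> B'"
  shows "linear_map R (free_module R B) (free_module R B') (free_map R f)"
  by (rule linear_mapI) (auto intro: free_map_closed[OF _ assms] free_map_add free_map_smult)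

lemma free_ext_superset:
  assumes f: "\<And>x. x \<in> B \<Longrightarrow> f x \<in> carrier (free_module R C)"
    and u: "u \<in> carrier (free_module R B)" and T: "finite T" "{x. u x \<noteq> \<zero>} \<subseteq> T" "T \<subseteq> B"
  shows "free_ext R f u y = (\<Oplus>x\<in>T. u x \<otimes> f x y)"
  unfolding free_ext_def
  by (rule add.finprod_mono_neutral_cong_left)
    (use T free_moduleD(1)[OF u] free_moduleD(1)[OF f] in auto)

lemma linear_map_free_ext:
  assumes f: "\<And>x. x \<in> B \<Longrightarrow> f x \<in> carrier (free_module R C)" and C: "finite C"
  shows "linear_map R (free_module R B) (free_module R C) (free_ext R f)"
proof (rule linear_mapI)
  let ?F = "free_module R B" and ?C = "free_module R C"
  interpret F: module R ?F by (rule module_free_module) (rule cring_axioms)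
  have fc: "f x y \<in> carrier R" if "x \<in> B" for x y by (rule free_moduleD(1)[OF f[OF that]])
  fix u assume u: "u \<in> carrier ?F"
  let ?S = "{x. u x \<noteq> \<zero>}"
  have uc: "u x \<in> carrier R" for x by (rule free_moduleD(1)[OF u])
  have S: "finite ?S" "?S \<subseteq> B" using u by (auto simp: free_module_simps)
  show "free_ext R f u \<in> carrier ?C"
  proof (rule free_moduleI[OF C])
    show "free_ext R f u y \<in> carrier R" for y
      unfolding free_ext_def using S uc fc by (intro finsum_closed) auto
    show "free_ext R f u y = \<zero>" if "y \<notin> C" for y
      unfolding free_ext_def using S uc that free_moduleD(2)[OF f that]
      by (intro add.finprod_one_eqI) auto
  qed
  {
    fix w assume w: "w \<in> carrier ?F"
    have wc: "w x \<in> carrier R" for x by (rule free_moduleD(1)[OF w])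
    let ?T = "?S \<union> {x. w x \<noteq> \<zero>}"
    have T: "finite ?T" "?T \<subseteq> B" using u w by (auto simp: free_module_simps)
    show "free_ext R f (u \<oplus>\<^bsub>?F\<^esub> w) = free_ext R f u \<oplus>\<^bsub>?C\<^esub> free_ext R f w"
    proof
      fix y
      have "free_ext R f (u \<oplus>\<^bsub>?F\<^esub> w) y = (\<Oplus>x\<in>?T. (u x \<oplus> w x) \<otimes> f x y)"
        by (subst free_ext_superset[OF f F.a_closed[OF u w] T(1) _ T(2)]) (auto simp: free_module_simps)
      also have "\<dots> = (\<Oplus>x\<in>?T. u x \<otimes> f x y \<oplus> w x \<otimes> f x y)"
        using T uc wc fc by (intro finsum_cong') (auto simp: l_distr)
      also have "\<dots> = (\<Oplus>x\<in>?T. u x \<otimes> f x y) \<oplus> (\<Oplus>x\<in>?T. w x \<otimes> f x y)"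
        using T uc wc fc by (intro finsum_addf) auto
      also have "\<dots> = free_ext R f u y \<oplus> free_ext R f w y"
        using free_ext_superset[OF f u T(1) _ T(2)] free_ext_superset[OF f w T(1) _ T(2)] by simp
      finally show "free_ext R f (u \<oplus>\<^bsub>?F\<^esub> w) y = (free_ext R f u \<oplus>\<^bsub>?C\<^esub> free_ext R f w) y"
        by (simp add: free_module_simps)
    qed
  }
  fix a assume a: "a \<in> carrier R"
  show "free_ext R f (a \<odot>\<^bsub>?F\<^esub> u) = a \<odot>\<^bsub>?C\<^esub> free_ext R f u"
  proof
    fix y
    have "free_ext R f (a \<odot>\<^bsub>?F\<^esub> u) y = (\<Oplus>x\<in>?S. (a \<otimes> u x) \<otimes> f x y)"
      by (subst free_ext_superset[OF f F.smult_closed[OF a u] S(1) _ S(2)]) (use a in \<open>auto simp: free_module_simps\<close>)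
    also have "\<dots> = (\<Oplus>x\<in>?S. a \<otimes> (u x \<otimes> f x y))"
      using S uc fc a by (intro finsum_cong') (auto simp: m_assoc)
    also have "\<dots> = a \<otimes> free_ext R f u y"
      unfolding free_ext_def using S uc fc a by (intro finsum_rdistr[symmetric]) auto
    finally show "free_ext R f (a \<odot>\<^bsub>?F\<^esub> u) y = (a \<odot>\<^bsub>?C\<^esub> free_ext R f u) y"
      by (simp add: free_module_simps)
  qed
qed

lemma free_ext_free_gen:
  assumes f: "\<And>x. x \<in> B \<Longrightarrow> f x \<in> carrier (free_module R C)" and b: "b \<in> B"
  shows "free_ext R f (free_gen R b) = f b"
proof
  fix y
  have fc: "f b y \<in> carrier R" by (rule free_moduleD(1)[OF f[OF b]])
  have "free_ext R f (free_gen R b) y = (\<Oplus>x\<in>{b}. free_gen R b x \<otimes> f x y)"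
    by (rule free_ext_superset[OF f free_gen_closed[OF b]]) (use b in \<open>auto simp: free_gen_def\<close>)
  also have "\<dots> = f b y" using fc by (simp add: free_gen_def)
  finally show "free_ext R f (free_gen R b) y = f b y" .
qed

end

context module
begin

section \<open>Wedge products in the quotient\<close>

abbreviation ext_power :: "nat \<Rightarrow> ('a, ('c list \<Rightarrow> 'a) set) module" where
  "ext_power m \<equiv> exterior_power R M m"

definition ext_class :: "nat \<Rightarrow> ('c list \<Rightarrow> 'a) \<Rightarrow> ('c list \<Rightarrow> 'a) set" where
  "ext_class m u = ext_kernel R M m +>\<^bsub>ext_free m\<^esub> u"

definition wedge :: "nat \<Rightarrow> 'c list \<Rightarrow> ('c list \<Rightarrow> 'a) set" where
  "wedge m vs = ext_class m (free_gen R vs)"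

lemma linear_map_ext_class: "linear_map R (ext_free m) (ext_power m) (ext_class m)"
proof (rule linear_mapI)
  note Q = module_quot_module[OF module_free_module[OF R.cring_axioms] submodule_ext_kernel, folded exterior_power_def]
  fix u assume u: "u \<in> carrier (ext_free m)"
  show "ext_class m u \<in> carrier (ext_power m)"
    using u by (auto simp: ext_class_def exterior_power_def quot_module_def A_RCOSETS_def')
  show "ext_class m (u \<oplus>\<^bsub>ext_free m\<^esub> w) = ext_class m u \<oplus>\<^bsub>ext_power m\<^esub> ext_class m w"
    if "w \<in> carrier (ext_free m)" for w
    unfolding ext_class_def by (rule Q(2)[symmetric, OF u that])
  show "ext_class m (a \<odot>\<^bsub>ext_free m\<^esub> u) = a \<odot>\<^bsub>ext_power m\<^esub> ext_class m u" if "a \<in> carrier R" for a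
    unfolding ext_class_def by (rule Q(3)[symmetric, OF that u])
qed

lemma ext_power_cases:
  assumes "\<omega> \<in> carrier (ext_power m)"
  obtains u where "u \<in> carrier (ext_free m)" "\<omega> = ext_class m u"
  using assms by (auto simp: ext_class_def exterior_power_def quot_module_def A_RCOSETS_def' a_r_coset_def')

lemma ext_class_eqD:
  assumes "u \<in> carrier (ext_free m)" "w \<in> carrier (ext_free m)" "ext_class m u = ext_class m w"
  obtains r where "r \<in> ext_kernel R M m" "u = r \<oplus>\<^bsub>ext_free m\<^esub> w"
proof -
  interpret F: module R "ext_free m" by (rule module_free_module) (rule R.cring_axioms)
  interpret N: submodule "ext_kernel R M m" R "ext_free m" by (rule submodule_ext_kernel)
  interpret N: abelian_subgroup "ext_kernel R M m" "ext_free m" by (rule abelian_subgroupI3) (unfold_locales)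
  have "u \<in> ext_class m w" using N.a_rcos_self[OF assms(1)] assms(3) by (simp add: ext_class_def)
  then show ?thesis using that by (auto simp: ext_class_def a_r_coset_def')
qed

lemma ext_class_kernel: "r \<in> ext_kernel R M m \<Longrightarrow> ext_class m r = \<zero>\<^bsub>ext_power m\<^esub>"
proof -
  interpret F: module R "ext_free m" by (rule module_free_module) (rule R.cring_axioms)
  interpret N: submodule "ext_kernel R M m" R "ext_free m" by (rule submodule_ext_kernel)
  interpret N: abelian_subgroup "ext_kernel R M m" "ext_free m" by (rule abelian_subgroupI3) (unfold_locales)
  show "r \<in> ext_kernel R M m \<Longrightarrow> ext_class m r = \<zero>\<^bsub>ext_power m\<^esub>"
    using N.a_rcos_const by (simp add: ext_class_def exterior_power_def quot_module_def)
qed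

lemma ext_relations_kernel: "ext_relations R M m \<subseteq> ext_kernel R M m"
  unfolding ext_kernel_def
  by (rule submodule_submodule_gen(2)[OF module_free_module[OF R.cring_axioms] ext_relations_closed])

lemma wedge_closed: "vs \<in> tuples M m \<Longrightarrow> wedge m vs \<in> carrier (ext_power m)"
  unfolding wedge_def by (rule linear_mapD(1)[OF linear_map_ext_class R.free_gen_closed])

lemma wedge_linear:
  assumes "vs \<in> tuples M m" "k < m" "a \<in> carrier R" "x \<in> carrier M" "y \<in> carrier M"
  shows "wedge m (vs[k := a \<odot>\<^bsub>M\<^esub> x \<oplus>\<^bsub>M\<^esub> y])
           = a \<odot>\<^bsub>ext_power m\<^esub> wedge m (vs[k := x]) \<oplus>\<^bsub>ext_power m\<^esub> wedge m (vs[k := y])"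
proof -
  let ?F = "ext_free m"
  interpret F: module R ?F by (rule module_free_module) (rule R.cring_axioms)
  interpret E: module R "ext_power m" by (rule module_exterior_power)
  let ?p = "free_gen R (vs[k := (a \<odot>\<^bsub>M\<^esub> x) \<oplus>\<^bsub>M\<^esub> y])"
  let ?q = "(a \<odot>\<^bsub>?F\<^esub> free_gen R (vs[k := x])) \<oplus>\<^bsub>?F\<^esub> free_gen R (vs[k := y])"
  have c: "?p \<in> carrier ?F" "free_gen R (vs[k := x]) \<in> carrier ?F" "free_gen R (vs[k := y]) \<in> carrier ?F"
    using assms by (auto intro!: R.free_gen_closed tuples_update)
  then have q: "?q \<in> carrier ?F" using assms by simp
  have "?p \<ominus>\<^bsub>?F\<^esub> ?q \<in> ext_relations R M m"
    unfolding ext_relations_def Let_def using assms by blast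
  then have r: "?p \<ominus>\<^bsub>?F\<^esub> ?q \<in> ext_kernel R M m" using ext_relations_kernel by blast
  have "?p = (?p \<ominus>\<^bsub>?F\<^esub> ?q) \<oplus>\<^bsub>?F\<^esub> ?q"
    using c(1) q by (simp add: a_minus_def F.a_assoc F.M.l_neg)
  then have "ext_class m ?p = ext_class m ((?p \<ominus>\<^bsub>?F\<^esub> ?q) \<oplus>\<^bsub>?F\<^esub> ?q)" by simp
  also have "\<dots> = ext_class m (?p \<ominus>\<^bsub>?F\<^esub> ?q) \<oplus>\<^bsub>ext_power m\<^esub> ext_class m ?q"
    using c(1) q by (intro linear_mapD(2)[OF linear_map_ext_class]) auto
  also have "\<dots> = ext_class m ?q"
    using ext_class_kernel[OF r] linear_mapD(1)[OF linear_map_ext_class q] by simp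
  also have "\<dots> = a \<odot>\<^bsub>ext_power m\<^esub> ext_class m (free_gen R (vs[k := x])) \<oplus>\<^bsub>ext_power m\<^esub> ext_class m (free_gen R (vs[k := y]))"
    using c assms(3) by (simp add: linear_mapD[OF linear_map_ext_class])
  finally show ?thesis by (simp add: wedge_def)
qed

lemma wedge_eq_entries:
  assumes "vs \<in> tuples M m" "i < m" "j < m" "i \<noteq> j" "vs ! i = vs ! j"
  shows "wedge m vs = \<zero>\<^bsub>ext_power m\<^esub>"
proof -
  have "free_gen R vs \<in> ext_relations R M m"
    using assms unfolding ext_relations_def Let_def by (cases i j rule: linorder_cases) (auto, metis+)
  then show ?thesis unfolding wedge_def using ext_relations_kernel ext_class_kernel by blast
qed

text \<open>Polarization: expanding the wedge with the sum of the two entries in both places leaves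
  just the two mixed wedges, whose sum is zero.\<close>

lemma wedge_swap:
  assumes vs: "vs \<in> tuples M m" and ij: "i < m" "j < m" "i \<noteq> j"
  shows "wedge m (vs[i := vs ! j, j := vs ! i]) = \<ominus>\<^bsub>ext_power m\<^esub> wedge m vs"
proof -
  interpret E: module R "ext_power m" by (rule module_exterior_power)
  define x y where "x = vs ! i" and "y = vs ! j"
  have len: "length vs = m" using vs by (simp add: tuples_def)
  have xy: "x \<in> carrier M" "y \<in> carrier M"
    using vs ij by (auto simp: tuples_def x_def y_def subset_iff)
  \<comment> \<open>Only the entries at \<open>i\<close> and \<open>j\<close> vary. As
    \<open>i \<noteq> j\<close> the two updates commute, so linearity is available in either
    place.\<close>
  define w where "w p q = wedge m (vs[i := p, j := q])" for p q
  have w_alt: "w p q = wedge m (vs[j := q, i := p])" for p q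
    unfolding w_def using ij(3) by (simp add: list_update_swap)
  have wc: "w p q \<in> carrier (ext_power m)" if "p \<in> carrier M" "q \<in> carrier M" for p q
    unfolding w_def using that vs by (intro wedge_closed tuples_update)
  have add2: "w p (q \<oplus>\<^bsub>M\<^esub> q') = w p q \<oplus>\<^bsub>ext_power m\<^esub> w p q'" if "p \<in> carrier M" "q \<in> carrier M" "q' \<in> carrier M" for p q q'
    unfolding w_def using wedge_linear[OF tuples_update[OF vs that(1)] ij(2) R.one_closed that(2,3), of i]
      that wc[OF that(1,2)] by (simp add: w_def)
  have add1: "w (p \<oplus>\<^bsub>M\<^esub> p') q = w p q \<oplus>\<^bsub>ext_power m\<^esub> w p' q" if "p \<in> carrier M" "p' \<in> carrier M" "q \<in> carrier M" for p p' q
    unfolding w_alt using wedge_linear[OF tuples_update[OF vs that(3)] ij(1) R.one_closed that(1,2), of j]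
      that wc[OF that(1,3)] by (simp add: w_alt)
  have alt: "w p p = \<zero>\<^bsub>ext_power m\<^esub>" if "p \<in> carrier M" for p
    unfolding w_def using ij len that vs
    by (intro wedge_eq_entries[of _ _ i j] tuples_update) (auto simp: nth_list_update)
  have "\<zero>\<^bsub>ext_power m\<^esub> = w (x \<oplus>\<^bsub>M\<^esub> y) (x \<oplus>\<^bsub>M\<^esub> y)" using alt xy by simp
  also have "\<dots> = (w x x \<oplus>\<^bsub>ext_power m\<^esub> w y x) \<oplus>\<^bsub>ext_power m\<^esub> (w x y \<oplus>\<^bsub>ext_power m\<^esub> w y y)"
    using xy by (simp add: add1 add2)
  also have "\<dots> = w y x \<oplus>\<^bsub>ext_power m\<^esub> w x y"
    using xy wc by (simp add: alt E.M.a_comm)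
  finally have "w y x \<oplus>\<^bsub>ext_power m\<^esub> w x y = \<zero>\<^bsub>ext_power m\<^esub>" by simp
  then have "w y x = \<ominus>\<^bsub>ext_power m\<^esub> w x y"
    using E.M.minus_equality wc xy by metis
  moreover have "vs[i := x, j := y] = vs" by (simp add: x_def y_def)
  ultimately show ?thesis by (simp add: w_def x_def y_def)
qed

text \<open>Phrased as membership in a submodule so that no sign has to be tracked: each
  transposition changes the wedge by a sign at most, and \<open>Y\<close> is closed under
  negation.\<close>

lemma wedge_permute:
  assumes Y: "submodule Y R (ext_power m)" and p: "p permutes {..<m}"
  shows "vs \<in> tuples M m \<Longrightarrow> wedge m vs \<in> Y \<Longrightarrow> wedge m (permute_list p vs) \<in> Y"
  using p finite_lessThan[of m]
proof (induction arbitrary: vs rule: permutes_induct)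
  case id
  then show ?case by simp
next
  case (swap a b p)
  interpret E: module R "ext_power m" by (rule module_exterior_power)
  have len: "length vs = m" using swap.prems by (simp add: tuples_def)
  have ab: "transpose a b permutes {..<m}" using swap.hyps by (intro permutes_swap_id) auto
  have vs': "permute_list (transpose a b) vs \<in> tuples M m"
    using swap.prems ab len by (simp add: tuples_def set_permute_list)
  have "wedge m (permute_list (transpose a b) vs) \<in> Y"
  proof (cases "a = b")
    case False
    have "permute_list (transpose a b) vs = vs[a := vs ! b, b := vs ! a]"
      using len swap.hyps False ab
      by (intro nth_equalityI) (auto simp: permute_list_nth nth_list_update transpose_def)
    then show ?thesis
      using wedge_swap[OF swap.prems(1), of a b] swap.hyps False swap.prems E.submoduleE(3)[OF Y] by simp
  qed (use swap.prems in simp)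
  from swap.IH[OF vs' this] show ?case
    using swap.hyps len by (subst permute_list_compose) auto
qed

text \<open>The universal property of the exterior power: the kernel of the linear extension is a
  submodule, and multilinearity and alternation say that it contains the generating
  relations.\<close>

lemma free_ext_kernel:
  assumes C: "finite C" and f: "\<And>vs. vs \<in> tuples M m \<Longrightarrow> f vs \<in> carrier (free_module R C)"
    and lin: "\<And>vs k a x y. vs \<in> tuples M m \<Longrightarrow> k < m \<Longrightarrow> a \<in> carrier R \<Longrightarrow> x \<in> carrier M \<Longrightarrow> y \<in> carrier M \<Longrightarrow>
      f (vs[k := a \<odot>\<^bsub>M\<^esub> x \<oplus>\<^bsub>M\<^esub> y]) = a \<odot>\<^bsub>free_module R C\<^esub> f (vs[k := x]) \<oplus>\<^bsub>free_module R C\<^esub> f (vs[k := y])"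
    and alt: "\<And>vs i j. vs \<in> tuples M m \<Longrightarrow> i < j \<Longrightarrow> j < m \<Longrightarrow> vs ! i = vs ! j \<Longrightarrow> f vs = \<zero>\<^bsub>free_module R C\<^esub>"
    and u: "u \<in> ext_kernel R M m"
  shows "free_ext R f u = \<zero>\<^bsub>free_module R C\<^esub>"
proof -
  let ?F = "ext_free m" and ?C = "free_module R C"
  interpret F: module R ?F by (rule module_free_module) (rule R.cring_axioms)
  interpret C: module R ?C by (rule module_free_module) (rule R.cring_axioms)
  have E: "linear_map R ?F ?C (free_ext R f)" by (rule R.linear_map_free_ext[OF f C])
  have gen: "free_ext R f (free_gen R vs) = f vs" if "vs \<in> tuples M m" for vs
    by (rule R.free_ext_free_gen[OF f that])
  have zero: "linear_map R ?F ?C (\<lambda>_. \<zero>\<^bsub>?C\<^esub>)" by (rule linear_mapI) auto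
  let ?W = "{u \<in> carrier ?F. free_ext R f u = \<zero>\<^bsub>?C\<^esub>}"
  have W: "submodule ?W R ?F" by (rule F.submodule_equalizer[OF C.module_axioms E zero])
  have "ext_relations R M m \<subseteq> ?W"
  proof
    fix r assume r: "r \<in> ext_relations R M m"
    then have rF: "r \<in> carrier ?F" using ext_relations_closed by blast
    have "free_ext R f r = \<zero>\<^bsub>?C\<^esub>"
      using r unfolding ext_relations_def Let_def
    proof (elim UnE)
      assume "r \<in> {free_gen R (vs[k := (a \<odot>\<^bsub>M\<^esub> x) \<oplus>\<^bsub>M\<^esub> y])
          \<ominus>\<^bsub>?F\<^esub> ((a \<odot>\<^bsub>?F\<^esub> free_gen R (vs[k := x])) \<oplus>\<^bsub>?F\<^esub> free_gen R (vs[k := y]))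
        | vs k a x y. vs \<in> tuples M m \<and> k < m \<and> a \<in> carrier R \<and> x \<in> carrier M \<and> y \<in> carrier M}"
      then obtain vs k a x y where *: "vs \<in> tuples M m" "k < m" "a \<in> carrier R" "x \<in> carrier M" "y \<in> carrier M"
        and r: "r = free_gen R (vs[k := (a \<odot>\<^bsub>M\<^esub> x) \<oplus>\<^bsub>M\<^esub> y])
          \<ominus>\<^bsub>?F\<^esub> ((a \<odot>\<^bsub>?F\<^esub> free_gen R (vs[k := x])) \<oplus>\<^bsub>?F\<^esub> free_gen R (vs[k := y]))"
        by blast
      let ?p = "free_gen R (vs[k := (a \<odot>\<^bsub>M\<^esub> x) \<oplus>\<^bsub>M\<^esub> y])"
      let ?q = "(a \<odot>\<^bsub>?F\<^esub> free_gen R (vs[k := x])) \<oplus>\<^bsub>?F\<^esub> free_gen R (vs[k := y])"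
      have t: "vs[k := x] \<in> tuples M m" "vs[k := y] \<in> tuples M m" "vs[k := (a \<odot>\<^bsub>M\<^esub> x) \<oplus>\<^bsub>M\<^esub> y] \<in> tuples M m"
        using * by (auto intro!: tuples_update)
      have c: "?p \<in> carrier ?F" "free_gen R (vs[k := x]) \<in> carrier ?F" "free_gen R (vs[k := y]) \<in> carrier ?F"
        using t by (auto intro!: R.free_gen_closed)
      then have q: "?q \<in> carrier ?F" using * by simp
      have "free_ext R f ?q = free_ext R f ?p"
        using c t * by (simp add: linear_mapD[OF E] gen lin)
      \<comment> \<open>The difference is rewritten with the scalar minus one, because
        \<open>linear_map\<close> speaks of sums and multiples only.\<close>
      moreover have "r = ?p \<oplus>\<^bsub>?F\<^esub> (\<ominus> \<one>) \<odot>\<^bsub>?F\<^esub> ?q"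
        unfolding r a_minus_def using F.smult_minus_one[OF q] by simp
      moreover have "free_ext R f (?p \<oplus>\<^bsub>?F\<^esub> (\<ominus> \<one>) \<odot>\<^bsub>?F\<^esub> ?q) = free_ext R f ?p \<oplus>\<^bsub>?C\<^esub> (\<ominus> \<one>) \<odot>\<^bsub>?C\<^esub> free_ext R f ?q"
        using c(1) q by (simp add: linear_mapD[OF E])
      ultimately show ?thesis
        using linear_mapD(1)[OF E c(1)] by (simp add: C.M.r_neg flip: C.smult_minus_one)
    next
      assume "r \<in> {free_gen R vs | vs i j. vs \<in> tuples M m \<and> i < j \<and> j < m \<and> vs ! i = vs ! j}"
      then show ?thesis using alt gen by auto
    qed
    then show "r \<in> ?W" using rF by simp
  qed
  then have "ext_kernel R M m \<subseteq> ?W"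
    unfolding ext_kernel_def by (rule submodule_submodule_gen(3)[OF F.module_axioms ext_relations_closed W])
  then show ?thesis using u by blast
qed

end

section \<open>Coordinates on exterior powers\<close>

text \<open>Unlike \<open>free_gen\<close>, this is extensional, as elements of
  \<open>coord_space\<close> have to be.\<close>

definition unit_vec :: "('a, 'b) ring_scheme \<Rightarrow> nat \<Rightarrow> nat \<Rightarrow> nat \<Rightarrow> 'a" where
  "unit_vec R n i = (\<lambda>j\<in>{..<n}. if i = j then \<one>\<^bsub>R\<^esub> else \<zero>\<^bsub>R\<^esub>)"

text \<open>The \<open>m\<close>-element subsets of \<open>{..<n}\<close>, written as sorted lists
  so that they give tuples of unit vectors directly.\<close>

definition inc_lists :: "nat \<Rightarrow> nat \<Rightarrow> nat list set" where
  "inc_lists n m = {t. sorted_wrt (<) t \<and> length t = m \<and> set t \<subseteq> {..<n}}"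

lemma finite_inc_lists: "finite (inc_lists n m)"
  by (rule finite_subset[OF _ finite_lists_length_eq[of "{..<n}" m]]) (auto simp: inc_lists_def)

text \<open>Here \<open>m \<le> n\<close> enters: it ensures that the exterior power has a nonempty
  basis.\<close>

lemma inc_lists_ne: "m \<le> n \<Longrightarrow> inc_lists n m \<noteq> {}"
  by (auto simp: inc_lists_def intro!: exI[of _ "[0..<m]"])

lemma inc_lists_nth: "t \<in> inc_lists n m \<Longrightarrow> c < m \<Longrightarrow> t ! c < n"
  using nth_mem[of c t] by (auto simp: inc_lists_def subset_iff)

locale ext_coords = cring R for R (structure) + fixes n m :: nat
begin

abbreviation V where "V \<equiv> coord_space R n"
abbreviation C where "C \<equiv> free_module R (inc_lists n m)"

sublocale V: module R V by (rule module_coord_space) (rule cring_axioms)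
sublocale C: module R C by (rule module_free_module) (rule cring_axioms)
sublocale F: module R "V.ext_free m" by (rule module_free_module) (rule cring_axioms)
sublocale E: module R "V.ext_power m" by (rule V.module_exterior_power)

lemma V_entry: "v \<in> carrier V \<Longrightarrow> j < n \<Longrightarrow> v j \<in> carrier R"
  by (auto simp: coord_space_simps)

lemma tuples_nth: "vs \<in> tuples V m \<Longrightarrow> i < m \<Longrightarrow> vs ! i \<in> carrier V"
  by (auto simp: tuples_def subset_iff)

lemma unit_vec_closed: "unit_vec R n i \<in> carrier V"
  by (auto simp: unit_vec_def coord_space_simps)

text \<open>Vectors of \<open>coord_space\<close> are undefined off \<open>{..<n}\<close>, those of
  \<open>free_module\<close> are zero there. Restriction is a linear map from the latter onto the
  former and carries \<open>free_module_spanned\<close> over.\<close>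

lemma coord_space_spanned:
  assumes W: "submodule W R V" and gen: "\<And>i. i < n \<Longrightarrow> unit_vec R n i \<in> W"
  shows "W = carrier V"
proof -
  let ?G = "free_module R {..<n}"
  interpret G: module R ?G by (rule module_free_module) (rule cring_axioms)
  define c where "c u = restrict u {..<n}" for u :: "nat \<Rightarrow> 'a"
  have c: "linear_map R ?G V c"
    by (rule linear_mapI) (auto simp: c_def coord_space_simps free_moduleD(1) free_module_simps(3,4) fun_eq_iff)
  have "{u \<in> carrier ?G. c u \<in> W} = carrier ?G"
  proof (rule free_module_spanned[OF G.submodule_vimage[OF V.module_axioms c W]])
    fix b assume b: "b \<in> {..<n}"
    have "c (free_gen R b) = unit_vec R n b" by (auto simp: c_def free_gen_def unit_vec_def fun_eq_iff)
    then show "free_gen R b \<in> {u \<in> carrier ?G. c u \<in> W}" using b gen free_gen_closed[OF b] by simp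
  qed
  moreover have "v \<in> c ` carrier ?G" if v: "v \<in> carrier V" for v
  proof
    let ?u = "\<lambda>i. if i < n then v i else \<zero>"
    show "?u \<in> carrier ?G" using V_entry[OF v] by (intro free_moduleI) auto
    show "v = c ?u" using v by (auto simp: c_def coord_space_simps PiE_iff extensional_def fun_eq_iff)
  qed
  ultimately have "carrier V \<subseteq> W" by blast
  then show ?thesis using V.submoduleE(1)[OF W] by blast
qed

text \<open>By linearity the entries of a wedge can be taken to be unit vectors, one position at a
  time. A wedge of unit vectors vanishes if an index repeats and is otherwise a rearrangement of an
  increasing one.\<close>

lemma wedge_spanned:
  assumes W: "submodule W R (V.ext_power m)"
    and gen: "\<And>t. t \<in> inc_lists n m \<Longrightarrow> V.wedge m (map (unit_vec R n) t) \<in> W"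
  shows "W = carrier (V.ext_power m)"
proof -
  have basis: "V.wedge m (map (unit_vec R n) t) \<in> W" if t: "length t = m" "set t \<subseteq> {..<n}" for t
  proof -
    have tup: "map (unit_vec R n) t \<in> tuples V m" using t unit_vec_closed by (auto simp: tuples_def)
    show ?thesis
    proof (cases "distinct t")
      case True
      have s: "sort t \<in> inc_lists n m" using True t by (simp add: inc_lists_def strict_sorted_iff)
      have "mset t = mset (sort t)" by simp
      then obtain p where p: "p permutes {..<length (sort t)}" "permute_list p (sort t) = t"
        by (rule mset_eq_permutation)
      have "map (unit_vec R n) (sort t) \<in> tuples V m"
        using t unit_vec_closed by (auto simp: tuples_def)
      from V.wedge_permute[OF W _ this gen[OF s], of p] show ?thesis
        using p t by (simp add: permute_list_map)
    next
      case False
      then obtain i j where "i < length t" "j < length t" "i \<noteq> j" "t ! i = t ! j"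
        by (auto simp: distinct_conv_nth)
      then have "V.wedge m (map (unit_vec R n) t) = \<zero>\<^bsub>V.ext_power m\<^esub>"
        using t by (intro V.wedge_eq_entries[OF tup, of i j]) auto
      then show ?thesis using E.submodule_zero_mem[OF W] by simp
    qed
  qed
  \<comment> \<open>\<open>k\<close> counts the leading entries that may be arbitrary; from position
    \<open>k\<close> on they are unit vectors. The case \<open>k = m\<close> is the goal.\<close>
  have "V.wedge m vs \<in> W" if "k \<le> m" "vs \<in> tuples V m" "\<And>j. k \<le> j \<Longrightarrow> j < m \<Longrightarrow> vs ! j \<in> unit_vec R n ` {..<n}" for k vs
    using that
  proof (induction k arbitrary: vs)
    case 0
    then have len: "length vs = m" by (simp add: tuples_def)
    have "\<forall>j\<in>{..<m}. \<exists>i. i < n \<and> vs ! j = unit_vec R n i" using 0 by auto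
    then obtain f where f: "\<And>j. j < m \<Longrightarrow> f j < n \<and> vs ! j = unit_vec R n (f j)" by (metis lessThan_iff)
    have "vs = map (unit_vec R n) (map f [0..<m])"
      using len f by (intro nth_equalityI) auto
    moreover have "set (map f [0..<m]) \<subseteq> {..<n}" using f by auto
    ultimately show ?case using basis[of "map f [0..<m]"] by simp
  next
    case (Suc k)
    have len: "length vs = m" using Suc.prems by (simp add: tuples_def)
    have k: "k < m" using Suc.prems by simp
    let ?A = "{x \<in> carrier V. V.wedge m (vs[k := x]) \<in> W}"
    note WE = E.submoduleE[OF W]
    have wl: "V.wedge m (vs[k := a \<odot>\<^bsub>V\<^esub> x \<oplus>\<^bsub>V\<^esub> y]) \<in> W"
      if "a \<in> carrier R" "x \<in> ?A" "y \<in> ?A" for a x y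
      using that WE(4,5) by (subst V.wedge_linear[OF Suc.prems(2) k]) auto
    have "V.wedge m (vs[k := \<zero>\<^bsub>V\<^esub>]) \<in> carrier (V.ext_power m)"
      by (intro V.wedge_closed V.tuples_update Suc.prems(2) V.M.zero_closed)
    \<comment> \<open>Linearity with scalar minus one and both vectors zero: the wedge is added to
      its own negative.\<close>
    then have z: "V.wedge m (vs[k := \<zero>\<^bsub>V\<^esub>]) = \<zero>\<^bsub>V.ext_power m\<^esub>"
      using V.wedge_linear[OF Suc.prems(2) k _ V.M.zero_closed V.M.zero_closed, of "\<ominus> \<one>"]
      by (simp add: E.M.l_neg flip: E.smult_minus_one)
    have zA: "\<zero>\<^bsub>V\<^esub> \<in> ?A" using z E.submodule_zero_mem[OF W] by simp
    have "submodule ?A R V"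
    proof (rule V.submoduleI')
      fix x y assume "x \<in> ?A" "y \<in> ?A"
      then show "x \<oplus>\<^bsub>V\<^esub> y \<in> ?A" using wl[OF one_closed, of x y] by simp
    next
      fix a x assume "a \<in> carrier R" "x \<in> ?A"
      then show "a \<odot>\<^bsub>V\<^esub> x \<in> ?A" using wl[OF _ _ zA, of a x] by simp
    qed (use zA in auto)
    moreover have "unit_vec R n i \<in> ?A" if i: "i < n" for i
    proof -
      have "V.wedge m (vs[k := unit_vec R n i]) \<in> W"
      proof (rule Suc.IH)
        show "vs[k := unit_vec R n i] \<in> tuples V m" by (rule V.tuples_update[OF Suc.prems(2) unit_vec_closed])
        fix j assume j: "k \<le> j" "j < m"
        show "vs[k := unit_vec R n i] ! j \<in> unit_vec R n ` {..<n}"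
        proof (cases "j = k")
          case True
          then show ?thesis using i len k by simp
        next
          case False
          then show ?thesis using Suc.prems(3)[of j] j by simp
        qed
      qed (use k in simp)
      then show ?thesis using unit_vec_closed by simp
    qed
    ultimately have "?A = carrier V" by (rule coord_space_spanned)
    then have "vs ! k \<in> ?A" using tuples_nth[OF Suc.prems(2) k] by simp
    then show ?case by simp
  qed
  from this[of m] have wedge: "V.wedge m vs \<in> W" if "vs \<in> tuples V m" for vs using that by auto
  let ?U = "{u \<in> carrier (V.ext_free m). V.ext_class m u \<in> W}"
  have "?U = carrier (V.ext_free m)"
    by (rule free_module_spanned[OF F.submodule_vimage[OF E.module_axioms V.linear_map_ext_class W]])
      (use wedge free_gen_closed in \<open>auto simp: V.wedge_def\<close>)
  then have "carrier (V.ext_power m) \<subseteq> W" by (auto elim!: V.ext_power_cases)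
  then show ?thesis using E.submoduleE(1)[OF W] by blast
qed

section \<open>Pluecker coordinates of decomposable wedges\<close>

definition minors :: "(nat \<Rightarrow> 'a) list \<Rightarrow> nat list \<Rightarrow> 'a" where
  "minors vs = (\<lambda>t. if t \<in> inc_lists n m then ring_det R m (\<lambda>i c. (vs ! i) (t ! c)) else \<zero>)"

lemma minors_entry: "vs \<in> tuples V m \<Longrightarrow> t \<in> inc_lists n m \<Longrightarrow> i < m \<Longrightarrow> c < m \<Longrightarrow> (vs ! i) (t ! c) \<in> carrier R"
  by (intro V_entry tuples_nth inc_lists_nth)

lemma minors_closed: "vs \<in> tuples V m \<Longrightarrow> minors vs \<in> carrier C"
  unfolding minors_def using minors_entry
  by (intro free_moduleI finite_inc_lists) (auto intro!: ring_det_closed)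

lemma minors_linear:
  assumes vs: "vs \<in> tuples V m" and k: "k < m" and a: "a \<in> carrier R" and x: "x \<in> carrier V" and y: "y \<in> carrier V"
  shows "minors (vs[k := a \<odot>\<^bsub>V\<^esub> x \<oplus>\<^bsub>V\<^esub> y]) = a \<odot>\<^bsub>C\<^esub> minors (vs[k := x]) \<oplus>\<^bsub>C\<^esub> minors (vs[k := y])"
proof
  fix t
  have len: "length vs = m" using vs by (simp add: tuples_def)
  show "minors (vs[k := a \<odot>\<^bsub>V\<^esub> x \<oplus>\<^bsub>V\<^esub> y]) t = (a \<odot>\<^bsub>C\<^esub> minors (vs[k := x]) \<oplus>\<^bsub>C\<^esub> minors (vs[k := y])) t"
  proof (cases "t \<in> inc_lists n m")
    case True
    let ?E = "\<lambda>i c. (vs ! i) (t ! c)"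
    have upd: "ring_det R m (\<lambda>i c. (vs[k := z] ! i) (t ! c)) = ring_det R m (?E(k := \<lambda>c. z (t ! c)))"
      if "z \<in> carrier V" for z
      using len k minors_entry[OF vs True] V_entry[OF that] inc_lists_nth[OF True]
      by (intro ring_det_cong) (auto simp: nth_list_update)
    have "ring_det R m (?E(k := \<lambda>c. (a \<odot>\<^bsub>V\<^esub> x \<oplus>\<^bsub>V\<^esub> y) (t ! c)))
        = ring_det R m (?E(k := \<lambda>c. a \<otimes> x (t ! c) \<oplus> y (t ! c)))"
      using k a minors_entry[OF vs True] V_entry[OF x] V_entry[OF y] inc_lists_nth[OF True]
      by (intro ring_det_cong) (auto simp: coord_space_simps)
    also have "\<dots> = a \<otimes> ring_det R m (?E(k := \<lambda>c. x (t ! c))) \<oplus> ring_det R m (?E(k := \<lambda>c. y (t ! c)))"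
      using k a minors_entry[OF vs True] V_entry[OF x] V_entry[OF y] inc_lists_nth[OF True]
      by (intro ring_det_row_linear) auto
    finally show ?thesis
      using True upd[of "a \<odot>\<^bsub>V\<^esub> x \<oplus>\<^bsub>V\<^esub> y"] upd[OF x] upd[OF y] a x y
      by (simp add: minors_def free_module_simps(3,4))
  qed (use a in \<open>simp add: minors_def free_module_simps(3,4)\<close>)
qed

lemma minors_alternating:
  assumes "vs \<in> tuples V m" "i < j" "j < m" "vs ! i = vs ! j"
  shows "minors vs = \<zero>\<^bsub>C\<^esub>"
proof
  fix t
  have "ring_det R m (\<lambda>i c. (vs ! i) (t ! c)) = \<zero>" if "t \<in> inc_lists n m"
    using assms minors_entry[OF assms(1) that]
    by (intro ring_det_identical_rows[of m _ i j]) auto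
  then show "minors vs t = \<zero>\<^bsub>C\<^esub> t" by (simp add: minors_def free_module_simps(2))
qed

text \<open>This is the source of linear independence: minors are dual to the wedges of unit
  vectors.\<close>

lemma minors_unit_vec:
  assumes s: "s \<in> inc_lists n m"
  shows "minors (map (unit_vec R n) s) = free_gen R s"
proof
  fix t
  have sl: "sorted_wrt (<) s" "length s = m" using s by (auto simp: inc_lists_def)
  show "minors (map (unit_vec R n) s) t = free_gen R s t"
  proof (cases "t \<in> inc_lists n m")
    case True
    then have tl: "sorted_wrt (<) t" "length t = m" by (auto simp: inc_lists_def)
    have "ring_det R m (\<lambda>i c. (map (unit_vec R n) s ! i) (t ! c)) = ring_det R m (\<lambda>i c. if s ! i = t ! c then \<one> else \<zero>)"
      using sl inc_lists_nth[OF True] by (intro ring_det_cong) (auto simp: unit_vec_def)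
    then show ?thesis using True ring_det_delta[OF sl tl] by (auto simp: minors_def free_gen_def)
  qed (use s in \<open>auto simp: minors_def free_gen_def\<close>)
qed

section \<open>The coordinate isomorphism of the exterior power\<close>

definition coords :: "((nat \<Rightarrow> 'a) list \<Rightarrow> 'a) \<Rightarrow> nat list \<Rightarrow> 'a" where
  "coords = free_ext R minors"

text \<open>A linear choice of representatives: the vector with coordinates \<open>u\<close> is
  written as a combination of tuples of unit vectors.\<close>

definition basis_lift :: "(nat list \<Rightarrow> 'a) \<Rightarrow> (nat \<Rightarrow> 'a) list \<Rightarrow> 'a" where
  "basis_lift = free_map R (map (unit_vec R n))"

lemma linear_map_coords': "linear_map R (V.ext_free m) C coords"
  unfolding coords_def by (rule linear_map_free_ext[OF minors_closed finite_inc_lists])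

lemma map_unit_vec_tuples: "map (unit_vec R n) \<in> inc_lists n m \<rightarrow> tuples V m"
  using unit_vec_closed by (auto simp: tuples_def inc_lists_def)

lemma linear_map_basis_lift: "linear_map R C (V.ext_free m) basis_lift"
  unfolding basis_lift_def by (rule linear_map_free_map[OF map_unit_vec_tuples])

lemma coords_basis_lift:
  assumes "u \<in> carrier C"
  shows "coords (basis_lift u) = u"
proof (rule linear_map_eq_on_gens[OF C.module_axioms linear_map_comp[OF linear_map_basis_lift linear_map_coords'] _ _ assms])
  show "linear_map R C C (\<lambda>u. u)" by (simp add: linear_map_def)
  show "coords (basis_lift (free_gen R b)) = free_gen R b" if b: "b \<in> inc_lists n m" for b
  proof -
    have "map (unit_vec R n) b \<in> tuples V m" using b map_unit_vec_tuples by blast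
    from free_ext_free_gen[OF minors_closed this]
    have "coords (free_gen R (map (unit_vec R n) b)) = minors (map (unit_vec R n) b)"
      unfolding coords_def .
    then show ?thesis by (simp add: basis_lift_def free_map_free_gen minors_unit_vec[OF b])
  qed
qed

lemma coords_kernel: "r \<in> ext_kernel R V m \<Longrightarrow> coords r = \<zero>\<^bsub>C\<^esub>"
  unfolding coords_def
  by (rule V.free_ext_kernel[OF finite_inc_lists minors_closed minors_linear minors_alternating])

lemma coords_cong:
  assumes "u \<in> carrier (V.ext_free m)" "w \<in> carrier (V.ext_free m)" "V.ext_class m u = V.ext_class m w"
  shows "coords u = coords w"
proof -
  obtain r where r: "r \<in> ext_kernel R V m" "u = r \<oplus>\<^bsub>V.ext_free m\<^esub> w"
    by (rule V.ext_class_eqD[OF assms])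
  have "r \<in> carrier (V.ext_free m)"
    using r(1) F.submoduleE(1)[OF V.submodule_ext_kernel] by blast
  then show ?thesis
    using r linear_mapD(2)[OF linear_map_coords' _ assms(2)] coords_kernel linear_mapD(1)[OF linear_map_coords' assms(2)]
    by simp
qed

text \<open>Going from coordinates to classes makes this a composite of linear maps; in the other
  direction a representative of each class would have to be picked.\<close>

definition ext_iso :: "(nat list \<Rightarrow> 'a) \<Rightarrow> ((nat \<Rightarrow> 'a) list \<Rightarrow> 'a) set" where
  "ext_iso u = V.ext_class m (basis_lift u)"

lemma linear_map_ext_iso: "linear_map R C (V.ext_power m) ext_iso"
  unfolding ext_iso_def[abs_def] by (rule linear_map_comp[OF linear_map_basis_lift V.linear_map_ext_class])

text \<open>The image is a submodule containing the wedges of unit vectors for increasing lists, so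
  \<open>wedge_spanned\<close> applies.\<close>

lemma ext_iso_surj: "ext_iso ` carrier C = carrier (V.ext_power m)"
proof (rule wedge_spanned)
  show "submodule (ext_iso ` carrier C) R (V.ext_power m)"
    by (rule C.submodule_image[OF E.module_axioms linear_map_ext_iso C.carrier_is_submodule])
  fix t assume t: "t \<in> inc_lists n m"
  have "V.wedge m (map (unit_vec R n) t) = ext_iso (free_gen R t)"
    by (simp add: ext_iso_def basis_lift_def free_map_free_gen V.wedge_def)
  then show "V.wedge m (map (unit_vec R n) t) \<in> ext_iso ` carrier C"
    using free_gen_closed[OF t] by blast
qed

text \<open>Coordinates of a class may be computed from any representative, not only from
  \<open>basis_lift u\<close>.\<close>

lemma ext_iso_eqD:
  assumes "u \<in> carrier C" "w \<in> carrier (V.ext_free m)" "ext_iso u = V.ext_class m w"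
  shows "u = coords w"
  using coords_cong[OF linear_mapD(1)[OF linear_map_basis_lift assms(1)] assms(2)] assms(1,3)
  by (simp add: ext_iso_def coords_basis_lift)

lemma ext_iso_coords:
  assumes "w \<in> carrier (V.ext_free m)"
  shows "ext_iso (coords w) = V.ext_class m w"
proof -
  have "V.ext_class m w \<in> ext_iso ` carrier C"
    unfolding ext_iso_surj by (rule linear_mapD(1)[OF V.linear_map_ext_class assms])
  then obtain u where u: "u \<in> carrier C" "V.ext_class m w = ext_iso u" by blast
  then show ?thesis using ext_iso_eqD[OF u(1) assms] by simp
qed

lemma ext_iso_inj: "inj_on ext_iso (carrier C)"
proof (rule inj_onI)
  fix u u' assume "u \<in> carrier C" "u' \<in> carrier C" "ext_iso u = ext_iso u'"
  then show "u = u'"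
    using ext_iso_eqD[of u "basis_lift u'"] linear_mapD(1)[OF linear_map_basis_lift] coords_basis_lift
    by (simp add: ext_iso_def)
qed

text \<open>The \<open>m\<close>-th compound matrix of \<open>A\<close>. It is defined through
  representatives rather than by its entries, so that multiplicativity follows from functoriality
  and no Cauchy-Binet formula is involved.\<close>

definition minor_act :: "(nat \<times> nat \<Rightarrow> 'a) \<Rightarrow> (nat list \<Rightarrow> 'a) \<Rightarrow> nat list \<Rightarrow> 'a" where
  "minor_act A u = coords (free_map R (map (mat_act R n A)) (basis_lift u))"

section \<open>The exterior action of one matrix\<close>

context
  fixes A assumes A: "A \<in> carrier (mat_ring R n)"
begin

lemma mat_entry: "i < n \<Longrightarrow> j < n \<Longrightarrow> A (i, j) \<in> carrier R"
  using A by (auto simp: mat_ring_def)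

lemma linear_map_mat_act: "linear_map R V V (mat_act R n A)"
proof (rule linear_mapI)
  fix x assume x: "x \<in> carrier V"
  note xe = V_entry[OF x]
  show "mat_act R n A x \<in> carrier V"
    using xe mat_entry by (auto simp: mat_act_def coord_space_simps intro!: finsum_closed)
  {
    fix y assume y: "y \<in> carrier V"
    note ye = V_entry[OF y]
    have "(\<Oplus>j\<in>{..<n}. A (i, j) \<otimes> (x \<oplus>\<^bsub>V\<^esub> y) j)
        = (\<Oplus>j\<in>{..<n}. A (i, j) \<otimes> x j) \<oplus> (\<Oplus>j\<in>{..<n}. A (i, j) \<otimes> y j)" if i: "i < n" for i
    proof -
      have "(\<Oplus>j\<in>{..<n}. A (i, j) \<otimes> (x \<oplus>\<^bsub>V\<^esub> y) j) = (\<Oplus>j\<in>{..<n}. A (i, j) \<otimes> x j \<oplus> A (i, j) \<otimes> y j)"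
        using xe ye mat_entry[OF i] by (intro finsum_cong') (auto simp: coord_space_simps r_distr)
      also have "\<dots> = (\<Oplus>j\<in>{..<n}. A (i, j) \<otimes> x j) \<oplus> (\<Oplus>j\<in>{..<n}. A (i, j) \<otimes> y j)"
        using xe ye mat_entry[OF i] by (intro finsum_addf) auto
      finally show ?thesis .
    qed
    then show "mat_act R n A (x \<oplus>\<^bsub>V\<^esub> y) = mat_act R n A x \<oplus>\<^bsub>V\<^esub> mat_act R n A y"
      by (auto simp: mat_act_def coord_space_simps(3)[of _ _ _ "restrict _ _"] fun_eq_iff)
  }
  fix a assume a: "a \<in> carrier R"
  have "(\<Oplus>j\<in>{..<n}. A (i, j) \<otimes> (a \<odot>\<^bsub>V\<^esub> x) j) = a \<otimes> (\<Oplus>j\<in>{..<n}. A (i, j) \<otimes> x j)" if i: "i < n" for i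
  proof -
    have "(\<Oplus>j\<in>{..<n}. A (i, j) \<otimes> (a \<odot>\<^bsub>V\<^esub> x) j) = (\<Oplus>j\<in>{..<n}. a \<otimes> (A (i, j) \<otimes> x j))"
      using xe mat_entry[OF i] a by (intro finsum_cong') (auto simp: coord_space_simps m_lcomm)
    also have "\<dots> = a \<otimes> (\<Oplus>j\<in>{..<n}. A (i, j) \<otimes> x j)"
      using xe mat_entry[OF i] a by (intro finsum_rdistr[symmetric]) auto
    finally show ?thesis .
  qed
  then show "mat_act R n A (a \<odot>\<^bsub>V\<^esub> x) = a \<odot>\<^bsub>V\<^esub> mat_act R n A x"
    by (auto simp: mat_act_def coord_space_simps(4)[of _ _ _ "restrict _ _"] fun_eq_iff)
qed

lemma mat_act_unit_vec:
  assumes "j < n" "i < n"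
  shows "mat_act R n A (unit_vec R n j) i = A (i, j)"
proof -
  have "mat_act R n A (unit_vec R n j) i = (\<Oplus>k\<in>{..<n}. if j = k then A (i, k) else \<zero>)"
    using assms mat_entry by (auto simp: mat_act_def unit_vec_def intro!: finsum_cong')
  also have "\<dots> = A (i, j)"
    by (rule finsum_singleton[where f = "\<lambda>k. A (i, k)"]) (use assms mat_entry in auto)
  finally show ?thesis .
qed

lemma map_mat_act_tuples: "map (mat_act R n A) \<in> tuples V m \<rightarrow> tuples V m"
  using linear_mapD(1)[OF linear_map_mat_act] by (auto simp: tuples_def subset_iff)

lemma linear_map_free_map_mat_act:
  "linear_map R (V.ext_free m) (V.ext_free m) (free_map R (map (mat_act R n A)))"
  by (rule linear_map_free_map[OF map_mat_act_tuples])

lemma linear_map_minor_act: "linear_map R C C (minor_act A)"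
  unfolding minor_act_def[abs_def]
  by (rule linear_map_comp[OF linear_map_comp[OF linear_map_basis_lift linear_map_free_map_mat_act] linear_map_coords'])

lemma exterior_map_class:
  assumes "w \<in> carrier (V.ext_free m)"
  shows "exterior_map R V m (mat_act R n A) (V.ext_class m w) = V.ext_class m (free_map R (map (mat_act R n A)) w)"
  unfolding V.ext_class_def
  by (rule V.exterior_map_coset) (use assms linear_mapD[OF linear_map_mat_act] in auto)

lemma exterior_map_iso:
  assumes "u \<in> carrier C"
  shows "exterior_map R V m (mat_act R n A) (ext_iso u) = ext_iso (minor_act A u)"
proof -
  have w: "basis_lift u \<in> carrier (V.ext_free m)" by (rule linear_mapD(1)[OF linear_map_basis_lift assms])
  show ?thesis
    unfolding minor_act_def ext_iso_coords[OF linear_mapD(1)[OF linear_map_free_map_mat_act w]]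
    unfolding ext_iso_def by (rule exterior_map_class[OF w])
qed

text \<open>Both sides are coordinates of the same class. It removes the lift that stands between
  the two factors when compound matrices are composed.\<close>

lemma minor_act_coords:
  assumes w: "w \<in> carrier (V.ext_free m)"
  shows "minor_act A (coords w) = coords (free_map R (map (mat_act R n A)) w)"
proof (rule ext_iso_eqD)
  have c: "coords w \<in> carrier C" by (rule linear_mapD(1)[OF linear_map_coords' w])
  show "minor_act A (coords w) \<in> carrier C" by (rule linear_mapD(1)[OF linear_map_minor_act c])
  show "free_map R (map (mat_act R n A)) w \<in> carrier (V.ext_free m)"
    by (rule linear_mapD(1)[OF linear_map_free_map_mat_act w])
  show "ext_iso (minor_act A (coords w)) = V.ext_class m (free_map R (map (mat_act R n A)) w)"
    unfolding exterior_map_iso[OF c, symmetric] ext_iso_coords[OF w] by (rule exterior_map_class[OF w])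
qed

text \<open>In \<open>minors\<close> the rows belong to the wedge factors, here the columns of
  \<open>A\<close> selected by \<open>s\<close>. So the submatrix of \<open>A\<close> appears
  transposed, and the formula is kept in that form.\<close>

lemma minor_act_entry:
  assumes s: "s \<in> inc_lists n m" and t: "t \<in> inc_lists n m"
  shows "minor_act A (free_gen R s) t = ring_det R m (\<lambda>i c. A (t ! c, s ! i))"
proof -
  have "map (mat_act R n A) (map (unit_vec R n) s) \<in> tuples V m"
    using s map_unit_vec_tuples map_mat_act_tuples by blast
  from free_ext_free_gen[OF minors_closed this]
  have "minor_act A (free_gen R s) = minors (map (mat_act R n A) (map (unit_vec R n) s))"
    unfolding minor_act_def basis_lift_def free_map_free_gen coords_def .
  moreover have "ring_det R m (\<lambda>i c. (map (mat_act R n A) (map (unit_vec R n) s) ! i) (t ! c))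
      = ring_det R m (\<lambda>i c. A (t ! c, s ! i))"
    using s inc_lists_nth[OF s] inc_lists_nth[OF t] mat_entry
    by (intro ring_det_cong) (auto simp: inc_lists_def mat_act_unit_vec)
  ultimately show ?thesis using t by (simp add: minors_def)
qed

end

lemma mat_act_mult:
  assumes A: "A \<in> carrier (mat_ring R n)" and B: "B \<in> carrier (mat_ring R n)" and v: "v \<in> carrier V"
  shows "mat_act R n (A \<otimes>\<^bsub>mat_ring R n\<^esub> B) v = mat_act R n A (mat_act R n B v)"
proof
  fix i
  note ent = mat_entry[OF A] mat_entry[OF B] V_entry[OF v]
  show "mat_act R n (A \<otimes>\<^bsub>mat_ring R n\<^esub> B) v i = mat_act R n A (mat_act R n B v) i"
  proof (cases "i < n")
    case True
    have "(\<Oplus>j\<in>{..<n}. (A \<otimes>\<^bsub>mat_ring R n\<^esub> B) (i, j) \<otimes> v j)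
        = (\<Oplus>j\<in>{..<n}. \<Oplus>k\<in>{..<n}. A (i, k) \<otimes> B (k, j) \<otimes> v j)"
      using True ent by (intro finsum_cong') (auto simp: mat_ring_def finsum_ldistr Pi_iff)
    also have "\<dots> = (\<Oplus>k\<in>{..<n}. \<Oplus>j\<in>{..<n}. A (i, k) \<otimes> B (k, j) \<otimes> v j)"
      using True ent by (intro finsum_swap) auto
    also have "\<dots> = (\<Oplus>k\<in>{..<n}. A (i, k) \<otimes> (\<Oplus>j\<in>{..<n}. B (k, j) \<otimes> v j))"
    proof (rule finsum_cong')
      fix k assume k: "k \<in> {..<n}"
      have "(\<Oplus>j\<in>{..<n}. A (i, k) \<otimes> B (k, j) \<otimes> v j) = (\<Oplus>j\<in>{..<n}. A (i, k) \<otimes> (B (k, j) \<otimes> v j))"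
        using True ent k by (intro finsum_cong') (auto simp: m_assoc)
      also have "\<dots> = A (i, k) \<otimes> (\<Oplus>j\<in>{..<n}. B (k, j) \<otimes> v j)"
        using True ent k by (intro finsum_rdistr[symmetric]) auto
      finally show "(\<Oplus>j\<in>{..<n}. A (i, k) \<otimes> B (k, j) \<otimes> v j) = A (i, k) \<otimes> (\<Oplus>j\<in>{..<n}. B (k, j) \<otimes> v j)" .
    qed (use True ent in \<open>auto intro!: finsum_closed\<close>)
    also have "\<dots> = (\<Oplus>k\<in>{..<n}. A (i, k) \<otimes> mat_act R n B v k)"
      using True ent by (intro finsum_cong') (auto simp: mat_act_def Pi_iff)
    finally show ?thesis using True by (simp add: mat_act_def)
  qed (simp add: mat_act_def)
qed

lemma mat_act_one:
  assumes v: "v \<in> carrier V"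
  shows "mat_act R n \<one>\<^bsub>mat_ring R n\<^esub> v = v"
proof
  fix i
  show "mat_act R n \<one>\<^bsub>mat_ring R n\<^esub> v i = v i"
  proof (cases "i < n")
    case True
    have "(\<Oplus>j\<in>{..<n}. \<one>\<^bsub>mat_ring R n\<^esub> (i, j) \<otimes> v j) = (\<Oplus>j\<in>{..<n}. if i = j then v j else \<zero>)"
      using True V_entry[OF v] by (intro finsum_cong') (auto simp: mat_ring_def)
    also have "\<dots> = v i" by (rule finsum_singleton) (use True V_entry[OF v] in auto)
    finally show ?thesis using True by (simp add: mat_act_def)
  qed (use v in \<open>auto simp: mat_act_def coord_space_simps PiE_iff extensional_def\<close>)
qed

text \<open>On generators the actions on tuples compose by \<open>mat_act_mult\<close>; passing to
  coordinates between the two actions is harmless by \<open>minor_act_coords\<close>.\<close>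

lemma minor_act_mult:
  assumes A: "A \<in> carrier (mat_ring R n)" and B: "B \<in> carrier (mat_ring R n)" and u: "u \<in> carrier C"
  shows "minor_act (A \<otimes>\<^bsub>mat_ring R n\<^esub> B) u = minor_act A (minor_act B u)"
proof -
  interpret MR: monoid "mat_ring R n" by (rule monoid_mat_ring) (rule cring_axioms)
  have AB: "A \<otimes>\<^bsub>mat_ring R n\<^esub> B \<in> carrier (mat_ring R n)" using A B by simp
  let ?f = "\<lambda>A. free_map R (map (mat_act R n A))"
  have w: "basis_lift u \<in> carrier (V.ext_free m)" by (rule linear_mapD(1)[OF linear_map_basis_lift u])
  have "?f (A \<otimes>\<^bsub>mat_ring R n\<^esub> B) (basis_lift u) = ?f A (?f B (basis_lift u))"
    by (rule linear_map_eq_on_gens[OF F.module_axioms linear_map_free_map_mat_act[OF AB]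
          linear_map_comp[OF linear_map_free_map_mat_act[OF B] linear_map_free_map_mat_act[OF A]] _ w])
      (auto simp: free_map_free_gen tuples_def subset_iff mat_act_mult[OF A B] intro!: arg_cong[where f = "free_gen R"])
  then show ?thesis
    using minor_act_coords[OF A linear_mapD(1)[OF linear_map_free_map_mat_act[OF B] w]]
    by (simp add: minor_act_def)
qed

lemma minor_act_one:
  assumes u: "u \<in> carrier C"
  shows "minor_act \<one>\<^bsub>mat_ring R n\<^esub> u = u"
proof -
  interpret MR: monoid "mat_ring R n" by (rule monoid_mat_ring) (rule cring_axioms)
  have w: "basis_lift u \<in> carrier (V.ext_free m)" by (rule linear_mapD(1)[OF linear_map_basis_lift u])
  have id: "linear_map R (V.ext_free m) (V.ext_free m) (\<lambda>w. w)" by (simp add: linear_map_def)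
  have "free_map R (map (mat_act R n \<one>\<^bsub>mat_ring R n\<^esub>)) (basis_lift u) = basis_lift u"
    by (rule linear_map_eq_on_gens[OF F.module_axioms linear_map_free_map_mat_act[OF MR.one_closed] id _ w])
      (auto simp: free_map_free_gen tuples_def subset_iff mat_act_one intro!: arg_cong[where f = "free_gen R"] map_idI)
  then show ?thesis by (simp add: minor_act_def coords_basis_lift[OF u])
qed

end

section \<open>Openness\<close>

text \<open>An equivariant linear bijection matches the invariant submodules on both sides. It
  replaces the abstract exterior power by its coordinate space, to which \<open>coord_rep\<close>
  applies.\<close>

lemma irreducible_rep_transport:
  assumes M: "module K M" and N: "module K N" and f: "linear_map K M N f"
    and inj: "inj_on f (carrier M)" and surj: "f ` carrier M = carrier N"
    and eqv: "\<And>g v. g \<in> carrier G \<Longrightarrow> v \<in> carrier M \<Longrightarrow> \<rho>' g (f v) = f (\<rho> g v)"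
    and cl: "\<And>g v. g \<in> carrier G \<Longrightarrow> v \<in> carrier M \<Longrightarrow> \<rho> g v \<in> carrier M"
  shows "irreducible_rep K N G \<rho>' \<longleftrightarrow> irreducible_rep K M G \<rho>"
proof -
  interpret M: module K M by fact
  interpret N: module K N by fact
  have f0: "f \<zero>\<^bsub>M\<^esub> = \<zero>\<^bsub>N\<^esub>" by (rule M.linear_map_zero[OF N f])
  have im_eq: "f ` A = f ` B \<longleftrightarrow> A = B" if "A \<subseteq> carrier M" "B \<subseteq> carrier M" for A B
    by (rule inj_on_image_eq_iff[OF inj that])
  have im0: "f ` {\<zero>\<^bsub>M\<^esub>} = {\<zero>\<^bsub>N\<^esub>}" by (simp add: f0)
  have ne: "carrier N \<noteq> {\<zero>\<^bsub>N\<^esub>} \<longleftrightarrow> carrier M \<noteq> {\<zero>\<^bsub>M\<^esub>}"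
    using im_eq[of "carrier M" "{\<zero>\<^bsub>M\<^esub>}"] by (simp add: surj f0)
  have inv: "(\<forall>g\<in>carrier G. \<rho>' g ` f ` W \<subseteq> f ` W) \<longleftrightarrow> (\<forall>g\<in>carrier G. \<rho> g ` W \<subseteq> W)" if W: "W \<subseteq> carrier M" for W
  proof -
    have "\<rho>' g ` f ` W = f ` \<rho> g ` W" if g: "g \<in> carrier G" for g
      unfolding image_image by (rule image_cong[OF refl]) (use eqv[OF g] W in auto)
    moreover have "f ` \<rho> g ` W \<subseteq> f ` W \<longleftrightarrow> \<rho> g ` W \<subseteq> W" if g: "g \<in> carrier G" for g
      unfolding image_subset_iff using inj_on_image_mem_iff[OF inj cl[OF g] W] by (auto simp: subsetD[OF W])
    ultimately show ?thesis by simp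
  qed
  \<comment> \<open>Every submodule of \<open>N\<close> is the image of its preimage, so quantifying
    over submodules of \<open>N\<close> is quantifying over images.\<close>
  have sub: "submodule W' K N \<longleftrightarrow> (\<exists>W. submodule W K M \<and> W' = f ` W)" for W'
  proof
    assume W': "submodule W' K N"
    have "W' = f ` {x \<in> carrier M. f x \<in> W'}"
      using N.submoduleE(1)[OF W'] unfolding surj[symmetric] by (auto simp: subset_iff image_iff)
    then show "\<exists>W. submodule W K M \<and> W' = f ` W"
      using M.submodule_vimage[OF N f W'] by blast
  qed (use M.submodule_image[OF N f] in blast)
  have "(\<forall>W'. submodule W' K N \<and> (\<forall>g\<in>carrier G. \<rho>' g ` W' \<subseteq> W') \<longrightarrow> W' = {\<zero>\<^bsub>N\<^esub>} \<or> W' = carrier N)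
    \<longleftrightarrow> (\<forall>W. submodule W K M \<and> (\<forall>g\<in>carrier G. \<rho>' g ` f ` W \<subseteq> f ` W) \<longrightarrow> f ` W = f ` {\<zero>\<^bsub>M\<^esub>} \<or> f ` W = f ` carrier M)"
    unfolding sub im0 surj by blast
  also have "\<dots> \<longleftrightarrow> (\<forall>W. submodule W K M \<and> (\<forall>g\<in>carrier G. \<rho> g ` W \<subseteq> W) \<longrightarrow> W = {\<zero>\<^bsub>M\<^esub>} \<or> W = carrier M)"
  proof (intro arg_cong[where f = All] ext)
    fix W
    show "(submodule W K M \<and> (\<forall>g\<in>carrier G. \<rho>' g ` f ` W \<subseteq> f ` W) \<longrightarrow> f ` W = f ` {\<zero>\<^bsub>M\<^esub>} \<or> f ` W = f ` carrier M)
      \<longleftrightarrow> (submodule W K M \<and> (\<forall>g\<in>carrier G. \<rho> g ` W \<subseteq> W) \<longrightarrow> W = {\<zero>\<^bsub>M\<^esub>} \<or> W = carrier M)"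
    proof (cases "submodule W K M")
      case True
      then have W: "W \<subseteq> carrier M" by (rule M.submoduleE(1))
      have "f ` W = f ` {\<zero>\<^bsub>M\<^esub>} \<longleftrightarrow> W = {\<zero>\<^bsub>M\<^esub>}" "f ` W = f ` carrier M \<longleftrightarrow> W = carrier M"
        using W by (auto simp: im_eq simp del: image_insert image_empty)
      then show ?thesis using inv[OF W] by simp
    qed simp
  qed
  finally show ?thesis unfolding irreducible_rep_def using ne by simp
qed

text \<open>Burnside's theorem is applied to the compound matrices, and their entries are then
  replaced by explicit minors, which can be compared across base change.\<close>

lemma m_dense_iff_spanning:
  assumes L: "algebraically_closed L" and G: "group G" and \<rho>: "\<rho> \<in> hom G (GL L n)" and m: "m \<le> n"
  shows "m_dense L (coord_space L n) G (\<lambda>g. mat_act L n (\<rho> g)) m \<longleftrightarrow>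
    spanning L (inc_lists n m \<times> inc_lists n m)
      ((\<lambda>g (t, s). ring_det L m (\<lambda>i c. \<rho> g (t ! c, s ! i))) ` carrier G)"
proof -
  interpret L: algebraically_closed L by fact
  interpret G: group G by fact
  interpret ext_coords L n m by unfold_locales
  \<comment> \<open>Membership in \<open>hom\<close> records multiplicativity only; that the
    identity of \<open>G\<close> acts as the identity matrix uses that \<open>GL L n\<close> is a
    group.\<close>
  interpret GLn: group "GL L n" by (rule group_GL) (rule L.cring_axioms)
  interpret hom: group_hom G "GL L n" \<rho> by unfold_locales (rule \<rho>)
  have car: "\<rho> g \<in> carrier (mat_ring L n)" if "g \<in> carrier G" for g
    using hom.hom_closed[OF that] by (simp add: GL_def units_of_def Units_def)
  have mult: "\<rho> (g \<otimes>\<^bsub>G\<^esub> h) = \<rho> g \<otimes>\<^bsub>mat_ring L n\<^esub> \<rho> h" if "g \<in> carrier G" "h \<in> carrier G" for g h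
    using hom.hom_mult[OF that] by (simp add: GL_def units_of_def)
  have one: "\<rho> \<one>\<^bsub>G\<^esub> = \<one>\<^bsub>mat_ring L n\<^esub>"
    using hom.hom_one by (simp add: GL_def units_of_def)
  interpret B: coord_rep L G "inc_lists n m" "\<lambda>g. minor_act (\<rho> g)"
  proof (intro coord_rep.intro coord_rep_axioms.intro)
    show "inc_lists n m \<noteq> {}" by (rule inc_lists_ne[OF m])
    show "minor_act (\<rho> (g \<otimes>\<^bsub>G\<^esub> h)) v = minor_act (\<rho> g) (minor_act (\<rho> h) v)"
      if "g \<in> carrier G" "h \<in> carrier G" "v \<in> carrier C" for g h v
      unfolding mult[OF that(1,2)] by (rule minor_act_mult[OF car[OF that(1)] car[OF that(2)] that(3)])
    show "minor_act (\<rho> \<one>\<^bsub>G\<^esub>) v = v" if "v \<in> carrier C" for v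
      unfolding one by (rule minor_act_one[OF that])
  qed (auto simp: L.algebraically_closed_axioms G.is_monoid finite_inc_lists linear_map_minor_act car)
  have "m_dense L (coord_space L n) G (\<lambda>g. mat_act L n (\<rho> g)) m
      \<longleftrightarrow> irreducible_rep L C G (\<lambda>g. minor_act (\<rho> g))"
    unfolding m_dense_def
    by (rule irreducible_rep_transport[OF C.module_axioms E.module_axioms linear_map_ext_iso ext_iso_inj ext_iso_surj])
      (rule exterior_map_iso[OF car] linear_mapD(1)[OF linear_map_minor_act[OF car]]; assumption)+
  also have "\<dots> \<longleftrightarrow> spanning L (inc_lists n m \<times> inc_lists n m)
      ((\<lambda>g (t, s). minor_act (\<rho> g) (free_gen L s) t) ` carrier G)"
    by (rule B.irreducible_iff_spanning)
  also have "\<dots> \<longleftrightarrow> spanning L (inc_lists n m \<times> inc_lists n m)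
      ((\<lambda>g (t, s). ring_det L m (\<lambda>i c. \<rho> g (t ! c, s ! i))) ` carrier G)"
  proof (rule L.spanning_cong, goal_cases)
    case (1 x)
    then show ?case using car minor_act_entry by fastforce
  next
    case (2 x)
    then show ?case using car minor_act_entry by fastforce
  next
    case (3 x d)
    then show ?case
      by (auto intro: L.free_moduleD(1)[OF B.rho_closed[OF _ L.free_gen_closed]])
  qed
  finally show ?thesis .
qed

lemma abs_m_dense_iff_spanning:
  assumes K: "field K" and G: "group G" and \<rho>: "\<rho> \<in> hom G (GL K n)" and m: "m \<le> n"
  shows "abs_m_dense K n G \<rho> m \<longleftrightarrow>
    spanning (field.alg_closure K) (inc_lists n m \<times> inc_lists n m)
      ((\<lambda>g (t, s). ring_det (field.alg_closure K) m
          (\<lambda>i c. mat_map n (ring.indexed_const K) (\<rho> g) (t ! c, s ! i))) ` carrier G)"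
proof -
  interpret K: field K by fact
  interpret L: algebraic_closure K.alg_closure "K.indexed_const ` carrier K" by (rule K.alg_closureE)
  have "mat_map n K.indexed_const \<in> hom (GL K n) (GL K.alg_closure n)"
    by (rule mat_map_hom[OF K.cring_axioms L.cring_axioms K.alg_closureE(2)])
  then have hom: "(\<lambda>g. mat_map n K.indexed_const (\<rho> g)) \<in> hom G (GL K.alg_closure n)"
    using \<rho> unfolding hom_def by auto
  show ?thesis
    unfolding abs_m_dense_def alg_closure_rep_def[abs_def]
    by (rule m_dense_iff_spanning[OF L.algebraically_closed_axioms G hom m])
qed

text \<open>The closures of all residue fields live on one type, which is the \<open>'l\<close> of
  \<open>spanning_open\<close>. One set \<open>T\<close> therefore serves every point of the
  family.\<close>

lemma spanning_open_family:
  fixes L :: "'x \<Rightarrow> 'l ring"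
  assumes "cring A" "finite D" "S \<subseteq> D \<rightarrow> carrier A" and L: "\<And>x. x \<in> I \<Longrightarrow> field (L x)"
  obtains T where "T \<subseteq> carrier A"
    and "\<And>x h. x \<in> I \<Longrightarrow> h \<in> ring_hom A (L x) \<Longrightarrow>
      spanning (L x) D ((\<lambda>s. h \<circ> s) ` S) \<longleftrightarrow> (\<exists>t\<in>T. h t \<noteq> \<zero>\<^bsub>L x\<^esub>)"
  using spanning_open[OF assms(1-3), where 'l = 'l] L by blast

lemma openin_abs_m_dense:
  assumes G: "group G" and m: "m \<le> n"
  shows "openin (Rep G n)
           {x \<in> Spec (rep_ring G n). abs_m_dense (residue_field (rep_ring G n) x) n G (rep_at G n x) m}"
proof -
  let ?A = "rep_ring G n" and ?D = "inc_lists n m \<times> inc_lists n m"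
  interpret A: cring ?A by (rule cring_rep_ring[OF G])
  \<comment> \<open>The compound matrices of the universal representation; the families at all
    points are images of this one.\<close>
  let ?S = "(\<lambda>g (t, s). ring_det ?A m (\<lambda>i c. univ_rep G n g (t ! c, s ! i))) ` carrier G"
  have ent: "univ_rep G n g (i, j) \<in> carrier ?A" if "g \<in> carrier G" "i < n" "j < n" for g i j
  proof -
    have "univ_rep G n g \<in> carrier (mat_ring ?A n)"
      using univ_rep_hom[OF G, of n] that(1) by (auto simp: hom_def GL_def units_of_def Units_def)
    then show ?thesis using that by (auto simp: mat_ring_def)
  qed
  have S: "?S \<subseteq> ?D \<rightarrow> carrier ?A"
    by (auto intro!: A.ring_det_closed ent inc_lists_nth)
  have "field (field.alg_closure (residue_field ?A x))" if x: "x \<in> Spec ?A" for x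
    using field.alg_closureE(1)[OF field_residue_field[OF x]] by (simp add: algebraic_closure_def)
  then obtain T where T: "T \<subseteq> carrier ?A"
    and spanT: "\<And>x h. x \<in> Spec ?A \<Longrightarrow> h \<in> ring_hom ?A (field.alg_closure (residue_field ?A x)) \<Longrightarrow>
      spanning (field.alg_closure (residue_field ?A x)) ?D ((\<lambda>s. h \<circ> s) ` ?S)
        \<longleftrightarrow> (\<exists>t\<in>T. h t \<noteq> \<zero>\<^bsub>field.alg_closure (residue_field ?A x)\<^esub>)"
    using spanning_open_family[of ?A ?D ?S "Spec ?A" "\<lambda>x. field.alg_closure (residue_field ?A x)"]
      A.cring_axioms S finite_inc_lists[of n m] by blast
  have "abs_m_dense (residue_field ?A x) n G (rep_at G n x) m \<longleftrightarrow> \<not> T \<subseteq> x" if x: "x \<in> Spec ?A" for x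
  proof -
    define K where "K = residue_field ?A x"
    interpret K: field K unfolding K_def by (rule field_residue_field[OF x])
    interpret L: algebraic_closure K.alg_closure "K.indexed_const ` carrier K" by (rule K.alg_closureE)
    define r where "r = residue_map ?A x"
    have r: "r \<in> ring_hom ?A K" unfolding r_def K_def by (rule residue_map_hom[OF x])
    interpret r: ring_hom_cring ?A K r by unfold_locales (rule r)
    interpret c: ring_hom_cring K K.alg_closure K.indexed_const by unfold_locales (rule K.alg_closureE)
    obtain h where h_def: "h = K.indexed_const \<circ> r" and h: "h \<in> ring_hom ?A K.alg_closure"
      using ring_hom_trans[OF r K.alg_closureE(2)] by blast
    interpret h: ring_hom_cring ?A K.alg_closure h by unfold_locales (rule h)
    have hom: "rep_at G n x \<in> hom G (GL K n)" unfolding K_def by (rule rep_at_hom[OF G x])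
    have "abs_m_dense K n G (rep_at G n x) m \<longleftrightarrow> spanning K.alg_closure ?D
        ((\<lambda>g (t, s). ring_det K.alg_closure m
            (\<lambda>i c. mat_map n K.indexed_const (rep_at G n x g) (t ! c, s ! i))) ` carrier G)"
      by (rule abs_m_dense_iff_spanning[OF K.field_axioms G hom m])
    also have "\<dots> \<longleftrightarrow> spanning K.alg_closure ?D ((\<lambda>s. h \<circ> s) ` ?S)"
    proof -
      \<comment> \<open>A determinant commutes with the ring homomorphism \<open>h\<close>, and both
        steps from the universal representation to the closure act entry by entry.\<close>
      have eq: "ring_det K.alg_closure m (\<lambda>i c. mat_map n K.indexed_const (rep_at G n x g) (t ! c, s ! i))
          = h (ring_det ?A m (\<lambda>i c. univ_rep G n g (t ! c, s ! i)))"
        if "g \<in> carrier G" "t \<in> inc_lists n m" "s \<in> inc_lists n m" for g t s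
        using that ent inc_lists_nth h.hom_closed
        by (subst h.hom_ring_det) (auto simp: rep_at_def mat_map_def h_def r_def intro!: L.ring_det_cong)
      have "ring_det K.alg_closure m (\<lambda>i c. mat_map n K.indexed_const (rep_at G n x g) (t ! c, s ! i)) \<in> carrier K.alg_closure"
        if "g \<in> carrier G" "t \<in> inc_lists n m" "s \<in> inc_lists n m" for g t s
        unfolding eq[OF that] using that by (intro h.hom_closed A.ring_det_closed ent inc_lists_nth)
      then show ?thesis
        using eq by (intro L.spanning_cong) fastforce+
    qed
    also have "\<dots> \<longleftrightarrow> (\<exists>t\<in>T. h t \<noteq> \<zero>\<^bsub>K.alg_closure\<^esub>)"
      using spanT[OF x] h unfolding K_def by blast
    also have "\<dots> \<longleftrightarrow> (\<exists>t\<in>T. t \<notin> x)"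
    proof (rule bex_cong[OF refl])
      fix t assume "t \<in> T"
      then have t: "t \<in> carrier ?A" using T by blast
      \<comment> \<open>The embedding of the residue field into its closure is injective, so
        vanishing is decided in the residue field.\<close>
      have "h t = \<zero>\<^bsub>K.alg_closure\<^esub> \<longleftrightarrow> r t = \<zero>\<^bsub>K\<^esub>"
      proof
        assume "h t = \<zero>\<^bsub>K.alg_closure\<^esub>"
        then have "K.indexed_const (r t) = \<zero>\<^bsub>K.alg_closure\<^esub>" by (simp add: h_def)
        also have "\<dots> = K.indexed_const \<zero>\<^bsub>K\<^esub>" by simp
        finally show "r t = \<zero>\<^bsub>K\<^esub>" by (rule inj_onD[OF K.indexed_const_inj_on]) (use t in auto)
      qed (simp add: h_def)
      also have "\<dots> \<longleftrightarrow> t \<in> x" unfolding r_def K_def by (rule residue_map_eq_zero_iff[OF x t])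
      finally show "h t \<noteq> \<zero>\<^bsub>K.alg_closure\<^esub> \<longleftrightarrow> t \<notin> x" by simp
    qed
    finally show ?thesis unfolding K_def by blast
  qed
  then have "{x \<in> Spec ?A. abs_m_dense (residue_field ?A x) n G (rep_at G n x) m} = {x \<in> Spec ?A. \<not> T \<subseteq> x}"
    by blast
  then show ?thesis using T openin_zariski[OF A.cring_axioms] by auto
qed

lemma openin_Spec: "cring A \<Longrightarrow> openin (zariski A) (Spec A)"
proof -
  assume A: "cring A"
  interpret cring A by fact
  \<comment> \<open>A prime ideal is proper, so the single function one exhibits the whole spectrum
    as open.\<close>
  have "\<not> {\<one>\<^bsub>A\<^esub>} \<subseteq> P" if "P \<in> Spec A" for P
  proof -
    interpret primeideal P A using that by (simp add: Spec_def)
    show ?thesis using one_imp_carrier I_notcarr by blast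
  qed
  then have "Spec A = {P \<in> Spec A. \<not> {\<one>\<^bsub>A\<^esub>} \<subseteq> P}" by blast
  then show "openin (zariski A) (Spec A)"
    unfolding openin_zariski[OF A] by (intro exI[of _ "{\<one>\<^bsub>A\<^esub>}"]) auto
qed

theorem proposition3p11:
  fixes G :: "('g, 'd) monoid_scheme" and n :: nat
  assumes "group G" and "0 < n"
  shows "(\<forall>m. 0 < m \<and> m < n \<longrightarrow>
           openin (Rep G n)
             {x \<in> Spec (rep_ring G n).
                abs_m_dense (residue_field (rep_ring G n) x) n G (rep_at G n x) m}) \<and>
         openin (Rep G n)
           {x \<in> Spec (rep_ring G n).
              abs_dense (residue_field (rep_ring G n) x) n G (rep_at G n x)}"
proof
  let ?U = "\<lambda>m. {x \<in> Spec (rep_ring G n). abs_m_dense (residue_field (rep_ring G n) x) n G (rep_at G n x) m}"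
  show "\<forall>m. 0 < m \<and> m < n \<longrightarrow> openin (Rep G n) (?U m)"
    using openin_abs_m_dense[OF assms(1)] by simp
  \<comment> \<open>Absolute density is a finite conjunction of open conditions. The factor
    \<open>Spec\<close> gives the empty intersection its meaning, which is the case
    \<open>n = 1\<close>.\<close>
  have "openin (Rep G n) (Spec (rep_ring G n) \<inter> (\<Inter>m\<in>M. ?U m))" if "finite M" "M \<subseteq> {0<..<n}" for M
    using that
  proof (induction M)
    case empty
    then show ?case using openin_Spec[OF cring_rep_ring[OF assms(1)]] by simp
  next
    case (insert m M)
    have "openin (Rep G n) (?U m \<inter> (Spec (rep_ring G n) \<inter> (\<Inter>m\<in>M. ?U m)))"
      by (intro openin_Int openin_abs_m_dense[OF assms(1)] insert.IH) (use insert.prems in auto)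
    also have "?U m \<inter> (Spec (rep_ring G n) \<inter> (\<Inter>m\<in>M. ?U m)) = Spec (rep_ring G n) \<inter> (\<Inter>m\<in>insert m M. ?U m)"
      by blast
    finally show ?case .
  qed
  then have "openin (Rep G n) (Spec (rep_ring G n) \<inter> (\<Inter>m\<in>{0<..<n}. ?U m))" by simp
  also have "Spec (rep_ring G n) \<inter> (\<Inter>m\<in>{0<..<n}. ?U m)
      = {x \<in> Spec (rep_ring G n). abs_dense (residue_field (rep_ring G n) x) n G (rep_at G n x)}"
    by (auto simp: abs_dense_def dense_rep_def abs_m_dense_def)
  finally show "openin (Rep G n)
      {x \<in> Spec (rep_ring G n). abs_dense (residue_field (rep_ring G n) x) n G (rep_at G n x)}" .
qed

end
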